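(* Let $M$ be an oriented non-maximal space-like surface in $\mathbb E^4_1$. Then $M$ has pointwise 1-type Gauss map of the first kind if and only if $M$ has parallel mean curvature vector.
   Context: $\mathbb E^4_1$ is the Minkowski space, i.e. $\mathbb R^4$ with the metric $-dx_1^2+dx_2^2+dx_3^2+dx_4^2$. A surface $M$ in $\mathbb E^4_1$ is space-like if every nonzero tangent vector $v$ satisfies $\langle v,v\rangle>0$. Let $\widetilde\nabla$ and $\nabla$ be the Levi-Civita connections of $\mathbb E^4_1$ and $M$. The second fundamental form $h$, shape operators $A_\xi$ and normal connection $D$ are defined by $\widetilde\nabla_XY=\nabla_XY+h(X,Y)$ and $\widetilde\nabla_X\xi=-A_\xi(X)+D_X\xi$, for $X,Y$ tangent and $\xi$ normal. The mean curvature vector is $H=\frac12(h(e_1,e_1)+h(e_2,e_2))$ for an orthonormal tangent frame $\{e_1,e_2\}$. $M$ is called maximal if $H=0$, and non-maximal if it is not maximal; $H$ is parallel if $DH=0$ identically. The Gauss map is $\nu=e_3\wedge e_4:M\to\bigwedge^2\mathbb E^4_1$, where $\{e_1,e_2,e_3,e_4\}$ is an oriented local orthonormal frame with $e_1,e_2$ tangent and $e_3,e_4$ normal to $M$; $\bigwedge^2\mathbb E^4_1$ is identified with a pseudo-Euclidean space via $\langle f_1\wedge f_2,g_1\wedge g_2\rangle=\det(\langle f_i,g_j\rangle)$. The Laplacian $\Delta=\sum_{i=1}^2(\nabla_{e_i}e_i-e_ie_i)$ of $M$ acts componentwise on $\nu$. $M$ has pointwise 1-type Gauss map of the first kind if $\Delta\nu=f\nu$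 for some smooth function $f$ on $M$ (the case $f=0$ is allowed).
   Formalization: The surface M is assumed connected; without this the claim fails, e.g. for the disjoint union of a maximal space-like surface with non-flat normal bundle and a round sphere in a space-like hyperplane (H is parallel and not identically zero, but the Gauss map is not of the first kind). *)

theory Defs
  imports "HOL-Analysis.Analysis"
begin

section \<open>Minkowski space and bivectors\<close>

definition mink :: "real^4 \<Rightarrow> real^4 \<Rightarrow> real" where
  "mink x y = - (x$1 * y$1) + x$2 * y$2 + x$3 * y$3 + x$4 * y$4"

text \<open>Bivectors are represented as antisymmetric 4 by 4 matrices, with entries the Pluecker
  coordinates. Operators that act componentwise on bivector-valued functions are then instances
  of operators on functions with values in a normed space.\<close>

definition wedge :: "real^4 \<Rightarrow> real^4 \<Rightarrow> real^4^4" where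
  "wedge x y = (\<chi> i j. x$i * y$j - x$j * y$i)"


section \<open>Smooth functions on open subsets of normed spaces\<close>

text \<open>Only meant for open \<open>U\<close> in a finite-dimensional space, where continuity of all iterated
  directional derivatives is the usual notion of infinite differentiability.\<close>

primrec Ck_on :: "nat \<Rightarrow> 'a::euclidean_space set \<Rightarrow> ('a \<Rightarrow> 'b::real_normed_vector) \<Rightarrow> bool" where
  "Ck_on 0 U f \<longleftrightarrow> continuous_on U f"
| "Ck_on (Suc k) U f \<longleftrightarrow>
     (\<forall>u\<in>U. f differentiable (at u)) \<and>
     (\<forall>a. Ck_on k U (\<lambda>u. frechet_derivative f (at u) a))"

definition smooth_on :: "'a::euclidean_space set \<Rightarrow> ('a \<Rightarrow> 'b::real_normed_vector) \<Rightarrow> bool" where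
  "smooth_on U f \<longleftrightarrow> (\<forall>k. Ck_on k U f)"


section \<open>Oriented immersed space-like surfaces\<close>

text \<open>The smooth structure and the orientation are given by an atlas of local parametrizations
  \<open>(U, \<phi>)\<close>, where \<open>U\<close> is the parameter domain; \<open>position\<close> is the immersion into
  Minkowski space. Injectivity of \<open>position\<close> is not required.\<close>

record 'm surface =
  points :: "'m topology"
  params :: "((real^2) set \<times> (real^2 \<Rightarrow> 'm)) set"
  position :: "'m \<Rightarrow> real^4"

definition oriented_surface :: "'m surface \<Rightarrow> bool" where
  "oriented_surface S \<longleftrightarrow>
     Hausdorff_space (points S) \<and> second_countable (points S) \<and>
     (\<forall>(U, \<phi>) \<in> params S. open U \<and> openin (points S) (\<phi> ` U) \<and>
        homeomorphic_map (top_of_set U) (subtopology (points S) (\<phi> ` U)) \<phi>) \<and>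
     (\<Union>(U, \<phi>) \<in> params S. \<phi> ` U) = topspace (points S) \<and>
     (\<forall>(U, \<phi>) \<in> params S. \<forall>(V, \<psi>) \<in> params S.
        smooth_on (U \<inter> \<phi> -` (\<psi> ` V)) (inv_into V \<psi> \<circ> \<phi>) \<and>
        (\<forall>u \<in> U \<inter> \<phi> -` (\<psi> ` V).
           det (matrix (frechet_derivative (inv_into V \<psi> \<circ> \<phi>) (at u))) > 0))"

definition immersed :: "'m surface \<Rightarrow> bool" where
  "immersed S \<longleftrightarrow>
     (\<forall>(U, \<phi>) \<in> params S. smooth_on U (position S \<circ> \<phi>) \<and>
        (\<forall>u\<in>U. inj (frechet_derivative (position S \<circ> \<phi>) (at u))))"

text \<open>Tangent vectors at \<open>p\<close> are identified with their images under the differential of the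
  immersion, i.e. with vectors of the ambient space.\<close>

definition tangent_space :: "'m surface \<Rightarrow> 'm \<Rightarrow> (real^4) set" where
  "tangent_space S p =
     {v. \<exists>(U, \<phi>) \<in> params S. \<exists>u\<in>U. \<exists>a. \<phi> u = p \<and>
           v = frechet_derivative (position S \<circ> \<phi>) (at u) a}"

definition normal_space :: "'m surface \<Rightarrow> 'm \<Rightarrow> (real^4) set" where
  "normal_space S p = {\<xi>. \<forall>v \<in> tangent_space S p. mink \<xi> v = 0}"

definition spacelike :: "'m surface \<Rightarrow> bool" where
  "spacelike S \<longleftrightarrow>
     (\<forall>p \<in> topspace (points S). \<forall>v \<in> tangent_space S p. v \<noteq> 0 \<longrightarrow> mink v v > 0)"

definition oriented_spacelike_surface :: "'m surface \<Rightarrow> bool" where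
  "oriented_spacelike_surface S \<longleftrightarrow> oriented_surface S \<and> immersed S \<and> spacelike S"

text \<open>A pair of tangent vectors at \<open>p\<close> is positive if its coordinate vectors are positively
  oriented in the plane, for some (equivalently, every) parametrization of the atlas around \<open>p\<close>.\<close>

definition positive_pair :: "'m surface \<Rightarrow> 'm \<Rightarrow> real^4 \<Rightarrow> real^4 \<Rightarrow> bool" where
  "positive_pair S p v w \<longleftrightarrow>
     (\<exists>(U, \<phi>) \<in> params S. \<exists>u\<in>U. \<exists>a b. \<phi> u = p \<and>
        v = frechet_derivative (position S \<circ> \<phi>) (at u) a \<and>
        w = frechet_derivative (position S \<circ> \<phi>) (at u) b \<and>
        det (vector [a, b] :: real^2^2) > 0)"


section \<open>Functions and vector fields\<close>

definition smooth_fun :: "'m surface \<Rightarrow> 'm set \<Rightarrow> ('m \<Rightarrow> 'b::real_normed_vector) \<Rightarrow> bool" where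
  "smooth_fun S W G \<longleftrightarrow> (\<forall>(U, \<phi>) \<in> params S. smooth_on (U \<inter> \<phi> -` W) (G \<circ> \<phi>))"

definition tangent_field :: "'m surface \<Rightarrow> 'm set \<Rightarrow> ('m \<Rightarrow> real^4) \<Rightarrow> bool" where
  "tangent_field S W X \<longleftrightarrow> smooth_fun S W X \<and> (\<forall>p\<in>W. X p \<in> tangent_space S p)"

definition normal_field :: "'m surface \<Rightarrow> 'm set \<Rightarrow> ('m \<Rightarrow> real^4) \<Rightarrow> bool" where
  "normal_field S W \<xi> \<longleftrightarrow> smooth_fun S W \<xi> \<and> (\<forall>p\<in>W. \<xi> p \<in> normal_space S p)"

text \<open>\<open>dirderiv S X G\<close> is the function \<open>X(G)\<close>: the derivative of \<open>G\<close> along the tangent field \<open>X\<close>.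
  For real-valued \<open>G\<close> it is the action of \<open>X\<close> as a derivation; for \<open>G\<close> with values in
  Minkowski space it is the ambient (flat) Levi-Civita connection.\<close>

definition dirderiv ::
  "'m surface \<Rightarrow> ('m \<Rightarrow> real^4) \<Rightarrow> ('m \<Rightarrow> 'b::real_normed_vector) \<Rightarrow> 'm \<Rightarrow> 'b" where
  "dirderiv S X G p =
     (THE d. \<exists>(U, \<phi>) \<in> params S. \<exists>u\<in>U. \<exists>a. \<phi> u = p \<and>
        frechet_derivative (position S \<circ> \<phi>) (at u) a = X p \<and>
        d = frechet_derivative (G \<circ> \<phi>) (at u) a)"

text \<open>Under the identification of tangent vectors with ambient vectors, a tangent field \<open>Y\<close> is the
  derivative \<open>Y(x)\<close> of the position function \<open>x\<close>, so \<open>[X, Y](x) = X(Y(x)) - Y(X(x))\<close>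
  reads as follows.\<close>

definition lie_bracket ::
  "'m surface \<Rightarrow> ('m \<Rightarrow> real^4) \<Rightarrow> ('m \<Rightarrow> real^4) \<Rightarrow> 'm \<Rightarrow> real^4" where
  "lie_bracket S X Y p = dirderiv S X Y p - dirderiv S Y X p"

text \<open>The Levi-Civita connection of the induced metric, by the Koszul formula.\<close>

definition levi_civita ::
  "'m surface \<Rightarrow> ('m \<Rightarrow> real^4) \<Rightarrow> ('m \<Rightarrow> real^4) \<Rightarrow> 'm \<Rightarrow> real^4" where
  "levi_civita S X Y p =
     (THE v. v \<in> tangent_space S p \<and>
        (\<forall>W Z. openin (points S) W \<and> p \<in> W \<and> tangent_field S W Z \<longrightarrow>
           2 * mink v (Z p) =
             dirderiv S X (\<lambda>q. mink (Y q) (Z q)) p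
           + dirderiv S Y (\<lambda>q. mink (X q) (Z q)) p
           - dirderiv S Z (\<lambda>q. mink (X q) (Y q)) p
           + mink (lie_bracket S X Y p) (Z p)
           - mink (lie_bracket S X Z p) (Y p)
           - mink (lie_bracket S Y Z p) (X p)))"


section \<open>Extrinsic geometry\<close>

definition second_fundamental_form ::
  "'m surface \<Rightarrow> ('m \<Rightarrow> real^4) \<Rightarrow> ('m \<Rightarrow> real^4) \<Rightarrow> 'm \<Rightarrow> real^4" where
  "second_fundamental_form S X Y p = dirderiv S X Y p - levi_civita S X Y p"

definition shape_operator ::
  "'m surface \<Rightarrow> ('m \<Rightarrow> real^4) \<Rightarrow> ('m \<Rightarrow> real^4) \<Rightarrow> 'm \<Rightarrow> real^4" where
  "shape_operator S \<xi> X p =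
     (THE v. v \<in> tangent_space S p \<and> dirderiv S X \<xi> p + v \<in> normal_space S p)"

definition normal_connection ::
  "'m surface \<Rightarrow> ('m \<Rightarrow> real^4) \<Rightarrow> ('m \<Rightarrow> real^4) \<Rightarrow> 'm \<Rightarrow> real^4" where
  "normal_connection S X \<xi> p = dirderiv S X \<xi> p + shape_operator S \<xi> X p"

definition tangent_frame ::
  "'m surface \<Rightarrow> 'm set \<Rightarrow> ('m \<Rightarrow> real^4) \<Rightarrow> ('m \<Rightarrow> real^4) \<Rightarrow> bool" where
  "tangent_frame S W e1 e2 \<longleftrightarrow>
     openin (points S) W \<and> tangent_field S W e1 \<and> tangent_field S W e2 \<and>
     (\<forall>q\<in>W. mink (e1 q) (e1 q) = 1 \<and> mink (e2 q) (e2 q) = 1 \<and> mink (e1 q) (e2 q) = 0)"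

text \<open>The objects below that are expressed through a local frame do not depend on it, whence the
  definite descriptions.\<close>

definition mean_curvature :: "'m surface \<Rightarrow> 'm \<Rightarrow> real^4" where
  "mean_curvature S p =
     (THE \<eta>. \<exists>W e1 e2. p \<in> W \<and> tangent_frame S W e1 e2 \<and>
        \<eta> = (1/2) *\<^sub>R (second_fundamental_form S e1 e1 p + second_fundamental_form S e2 e2 p))"

definition maximal :: "'m surface \<Rightarrow> bool" where
  "maximal S \<longleftrightarrow> (\<forall>p \<in> topspace (points S). mean_curvature S p = 0)"

definition parallel_mean_curvature :: "'m surface \<Rightarrow> bool" where
  "parallel_mean_curvature S \<longleftrightarrow>
     (\<forall>W X. openin (points S) W \<and> tangent_field S W X \<longrightarrow>
        (\<forall>p\<in>W. normal_connection S X (mean_curvature S) p = 0))"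


section \<open>Gauss map\<close>

text \<open>Exactly one of the normal vectors \<open>e3\<close>, \<open>e4\<close> is time-like; it is not prescribed which.\<close>

definition oriented_frame ::
  "'m surface \<Rightarrow> 'm set \<Rightarrow> ('m \<Rightarrow> real^4) \<Rightarrow> ('m \<Rightarrow> real^4) \<Rightarrow> ('m \<Rightarrow> real^4) \<Rightarrow> ('m \<Rightarrow> real^4) \<Rightarrow> bool"
  where
  "oriented_frame S W e1 e2 e3 e4 \<longleftrightarrow>
     tangent_frame S W e1 e2 \<and> normal_field S W e3 \<and> normal_field S W e4 \<and>
     (\<forall>q\<in>W. \<bar>mink (e3 q) (e3 q)\<bar> = 1 \<and> \<bar>mink (e4 q) (e4 q)\<bar> = 1 \<and> mink (e3 q) (e4 q) = 0 \<and>
        positive_pair S q (e1 q) (e2 q) \<and>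
        det (vector [e1 q, e2 q, e3 q, e4 q] :: real^4^4) > 0)"

definition gauss_map :: "'m surface \<Rightarrow> 'm \<Rightarrow> real^4^4" where
  "gauss_map S p =
     (THE w. \<exists>W e1 e2 e3 e4. p \<in> W \<and> oriented_frame S W e1 e2 e3 e4 \<and> w = wedge (e3 p) (e4 p))"

definition laplacian :: "'m surface \<Rightarrow> ('m \<Rightarrow> 'b::real_normed_vector) \<Rightarrow> 'm \<Rightarrow> 'b" where
  "laplacian S G p =
     (THE d. \<exists>W e1 e2. p \<in> W \<and> tangent_frame S W e1 e2 \<and>
        d = (dirderiv S (levi_civita S e1 e1) G p - dirderiv S e1 (dirderiv S e1 G) p)
          + (dirderiv S (levi_civita S e2 e2) G p - dirderiv S e2 (dirderiv S e2 G) p))"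

definition pointwise_1type_gauss_first_kind :: "'m surface \<Rightarrow> bool" where
  "pointwise_1type_gauss_first_kind S \<longleftrightarrow>
     (\<exists>f :: 'm \<Rightarrow> real. smooth_fun S (topspace (points S)) f \<and>
        (\<forall>p \<in> topspace (points S). laplacian S (gauss_map S) p = f p *\<^sub>R gauss_map S p))"

end

theory Submission
  imports Defs
begin

text \<open>In a local orthonormal tangent frame \<open>e\<^sub>1\<close>, \<open>e\<^sub>2\<close> the Gauss map is the Hodge dual of
  \<open>\<tau> = e\<^sub>1 \<and> e\<^sub>2\<close>, so \<open>\<tau>\<close> may be studied instead. The structure equations together with the
  Codazzi equations give
  \<open>\<Delta>\<tau> = |h|\<^sup>2 \<tau> - 2 (h\<^sub>1\<^sub>1 - h\<^sub>2\<^sub>2) \<and> h\<^sub>1\<^sub>2 - 2 e\<^sub>1 \<and> D\<^sub>2H + 2 e\<^sub>2 \<and> D\<^sub>1H\<close>,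
  where \<open>D\<close> is the normal connection. The four terms lie in independent subspaces of the bivectors,
  hence \<open>\<Delta>\<nu> = f \<nu>\<close> forces \<open>DH = 0\<close>. Conversely, if \<open>DH = 0\<close>, then \<open>H\<close> vanishes nowhere by
  connectedness, and the Ricci equation applied to \<open>H\<close> shows that the normal curvature, i.e. the
  second term, is zero; then \<open>f = |h|\<^sup>2\<close>.\<close>

section \<open>Calculus of smooth functions\<close>

text \<open>Passing to the tangent bivector avoids the normal connection forms and the open question
  which normal is time-like. Nothing is lost: \<open>hodge\<close> is a constant linear map, so it
  commutes with the Laplacian, and its square on bivectors is -1, so eigen-equations pass back and
  forth. Non-maximality is there for the term \<open>wedge (h11 u - h22 u) (h12 u)\<close>. If H =
  0, then H is trivially parallel, but nothing makes this term vanish. The Ricci equation says that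
  its contraction with a parallel H is 0, which kills it wherever H is nonzero. The hypothesis
  provides a single such point; connectedness does the rest. A second layer of work comes from the
  definitions, in which objects are unique values over all charts and all orthonormal frames. Each
  of them is evaluated in one chart with one frame; independence of the frame rests on the second
  fundamental form and the Hessian being tensors, and on traces being invariant under orthogonal
  changes.\<close>

abbreviation D :: "('a::real_normed_vector \<Rightarrow> 'b::real_normed_vector) \<Rightarrow> 'a \<Rightarrow> 'a \<Rightarrow> 'b"
  where "D f u \<equiv> frechet_derivative f (at u)"

lemma D_eqI: "(f has_derivative f') (at u) \<Longrightarrow> D f u = f'"
  using frechet_derivative_at by metis

lemma linear_D: "f differentiable (at u) \<Longrightarrow> linear (D f u)"
  by (rule linear_frechet_derivative)

lemma has_derivative_D: "f differentiable (at u) \<Longrightarrow> (f has_derivative D f u) (at u)"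
  using frechet_derivative_works by blast

section \<open>Closure properties of the classes of k times differentiable functions\<close>

lemma Ck_on_cong:
  assumes "open U" "\<And>u. u \<in> U \<Longrightarrow> f u = g u" "Ck_on k U f"
  shows "Ck_on k U g"
  using assms(2,3)
proof (induction k arbitrary: f g)
  case 0
  then show ?case using continuous_on_cong[of U U f g] by simp
next
  case (Suc k)
  have dg: "g differentiable (at u)" and D: "D g u = D f u" if "u \<in> U" for u
  proof -
    have "(f has_derivative D f u) (at u)"
      using Suc.prems that by (simp add: has_derivative_D)
    then have "(g has_derivative D f u) (at u)"
      using has_derivative_transform_within_open[OF _ assms(1) that] Suc.prems(1) by blast
    then show "g differentiable (at u)" "D g u = D f u"
      by (auto simp: differentiable_def D_eqI)
  qed
  have "Ck_on k U (\<lambda>u. D g u a)" for a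
    by (rule Suc.IH[of "\<lambda>u. D f u a"]) (use Suc.prems D in auto)
  then show ?case using dg by simp
qed

lemma Ck_on_SucD: "Ck_on (Suc k) U f \<Longrightarrow> Ck_on k U f"
proof (induction k arbitrary: f)
  case 0
  then show ?case
    by (auto simp: continuous_at_imp_continuous_on differentiable_imp_continuous_within)
next
  case (Suc k)
  then show ?case by (metis Ck_on.simps(2))
qed

text \<open>\<open>Ck_on\<close> speaks of \<open>frechet_derivative\<close>; here any explicit
  derivative formula valid on the open set may replace it, so each closure proof below only has to
  exhibit its product or chain rule.\<close>

lemma Ck_on_SucI:
  assumes "open U" "\<And>u. u \<in> U \<Longrightarrow> (f has_derivative f' u) (at u)" "\<And>a. Ck_on k U (\<lambda>u. f' u a)"
  shows "Ck_on (Suc k) U f"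
proof -
  have "Ck_on k U (\<lambda>u. D f u a)" for a
    by (rule Ck_on_cong[OF assms(1) _ assms(3)[of a]]) (use assms(2) D_eqI in metis)
  then show ?thesis using assms(2) by (auto simp: differentiable_def)
qed

lemma Ck_on_SucE:
  assumes "Ck_on (Suc k) U f" "u \<in> U"
  shows "(f has_derivative D f u) (at u)"
  using assms by (simp add: has_derivative_D)

lemma Ck_on_const: "Ck_on k U (\<lambda>_. c)"
  by (induction k arbitrary: c) auto

lemma Ck_on_compose_linear:
  assumes "bounded_linear L" "open U"
  shows "Ck_on k U f \<Longrightarrow> Ck_on k U (\<lambda>u. L (f u))"
proof (induction k arbitrary: f)
  case 0
  then show ?case using assms(1) by (simp add: bounded_linear.continuous_on)
next
  case (Suc k)
  show ?case
  proof (rule Ck_on_SucI[OF assms(2)])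
    show "((\<lambda>u. L (f u)) has_derivative (\<lambda>a. L (D f u a))) (at u)" if "u \<in> U" for u
      using bounded_linear.has_derivative[OF assms(1) Ck_on_SucE[OF Suc.prems that]] .
    show "Ck_on k U (\<lambda>u. L (D f u a))" for a
      by (rule Suc.IH) (use Suc.prems in simp)
  qed
qed

lemma Ck_on_add:
  assumes "open U"
  shows "Ck_on k U f \<Longrightarrow> Ck_on k U g \<Longrightarrow> Ck_on k U (\<lambda>u. f u + g u)"
proof (induction k arbitrary: f g)
  case 0
  then show ?case by (simp add: continuous_on_add)
next
  case (Suc k)
  show ?case
  proof (rule Ck_on_SucI[OF assms])
    show "((\<lambda>u. f u + g u) has_derivative (\<lambda>a. D f u a + D g u a)) (at u)" if "u \<in> U" for u
      using has_derivative_add[OF Ck_on_SucE[OF Suc.prems(1) that] Ck_on_SucE[OF Suc.prems(2) that]] .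
    show "Ck_on k U (\<lambda>u. D f u a + D g u a)" for a
      by (rule Suc.IH) (use Suc.prems in auto)
  qed
qed

lemma Ck_on_sum:
  assumes "open U" "finite I" "\<And>i. i \<in> I \<Longrightarrow> Ck_on k U (f i)"
  shows "Ck_on k U (\<lambda>u. \<Sum>i\<in>I. f i u)"
  using assms(2,3)
  by (induction I rule: finite_induct) (auto simp: Ck_on_const intro!: Ck_on_add[OF assms(1)])

lemma Ck_on_bilinear:
  assumes "bounded_bilinear B" "open U"
  shows "Ck_on k U f \<Longrightarrow> Ck_on k U g \<Longrightarrow> Ck_on k U (\<lambda>u. B (f u) (g u))"
proof (induction k arbitrary: f g)
  case 0
  then show ?case using assms(1) by (simp add: bounded_bilinear.continuous_on)
next
  case (Suc k)
  show ?case
  proof (rule Ck_on_SucI[OF assms(2)])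
    show "((\<lambda>u. B (f u) (g u)) has_derivative (\<lambda>a. B (f u) (D g u a) + B (D f u a) (g u))) (at u)"
      if "u \<in> U" for u
      using bounded_bilinear.FDERIV[OF assms(1) Ck_on_SucE[OF Suc.prems(1) that]
          Ck_on_SucE[OF Suc.prems(2) that]] .
    show "Ck_on k U (\<lambda>u. B (f u) (D g u a) + B (D f u a) (g u))" for a
      by (intro Ck_on_add[OF assms(2)] Suc.IH Ck_on_SucD[OF Suc.prems(1)] Ck_on_SucD[OF Suc.prems(2)])
        (use Suc.prems in auto)
  qed
qed

text \<open>The derivatives in \<open>Ck_on\<close> are taken in fixed directions. Expanding a
  moving direction in a basis reduces the general case to those, with the coordinates as
  factors.\<close>

lemma linear_eq_sum_Basis:
  fixes L :: "'a::euclidean_space \<Rightarrow> 'b::real_vector"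
  assumes "linear L" shows "L v = (\<Sum>b\<in>Basis. (v \<bullet> b) *\<^sub>R L b)"
proof -
  have "L v = L (\<Sum>b\<in>Basis. (v \<bullet> b) *\<^sub>R b)" by (simp add: euclidean_representation)
  then show ?thesis by (simp add: linear_sum[OF assms] linear_scale[OF assms])
qed

text \<open>In the chain rule the inner derivative is a direction varying with \<open>u\<close>,
  hence the basis expansion. The induction generalises over \<open>f\<close> only, since the
  derivative of the composite again composes derivatives of \<open>f\<close> with the same
  \<open>g\<close>.\<close>

lemma Ck_on_compose:
  fixes f :: "'b::euclidean_space \<Rightarrow> 'c::real_normed_vector" and g :: "'a::euclidean_space \<Rightarrow> 'b"
  assumes "open U" "g ` U \<subseteq> V"
  shows "Ck_on k V f \<Longrightarrow> Ck_on k U g \<Longrightarrow> Ck_on k U (\<lambda>u. f (g u))"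
proof (induction k arbitrary: f)
  case 0
  then show ?case using assms(2) by (auto intro: continuous_on_compose2)
next
  case (Suc k)
  note bb = bounded_bilinear_scaleR bounded_bilinear_inner
  show ?case
  proof (rule Ck_on_SucI[OF assms(1)])
    fix u assume u: "u \<in> U"
    then have gu: "g u \<in> V" using assms(2) by auto
    have "(f has_derivative D f (g u)) (at (g u))" using Ck_on_SucE[OF Suc.prems(1) gu] .
    from has_derivative_compose[OF Ck_on_SucE[OF Suc.prems(2) u] this]
    have "((\<lambda>u. f (g u)) has_derivative (\<lambda>a. D f (g u) (D g u a))) (at u)" by simp
    also have "(\<lambda>a. D f (g u) (D g u a)) = (\<lambda>a. \<Sum>b\<in>Basis. (D g u a \<bullet> b) *\<^sub>R D f (g u) b)"
      by (rule ext, rule linear_eq_sum_Basis, rule linear_D) (use Suc.prems(1) gu in auto)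
    finally show "((\<lambda>u. f (g u)) has_derivative (\<lambda>a. \<Sum>b\<in>Basis. (D g u a \<bullet> b) *\<^sub>R D f (g u) b)) (at u)" .
  next
    fix a
    have "Ck_on k U (\<lambda>u. D g u a)" and "\<And>b. Ck_on k V (\<lambda>v. D f v b)"
      using Suc.prems by auto
    then show "Ck_on k U (\<lambda>u. \<Sum>b\<in>Basis. (D g u a \<bullet> b) *\<^sub>R D f (g u) b)"
      by (intro Ck_on_sum[OF assms(1)] Ck_on_bilinear[OF bb(1) assms(1)] Ck_on_bilinear[OF bb(2) assms(1)]
          Suc.IH Ck_on_const Ck_on_SucD[OF Suc.prems(2)]) auto
  qed
qed

text \<open>The derivative is a polynomial in the reciprocal itself and the derivative of
  \<open>f\<close>, so the induction hypothesis for the same function closes the step. The square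
  root below is treated in the same manner.\<close>

lemma Ck_on_inverse:
  fixes f :: "'a::euclidean_space \<Rightarrow> real"
  assumes "open U" "\<And>u. u \<in> U \<Longrightarrow> f u \<noteq> 0"
  shows "Ck_on k U f \<Longrightarrow> Ck_on k U (\<lambda>u. inverse (f u))"
proof (induction k)
  case 0
  then show ?case using assms(2) by (simp add: continuous_on_inverse)
next
  case (Suc k)
  note mul = Ck_on_bilinear[OF bounded_bilinear_mult assms(1)]
  show ?case
  proof (rule Ck_on_SucI[OF assms(1)])
    show "((\<lambda>u. inverse (f u)) has_derivative
        (\<lambda>a. (inverse (f u) * inverse (f u)) * (-1 * D f u a))) (at u)" if "u \<in> U" for u
      using Deriv.has_derivative_inverse[OF assms(2)[OF that] Ck_on_SucE[OF Suc.prems that]]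
      by (simp add: mult.commute mult.left_commute)
    show "Ck_on k U (\<lambda>u. (inverse (f u) * inverse (f u)) * (-1 * D f u a))" for a
      by (intro mul Suc.IH Ck_on_const Ck_on_SucD[OF Suc.prems]) (use Suc.prems in auto)
  qed
qed

lemma Ck_on_sqrt:
  fixes f :: "'a::euclidean_space \<Rightarrow> real"
  assumes "open U" "\<And>u. u \<in> U \<Longrightarrow> f u > 0"
  shows "Ck_on k U f \<Longrightarrow> Ck_on k U (\<lambda>u. sqrt (f u))"
proof (induction k)
  case 0
  then show ?case by (simp add: continuous_on_real_sqrt)
next
  case (Suc k)
  note mul = Ck_on_bilinear[OF bounded_bilinear_mult assms(1)]
  show ?case
  proof (rule Ck_on_SucI[OF assms(1)])
    show "((\<lambda>u. sqrt (f u)) has_derivative (\<lambda>a. (1/2 * inverse (sqrt (f u))) * D f u a)) (at u)"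
      if "u \<in> U" for u
      by (rule has_derivative_eq_rhs,
          rule has_derivative_real_sqrt[OF assms(2)[OF that] Ck_on_SucE[OF Suc.prems that]])
        (simp add: field_simps)
    show "Ck_on k U (\<lambda>u. (1/2 * inverse (sqrt (f u))) * D f u a)" for a
      by (intro mul Ck_on_inverse[OF assms(1)] Suc.IH Ck_on_const Ck_on_SucD[OF Suc.prems])
        (use Suc.prems assms(2) in \<open>auto simp: less_imp_neq[symmetric]\<close>)
  qed
qed

section \<open>Smooth functions and rules for their derivatives\<close>

lemma smooth_onD:
  assumes "smooth_on U f"
  shows smooth_on_imp_differentiable: "u \<in> U \<Longrightarrow> f differentiable (at u)"
    and smooth_on_D: "smooth_on U (\<lambda>u. D f u a)"
    and smooth_on_imp_continuous_on: "continuous_on U f"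
proof -
  have k: "Ck_on k U f" for k using assms by (simp add: smooth_on_def)
  show "u \<in> U \<Longrightarrow> f differentiable (at u)" using k[of 1] by simp
  show "smooth_on U (\<lambda>u. D f u a)" unfolding smooth_on_def using k[of "Suc _"] by simp
  show "continuous_on U f" using k[of 0] by simp
qed

lemma smooth_on_cong:
  "smooth_on U f \<Longrightarrow> open U \<Longrightarrow> (\<And>u. u \<in> U \<Longrightarrow> f u = g u) \<Longrightarrow> smooth_on U g"
  unfolding smooth_on_def using Ck_on_cong by blast

lemma smooth_on_subset: "smooth_on U f \<Longrightarrow> V \<subseteq> U \<Longrightarrow> smooth_on V f"
proof -
  have "Ck_on k U f \<Longrightarrow> V \<subseteq> U \<Longrightarrow> Ck_on k V f" for k
    by (induction k arbitrary: f) (auto intro: continuous_on_subset)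
  then show "smooth_on U f \<Longrightarrow> V \<subseteq> U \<Longrightarrow> smooth_on V f" by (auto simp: smooth_on_def)
qed

lemma smooth_on_const: "smooth_on U (\<lambda>_. c)"
  by (simp add: smooth_on_def Ck_on_const)

lemma smooth_on_linear:
  "smooth_on U f \<Longrightarrow> open U \<Longrightarrow> bounded_linear L \<Longrightarrow> smooth_on U (\<lambda>u. L (f u))"
  by (simp add: smooth_on_def Ck_on_compose_linear)

lemma smooth_on_add:
  "smooth_on U f \<Longrightarrow> smooth_on U g \<Longrightarrow> open U \<Longrightarrow> smooth_on U (\<lambda>u. f u + g u)"
  by (simp add: smooth_on_def Ck_on_add)

lemma smooth_on_sum:
  "finite I \<Longrightarrow> open U \<Longrightarrow> (\<And>i. i \<in> I \<Longrightarrow> smooth_on U (f i)) \<Longrightarrow> smooth_on U (\<lambda>u. \<Sum>i\<in>I. f i u)"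
  by (simp add: smooth_on_def Ck_on_sum)

lemma smooth_on_bilinear:
  "bounded_bilinear B \<Longrightarrow> smooth_on U f \<Longrightarrow> smooth_on U g \<Longrightarrow> open U
    \<Longrightarrow> smooth_on U (\<lambda>u. B (f u) (g u))"
  by (simp add: smooth_on_def Ck_on_bilinear)

lemmas smooth_on_scaleR = smooth_on_bilinear[OF bounded_bilinear_scaleR]

lemma smooth_on_uminus: "smooth_on U f \<Longrightarrow> open U \<Longrightarrow> smooth_on U (\<lambda>u. - f u)"
  by (rule smooth_on_linear) (auto simp: bounded_linear_minus bounded_linear_ident)

lemma smooth_on_diff:
  "smooth_on U f \<Longrightarrow> smooth_on U g \<Longrightarrow> open U \<Longrightarrow> smooth_on U (\<lambda>u. f u - g u)"
  using smooth_on_add[OF _ smooth_on_uminus] by fastforce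

lemma smooth_on_inverse_sqrt:
  fixes f :: "'a::euclidean_space \<Rightarrow> real"
  assumes "smooth_on U f" "open U" "\<And>u. u \<in> U \<Longrightarrow> f u > 0"
  shows "smooth_on U (\<lambda>u. inverse (sqrt (f u)))"
  unfolding smooth_on_def
proof
  fix k
  have "Ck_on k U (\<lambda>u. sqrt (f u))"
    using Ck_on_sqrt[OF assms(2,3)] assms(1) by (simp add: smooth_on_def)
  moreover have "sqrt (f u) \<noteq> 0" if "u \<in> U" for u using assms(3)[OF that] by simp
  ultimately show "Ck_on k U (\<lambda>u. inverse (sqrt (f u)))"
    by (intro Ck_on_inverse[OF assms(2)])
qed

lemma smooth_on_compose:
  fixes f :: "'b::euclidean_space \<Rightarrow> 'c::real_normed_vector" and g :: "'a::euclidean_space \<Rightarrow> 'b"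
  shows "smooth_on V f \<Longrightarrow> smooth_on U g \<Longrightarrow> open U \<Longrightarrow> g ` U \<subseteq> V \<Longrightarrow> smooth_on U (\<lambda>u. f (g u))"
  by (simp add: smooth_on_def Ck_on_compose)

lemma smooth_on_D_along:
  assumes f: "smooth_on U f" and a: "smooth_on U a" and U: "open U"
  shows "smooth_on U (\<lambda>u. D f u (a u))"
proof (rule smooth_on_cong[OF _ U])
  show "smooth_on U (\<lambda>u. \<Sum>b\<in>Basis. (a u \<bullet> b) *\<^sub>R D f u b)"
    by (intro smooth_on_sum[OF _ U] smooth_on_scaleR smooth_on_bilinear[OF bounded_bilinear_inner]
        a smooth_on_const smooth_on_D f U) auto
  show "(\<Sum>b\<in>Basis. (a u \<bullet> b) *\<^sub>R D f u b) = D f u (a u)" if "u \<in> U" for u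
    by (rule linear_eq_sum_Basis[symmetric], rule linear_D, rule smooth_on_imp_differentiable[OF f that])
qed

lemma D_cong:
  assumes "open U" "u \<in> U" "\<And>v. v \<in> U \<Longrightarrow> f v = g v" "f differentiable (at u)"
  shows "D g u = D f u"
  using frechet_derivative_transform_within_open[OF assms(4,1,2,3)] by simp

lemma D_bilinear:
  assumes "bounded_bilinear B" "f differentiable (at u)" "g differentiable (at u)"
  shows "D (\<lambda>u. B (f u) (g u)) u a = B (D f u a) (g u) + B (f u) (D g u a)"
  using D_eqI[OF bounded_bilinear.FDERIV[OF assms(1) has_derivative_D[OF assms(2)]
        has_derivative_D[OF assms(3)]]] by simp

lemma D_linear:
  assumes "bounded_linear L" "f differentiable (at u)"
  shows "D (\<lambda>u. L (f u)) u a = L (D f u a)"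
  using D_eqI[OF bounded_linear.has_derivative[OF assms(1) has_derivative_D[OF assms(2)]]] by simp

lemma D_add:
  assumes "f differentiable (at u)" "g differentiable (at u)"
  shows "D (\<lambda>u. f u + g u) u a = D f u a + D g u a"
  using D_eqI[OF has_derivative_add[OF has_derivative_D[OF assms(1)] has_derivative_D[OF assms(2)]]]
  by simp

lemma D_compose:
  assumes "g differentiable (at u)" "f differentiable (at (g u))"
  shows "D (\<lambda>u. f (g u)) u a = D f (g u) (D g u a)"
  using D_eqI[OF has_derivative_compose[OF has_derivative_D[OF assms(1)] has_derivative_D[OF assms(2)]]]
  by simp

section \<open>Second derivatives, their symmetry, and commutators\<close>

definition D2 :: "('a::real_normed_vector \<Rightarrow> 'b::real_normed_vector) \<Rightarrow> 'a \<Rightarrow> 'a \<Rightarrow> 'a \<Rightarrow> 'b" where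
  "D2 f u a b = D (\<lambda>v. D f v b) u a"

lemma D2_compose_linear:
  assumes "smooth_on U f" "open U" "u \<in> U" "bounded_linear L"
  shows "D2 (\<lambda>v. L (f v)) u a b = L (D2 f u a b)"
proof -
  have "D (\<lambda>v. L (f v)) v b = L (D f v b)" if "v \<in> U" for v
    using D_linear[OF assms(4) smooth_on_imp_differentiable[OF assms(1) that]] .
  moreover have "(\<lambda>v. L (D f v b)) differentiable (at u)"
    using smooth_on_imp_differentiable[OF smooth_on_linear[OF smooth_on_D[OF assms(1)] assms(2,4)] assms(3)] .
  ultimately have "D2 (\<lambda>v. L (f v)) u a b = D (\<lambda>v. L (D f v b)) u a"
    unfolding D2_def using D_cong[OF assms(2,3), of "\<lambda>v. L (D f v b)" "\<lambda>v. D (\<lambda>v. L (f v)) v b"] by simp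
  then show ?thesis
    unfolding D2_def
    using D_linear[OF assms(4) smooth_on_imp_differentiable[OF smooth_on_D[OF assms(1)] assms(3)]]
    by simp
qed

lemma D_line:
  fixes f :: "'a::real_normed_vector \<Rightarrow> real"
  assumes "f differentiable (at (w + s *\<^sub>R a))"
  shows "DERIV (\<lambda>s. f (w + s *\<^sub>R a)) s :> D f (w + s *\<^sub>R a) a"
proof -
  have "((\<lambda>s. w + s *\<^sub>R a) has_derivative (\<lambda>h. h *\<^sub>R a)) (at s)"
    by (auto intro!: derivative_eq_intros)
  from has_derivative_compose[OF this has_derivative_D[OF assms]]
  have "((\<lambda>s. f (w + s *\<^sub>R a)) has_derivative (\<lambda>h. D f (w + s *\<^sub>R a) (h *\<^sub>R a))) (at s)" .
  then show ?thesis
    unfolding has_field_derivative_def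
    by (rule has_derivative_eq_rhs) (auto simp: linear_scale[OF linear_D[OF assms]])
qed

text \<open>The mean value theorem is applied to the increment in direction \<open>b\<close> as a
  function of the step along \<open>a\<close>, then to the resulting derivative along
  \<open>b\<close>. The difference is symmetric in \<open>a\<close> and \<open>b\<close>, while its
  value is a mixed derivative at a nearby point.\<close>

lemma second_difference:
  fixes f :: "'a::euclidean_space \<Rightarrow> real"
  assumes f: "smooth_on U f" and t: "t > 0"
    and sub: "\<And>r s. 0 \<le> r \<Longrightarrow> r \<le> t \<Longrightarrow> 0 \<le> s \<Longrightarrow> s \<le> t \<Longrightarrow> u + r *\<^sub>R a + s *\<^sub>R b \<in> U"
  obtains r s where "0 \<le> r" "r \<le> t" "0 \<le> s" "s \<le> t"
    "f (u + t *\<^sub>R a + t *\<^sub>R b) - f (u + t *\<^sub>R a) - f (u + t *\<^sub>R b) + f u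
      = t * t * D2 f (u + r *\<^sub>R a + s *\<^sub>R b) b a"
proof -
  have f1: "((\<lambda>r. f (u + t *\<^sub>R b + r *\<^sub>R a) - f (u + r *\<^sub>R a)) has_real_derivative
     (D f (u + t *\<^sub>R b + r *\<^sub>R a) a - D f (u + r *\<^sub>R a) a)) (at r)" if "0 \<le> r" "r \<le> t" for r
  proof (intro DERIV_diff D_line smooth_on_imp_differentiable[OF f])
    show "u + t *\<^sub>R b + r *\<^sub>R a \<in> U" using sub[of r t] that t by (simp add: add.commute add.left_commute)
    show "u + r *\<^sub>R a \<in> U" using sub[of r 0] that t by simp
  qed
  obtain r where r: "0 < r" "r < t"
    "(f (u + t *\<^sub>R b + t *\<^sub>R a) - f (u + t *\<^sub>R a)) - (f (u + t *\<^sub>R b + 0 *\<^sub>R a) - f (u + 0 *\<^sub>R a))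
     = (t - 0) * (D f (u + t *\<^sub>R b + r *\<^sub>R a) a - D f (u + r *\<^sub>R a) a)"
    using MVT2[OF t f1] by auto
  have f2: "((\<lambda>s. D f (u + r *\<^sub>R a + s *\<^sub>R b) a) has_real_derivative
     D2 f (u + r *\<^sub>R a + s *\<^sub>R b) b a) (at s)" if "0 \<le> s" "s \<le> t" for s
    unfolding D2_def
    by (intro D_line[where f = "\<lambda>v. D f v a"] smooth_on_imp_differentiable[OF smooth_on_D[OF f]] sub) (use r that in auto)
  obtain s where s: "0 < s" "s < t"
    "D f (u + r *\<^sub>R a + t *\<^sub>R b) a - D f (u + r *\<^sub>R a + 0 *\<^sub>R b) a = (t - 0) * D2 f (u + r *\<^sub>R a + s *\<^sub>R b) b a"
    using MVT2[OF t f2] by auto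
  have eq: "u + t *\<^sub>R b + x *\<^sub>R a = u + x *\<^sub>R a + t *\<^sub>R b" for x by simp
  show thesis
    by (rule that[of r s]) (use r s in \<open>auto simp: eq algebra_simps\<close>)
qed

text \<open>Exchanging \<open>a\<close> and \<open>b\<close> in the second difference equates the
  two mixed derivatives at two points arbitrarily close to \<open>u\<close>; continuity of both
  carries the equality to \<open>u\<close>.\<close>

lemma D2_sym_real:
  fixes f :: "'a::euclidean_space \<Rightarrow> real"
  assumes f: "smooth_on U f" and U: "open U" and u: "u \<in> U"
  shows "D2 f u a b = D2 f u b a"
proof (rule ccontr)
  assume ne: "D2 f u a b \<noteq> D2 f u b a"
  define e where "e = \<bar>D2 f u a b - D2 f u b a\<bar> / 2"
  have e: "e > 0" using ne by (simp add: e_def)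
  have cont: "continuous_on U (\<lambda>v. D2 f v c d)" for c d
    unfolding D2_def using smooth_on_imp_continuous_on[OF smooth_on_D[OF smooth_on_D[OF f]]] .
  obtain d1 where d1: "d1 > 0" "\<And>v. v \<in> U \<Longrightarrow> dist v u < d1 \<Longrightarrow> dist (D2 f v a b) (D2 f u a b) < e"
    using cont[of a b] e u unfolding continuous_on_iff by metis
  obtain d2 where d2: "d2 > 0" "\<And>v. v \<in> U \<Longrightarrow> dist v u < d2 \<Longrightarrow> dist (D2 f v b a) (D2 f u b a) < e"
    using cont[of b a] e u unfolding continuous_on_iff by metis
  obtain d0 where d0: "d0 > 0" "ball u d0 \<subseteq> U" using U u open_contains_ball by blast
  define d where "d = min d0 (min d1 d2)"
  have d: "d > 0" using d0 d1 d2 by (simp add: d_def)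
  \<comment> \<open>The summand 1 keeps \<open>n\<close> positive when both directions vanish. With
    \<open>t = d / n / 2\<close> the parallelogram with sides \<open>t\<close> times
    \<open>a\<close> and \<open>b\<close> stays in the ball of radius \<open>d\<close>, because t (n
    - 1) < 2 t n = d.\<close>
  define n where "n = 1 + norm a + norm b"
  define t where "t = d / n / 2"
  have n: "n > 0" unfolding n_def by (smt (verit) norm_ge_zero)
  have t: "t > 0" using d n by (simp add: t_def)
  have near: "dist (u + r *\<^sub>R a + s *\<^sub>R b) u < d" if "0 \<le> r" "r \<le> t" "0 \<le> s" "s \<le> t" for r s
  proof -
    have "dist (u + r *\<^sub>R a + s *\<^sub>R b) u = norm (r *\<^sub>R a + s *\<^sub>R b)" by (simp add: dist_norm)
    also have "\<dots> \<le> r * norm a + s * norm b" using norm_triangle_ineq[of "r *\<^sub>R a" "s *\<^sub>R b"] that by simp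
    also have "\<dots> \<le> t * norm a + t * norm b" using that by (intro add_mono mult_right_mono) auto
    also have "\<dots> = t * (n - 1)" by (simp add: n_def algebra_simps)
    also have "\<dots> < t * (2 * n)" using t n by (intro mult_strict_left_mono) auto
    also have "\<dots> = d" using n by (simp add: t_def)
    finally show ?thesis .
  qed
  then have inU: "u + r *\<^sub>R a + s *\<^sub>R b \<in> U" if "0 \<le> r" "r \<le> t" "0 \<le> s" "s \<le> t" for r s
    using d0 near[OF that] by (auto simp: d_def dist_commute subset_iff)
  have inU': "u + r *\<^sub>R b + s *\<^sub>R a \<in> U" if "0 \<le> r" "r \<le> t" "0 \<le> s" "s \<le> t" for r s
    using inU[of s r] that by (simp add: add.assoc add.commute[of "r *\<^sub>R b"])
  obtain r s where rs: "0 \<le> r" "r \<le> t" "0 \<le> s" "s \<le> t"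
    "f (u + t *\<^sub>R a + t *\<^sub>R b) - f (u + t *\<^sub>R a) - f (u + t *\<^sub>R b) + f u
      = t * t * D2 f (u + r *\<^sub>R a + s *\<^sub>R b) b a"
    using second_difference[OF f t inU] by blast
  obtain r' s' where rs': "0 \<le> r'" "r' \<le> t" "0 \<le> s'" "s' \<le> t"
    "f (u + t *\<^sub>R b + t *\<^sub>R a) - f (u + t *\<^sub>R b) - f (u + t *\<^sub>R a) + f u
      = t * t * D2 f (u + r' *\<^sub>R b + s' *\<^sub>R a) a b"
    using second_difference[OF f t inU'] by blast
  have "t * t * D2 f (u + r *\<^sub>R a + s *\<^sub>R b) b a = t * t * D2 f (u + r' *\<^sub>R b + s' *\<^sub>R a) a b"
    unfolding rs(5)[symmetric] rs'(5)[symmetric] by (simp add: add.assoc add.commute[of "t *\<^sub>R b"])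
  then have eq: "D2 f (u + r *\<^sub>R a + s *\<^sub>R b) b a = D2 f (u + r' *\<^sub>R b + s' *\<^sub>R a) a b"
    using t by simp
  have "dist (D2 f (u + r *\<^sub>R a + s *\<^sub>R b) b a) (D2 f u b a) < e"
    using d2(2)[OF inU[OF rs(1-4)]] near[OF rs(1-4)] by (simp add: d_def)
  moreover have "dist (u + r' *\<^sub>R b + s' *\<^sub>R a) u < d"
    using near[of s' r'] rs' by (simp add: add.assoc add.commute[of "r' *\<^sub>R b"])
  then have "dist (D2 f (u + r' *\<^sub>R b + s' *\<^sub>R a) a b) (D2 f u a b) < e"
    using d1(2)[OF inU'[OF rs'(1-4)]] by (simp add: d_def)
  \<comment> \<open>The common value would lie within \<open>e\<close> of two numbers at distance
    \<open>2 * e\<close>.\<close>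
  ultimately show False unfolding eq e_def dist_real_def by (auto simp: abs_if split: if_splits)
qed

text \<open>The mean value theorem concerns real functions, so the symmetry is transferred
  coordinate by coordinate.\<close>

lemma D2_sym:
  fixes f :: "'a::euclidean_space \<Rightarrow> 'b::euclidean_space"
  assumes "smooth_on U f" "open U" "u \<in> U"
  shows "D2 f u a b = D2 f u b a"
proof (rule euclidean_eqI)
  fix i :: 'b
  have L: "bounded_linear (\<lambda>y::'b. y \<bullet> i)" by (rule bounded_linear_inner_left)
  show "D2 f u a b \<bullet> i = D2 f u b a \<bullet> i"
    using D2_sym_real[OF smooth_on_linear[OF assms(1,2) L] assms(2,3), of a b]
    unfolding D2_compose_linear[OF assms L] .
qed

lemma linear_D2:
  assumes f: "smooth_on U f" and U: "open U" and u: "u \<in> U"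
  shows "linear (\<lambda>a. D2 f u a b)" "linear (\<lambda>b. D2 f u a b)"
proof -
  have dd: "(\<lambda>v. D f v b) differentiable (at u)" for b
    using smooth_on_imp_differentiable[OF smooth_on_D[OF f] u] .
  show "linear (\<lambda>a. D2 f u a b)"
    unfolding D2_def using linear_D[OF dd] by simp
  have lin: "linear (D f v)" if "v \<in> U" for v
    using linear_D[OF smooth_on_imp_differentiable[OF f that]] .
  show "linear (\<lambda>b. D2 f u a b)"
  proof (rule linearI)
    fix b c
    have "D (\<lambda>v. D f v (b + c)) u = D (\<lambda>v. D f v b + D f v c) u"
      by (rule D_cong[OF U u]) (use lin dd in \<open>auto simp: linear_add\<close>)
    then show "D2 f u a (b + c) = D2 f u a b + D2 f u a c"
      unfolding D2_def using D_add[OF dd dd] by simp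
  next
    fix r b
    have "D (\<lambda>v. D f v (r *\<^sub>R b)) u = D (\<lambda>v. r *\<^sub>R D f v b) u"
      by (rule D_cong[OF U u]) (use lin dd in \<open>auto simp: linear_scale\<close>)
    then show "D2 f u a (r *\<^sub>R b) = r *\<^sub>R D2 f u a b"
      unfolding D2_def using D_linear[OF bounded_linear_scaleR_right dd] by simp
  qed
qed

lemma D_D_along:
  assumes f: "smooth_on U f" and U: "open U" and u: "u \<in> U" and b: "b differentiable (at u)"
  shows "D (\<lambda>v. D f v (b v)) u a = D2 f u a (b u) + D f u (D b u a)"
proof -
  have lin: "linear (D f v)" if "v \<in> U" for v
    using linear_D[OF smooth_on_imp_differentiable[OF f that]] .
  have "((\<lambda>v. \<Sum>i\<in>Basis. (b v \<bullet> i) *\<^sub>R D f v i) has_derivative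
      (\<lambda>a. \<Sum>i\<in>Basis. (b u \<bullet> i) *\<^sub>R D (\<lambda>v. D f v i) u a + (D b u a \<bullet> i) *\<^sub>R D f u i)) (at u)"
    by (intro has_derivative_sum has_derivative_scaleR has_derivative_inner_left
        has_derivative_D b smooth_on_imp_differentiable[OF smooth_on_D[OF f] u])
  then have "((\<lambda>v. D f v (b v)) has_derivative
      (\<lambda>a. \<Sum>i\<in>Basis. (b u \<bullet> i) *\<^sub>R D (\<lambda>v. D f v i) u a + (D b u a \<bullet> i) *\<^sub>R D f u i)) (at u)"
    by (rule has_derivative_transform_within_open[OF _ U u])
      (rule linear_eq_sum_Basis[OF lin, symmetric])
  from D_eqI[OF this] have "D (\<lambda>v. D f v (b v)) u a
      = (\<Sum>i\<in>Basis. (b u \<bullet> i) *\<^sub>R D2 f u a i) + (\<Sum>i\<in>Basis. (D b u a \<bullet> i) *\<^sub>R D f u i)"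
    by (simp add: D2_def sum.distrib)
  then show ?thesis
    using linear_eq_sum_Basis[OF linear_D2(2)[OF f U u], of a "b u"]
      linear_eq_sum_Basis[OF lin[OF u], of "D b u a"] by simp
qed

text \<open>The second derivatives cancel by symmetry and only the bracket of the fields
  \<open>a\<close> and \<open>b\<close> survives. With \<open>f\<close> the position this is freedom
  from torsion; with the frame vectors it gives the Codazzi equations, with the mean curvature
  vector the Ricci equation.\<close>

lemma commutator:
  fixes f :: "'a::euclidean_space \<Rightarrow> 'b::euclidean_space"
  assumes f: "smooth_on U f" and U: "open U" and u: "u \<in> U"
    and a: "a differentiable (at u)" and b: "b differentiable (at u)"
  shows "D (\<lambda>v. D f v (b v)) u (a u) - D (\<lambda>v. D f v (a v)) u (b u)
    = D f u (D b u (a u) - D a u (b u))"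
  unfolding D_D_along[OF f U u a] D_D_along[OF f U u b] D2_sym[OF f U u, of "a u" "b u"]
    linear_diff[OF linear_D[OF smooth_on_imp_differentiable[OF f u]]]
  by (rule add_diff_cancel_left)

section \<open>Linear algebra of Minkowski space\<close>

lemma bounded_bilinear_mink: "bounded_bilinear mink"
  unfolding bilinear_conv_bounded_bilinear[symmetric] bilinear_def
  by (auto intro!: linearI simp: mink_def algebra_simps)

interpretation mink: bounded_bilinear mink by (rule bounded_bilinear_mink)

lemma bounded_bilinear_wedge: "bounded_bilinear wedge"
  unfolding bilinear_conv_bounded_bilinear[symmetric] bilinear_def
  by (auto intro!: linearI simp: wedge_def vec_eq_iff algebra_simps)

interpretation wedge: bounded_bilinear wedge by (rule bounded_bilinear_wedge)

lemmas mink_simps = mink.add_left mink.add_right mink.diff_left mink.diff_right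
  mink.scaleR_left mink.scaleR_right mink.minus_left mink.minus_right mink.zero_left mink.zero_right

lemmas wedge_simps = wedge.add_left wedge.add_right wedge.diff_left wedge.diff_right
  wedge.scaleR_left wedge.scaleR_right wedge.minus_left wedge.minus_right wedge.zero_left wedge.zero_right

lemma mink_commute: "mink x y = mink y x"
  by (simp add: mink_def algebra_simps)

lemma wedge_self [simp]: "wedge x x = 0"
  by (simp add: wedge_def vec_eq_iff)

lemma wedge_commute: "wedge x y = - wedge y x"
  by (simp add: wedge_def vec_eq_iff)

lemma mink_axis:
  "mink v (axis 1 1) = - v$1" "mink v (axis 2 1) = v$2" "mink v (axis 3 1) = v$3" "mink v (axis 4 1) = v$4"
  by (simp_all add: mink_def axis_def)

lemma mink_nondegenerate:
  assumes "\<And>z. mink v z = 0" shows "v = 0"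
  using mink_axis[of v] assms by (simp add: vec_eq_iff forall_4)

lemma vector_4:
  "(vector [x,y,z,w] :: 'a::zero^4)$1 = x" "(vector [x,y,z,w] :: 'a^4)$2 = y"
  "(vector [x,y,z,w] :: 'a^4)$3 = z" "(vector [x,y,z,w] :: 'a^4)$4 = w"
  unfolding vector_def by simp_all

lemma det_4:
  "det (A::'a::comm_ring_1^4^4) =
    A$1$1 * (A$2$2 * A$3$3 * A$4$4 + A$2$3 * A$3$4 * A$4$2 + A$2$4 * A$3$2 * A$4$3
      - A$2$2 * A$3$4 * A$4$3 - A$2$3 * A$3$2 * A$4$4 - A$2$4 * A$3$3 * A$4$2)
  - A$1$2 * (A$2$1 * A$3$3 * A$4$4 + A$2$3 * A$3$4 * A$4$1 + A$2$4 * A$3$1 * A$4$3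
      - A$2$1 * A$3$4 * A$4$3 - A$2$3 * A$3$1 * A$4$4 - A$2$4 * A$3$3 * A$4$1)
  + A$1$3 * (A$2$1 * A$3$2 * A$4$4 + A$2$2 * A$3$4 * A$4$1 + A$2$4 * A$3$1 * A$4$2
      - A$2$1 * A$3$4 * A$4$2 - A$2$2 * A$3$1 * A$4$4 - A$2$4 * A$3$2 * A$4$1)
  - A$1$4 * (A$2$1 * A$3$2 * A$4$3 + A$2$2 * A$3$3 * A$4$1 + A$2$3 * A$3$1 * A$4$2
      - A$2$1 * A$3$3 * A$4$2 - A$2$2 * A$3$1 * A$4$3 - A$2$3 * A$3$2 * A$4$1)"
proof -
  have f1: "finite {2::4, 3, 4}" "1 \<notin> {2::4, 3, 4}" by auto
  have f2: "finite {3::4, 4}" "2 \<notin> {3::4, 4}" by auto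
  have f3: "finite {4::4}" "3 \<notin> {4::4}" by auto
  show ?thesis
    unfolding det_def UNIV_4
    unfolding sum_over_permutations_insert[OF f1]
    unfolding sum_over_permutations_insert[OF f2]
    unfolding sum_over_permutations_insert[OF f3]
    unfolding permutes_sing
    by (simp add: sign_swap_id permutation_swap_id permutation_compose sign_compose sign_id swap_id_eq
        algebra_simps)
qed

text \<open>A bivector as a linear map, one index lowered with the Minkowski metric, whence the sign
  in the first coordinate. Bivectors are compared by means of it.\<close>

definition contract :: "real^4^4 \<Rightarrow> real^4 \<Rightarrow> real^4" where
  "contract w v = (\<chi> i. - (w$i$1 * v$1) + w$i$2 * v$2 + w$i$3 * v$3 + w$i$4 * v$4)"

lemma bounded_bilinear_contract: "bounded_bilinear contract"
  unfolding bilinear_conv_bounded_bilinear[symmetric] bilinear_def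
  by (auto intro!: linearI simp: contract_def vec_eq_iff algebra_simps)

interpretation contract: bounded_bilinear contract by (rule bounded_bilinear_contract)

lemmas contract_simps = contract.add_left contract.add_right contract.diff_left contract.diff_right
  contract.scaleR_left contract.scaleR_right contract.minus_left contract.minus_right
  contract.zero_left contract.zero_right

lemma contract_wedge: "contract (wedge x y) v = mink y v *\<^sub>R x - mink x v *\<^sub>R y"
  by (simp add: contract_def wedge_def mink_def vec_eq_iff algebra_simps)

lemma contract_inject:
  assumes "\<And>v. contract w v = contract w' v" shows "w = w'"
proof -
  have "contract w (axis j 1) $ i = contract w' (axis j 1) $ i" for i j using assms by simp
  from this[of 1] this[of 2] this[of 3] this[of 4] show ?thesis
    by (simp add: contract_def axis_def vec_eq_iff forall_4)
qed

text \<open>The Hodge operator, with the sign for which \<open>hodge (e\<^sub>1 \<and> e\<^sub>2) = e\<^sub>3 \<and> e\<^sub>4\<close>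
  on oriented orthonormal frames with space-like \<open>e\<^sub>1\<close>, \<open>e\<^sub>2\<close>.\<close>

definition hodge :: "real^4^4 \<Rightarrow> real^4^4" where
  "hodge w = vector [vector [0, w$3$4, w$4$2, w$2$3], vector [w$4$3, 0, - w$1$4, - w$3$1],
     vector [w$2$4, w$1$4, 0, - w$1$2], vector [w$3$2, w$3$1, w$1$2, 0]]"

lemma bounded_linear_hodge: "bounded_linear hodge"
  unfolding linear_conv_bounded_linear[symmetric]
  by (rule linearI) (simp_all add: hodge_def vec_eq_iff forall_4 vector_4)

lemmas hodge_simps = linear_add[OF bounded_linear.linear[OF bounded_linear_hodge]]
  linear_diff[OF bounded_linear.linear[OF bounded_linear_hodge]]
  linear_neg[OF bounded_linear.linear[OF bounded_linear_hodge]]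
  linear_scale[OF bounded_linear.linear[OF bounded_linear_hodge]]
  linear_0[OF bounded_linear.linear[OF bounded_linear_hodge]]

text \<open>In Lorentzian signature the Hodge operator on bivectors squares to -1. On matrices that
  are not antisymmetric this fails for \<open>hodge\<close>, hence the restriction to wedge
  products.\<close>

lemma hodge_hodge_wedge: "hodge (hodge (wedge x y)) = - wedge x y"
  by (simp add: hodge_def wedge_def vec_eq_iff forall_4 vector_4)

text \<open>The defining property of the Hodge dual: up to sign it is the volume form with
  \<open>a\<close> and \<open>b\<close> in its first two slots. The orientation of a frame enters
  through this determinant.\<close>

lemma mink_contract_hodge:
  "mink (contract (hodge (wedge a b)) d) c = - det (vector [a, b, c, d] :: real^4^4)"
  by (simp add: det_4 vector_4 mink_def contract_def hodge_def wedge_def algebra_simps)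

lemma mink_contract_hodge_alt:
  "mink (contract (hodge (wedge a b)) d) c = - mink (contract (hodge (wedge a b)) c) d"
  "mink (contract (hodge (wedge a b)) c) c = 0"
  "mink (contract (hodge (wedge a b)) d) a = 0"
  "mink (contract (hodge (wedge a b)) d) b = 0"
  by (simp_all add: mink_def vector_4 contract_def hodge_def wedge_def algebra_simps)

text \<open>Contracting \<open>hodge (wedge a b)\<close> with \<open>t\<close> is, up to sign, the
  triple cross product of Minkowski space; its square is minus the Gram determinant of
  \<open>a\<close>, \<open>b\<close>, \<open>t\<close>.\<close>

lemma mink_contract_hodge_Gram:
  "mink (contract (hodge (wedge a b)) t) (contract (hodge (wedge a b)) t) =
    - (mink a a * mink b b * mink t t + 2 * mink a b * mink b t * mink a t
     - mink a a * (mink b t)\<^sup>2 - mink b b * (mink a t)\<^sup>2 - mink t t * (mink a b)\<^sup>2)"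
  unfolding mink_def contract_def hodge_def wedge_def power2_eq_square
  by (simp add: vector_4) algebra

section \<open>Orthonormal frames and the normal plane of an orthonormal pair\<close>

definition orthonormal_pair :: "real^4 \<Rightarrow> real^4 \<Rightarrow> bool" where
  "orthonormal_pair a b \<longleftrightarrow> mink a a = 1 \<and> mink b b = 1 \<and> mink a b = 0 \<and> mink b a = 0"

text \<open>With \<open>J\<close> the metric and \<open>G\<close> the Gram matrix, M J M^T = G and
  G^2 = 1 exhibit a right inverse of \<open>M\<close>. For square matrices it is also a left
  inverse, which is the expansion of \<open>v\<close>. Taking determinants in M J M^T = G gives the
  second claim, the minus sign being det J.\<close>

lemma orthonormal_expansion:
  fixes M :: "real^4^4"
  assumes diag: "\<And>i. \<bar>mink (M$i) (M$i)\<bar> = 1" and off: "\<And>i j. i \<noteq> j \<Longrightarrow> mink (M$i) (M$j) = 0"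
  shows "v = (\<Sum>i\<in>UNIV. (mink (M$i) (M$i) * mink v (M$i)) *\<^sub>R M$i)"
    and "(det M)\<^sup>2 = - (\<Prod>i\<in>UNIV. mink (M$i) (M$i))"
proof -
  define J :: "real^4^4" where "J = (\<chi> i j. if i = j then (if i = 1 then -1 else 1) else 0)"
  define G :: "real^4^4" where "G = (\<chi> i j. if i = j then mink (M$i) (M$i) else 0)"
  have Jv: "J *v x = (\<chi> i. if i = 1 then - x$i else x$i)" for x
    by (simp add: vec_eq_iff forall_4 matrix_vector_mult_def J_def sum_4)
  have mJ: "mink x y = x \<bullet> (J *v y)" for x y
    by (simp add: Jv mink_def inner_vec_def sum_4)
  have gram: "M ** J ** transpose M = G"
    unfolding vec_eq_iff
  proof (intro allI)
    fix i j
    have "(M ** J ** transpose M) $ i $ j = mink (M$i) (M$j)"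
      by (simp add: matrix_matrix_mult_def transpose_def J_def sum_4 mink_def)
    then show "(M ** J ** transpose M) $ i $ j = G $ i $ j" using off by (simp add: G_def)
  qed
  have GG: "G ** G = mat 1"
    using diag by (simp add: vec_eq_iff forall_4 matrix_matrix_mult_def mat_def G_def sum_4)
      (metis abs_mult_self_eq mult_1)
  have "M ** (J ** transpose M ** G) = mat 1"
    using gram GG by (simp add: matrix_mul_assoc)
  then have inv: "(J ** transpose M ** G) ** M = mat 1"
    using matrix_left_right_inverse by blast
  have JJ: "J ** J = mat 1"
    by (simp add: vec_eq_iff forall_4 matrix_matrix_mult_def mat_def J_def sum_4)
  have "transpose M ** G ** M ** J = J ** (J ** transpose M ** G ** M) ** J"
    by (simp add: matrix_mul_assoc JJ)
  then have "transpose M ** G ** M ** J = mat 1" by (simp add: inv JJ)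
  then have "v = transpose M *v (G *v (M *v (J *v v)))"
    by (metis matrix_vector_mul_assoc matrix_vector_mul_lid)
  also have "M *v (J *v v) = (\<chi> i. mink v (M$i))"
    by (simp add: matrix_vector_mult_def vec_eq_iff mink_def J_def sum_4 mult.commute)
  also have "transpose M *v (G *v (\<chi> i. mink v (M$i)))
      = (\<Sum>i\<in>UNIV. (mink (M$i) (M$i) * mink v (M$i)) *\<^sub>R M$i)"
    by (simp add: matrix_vector_mult_def vec_eq_iff G_def transpose_def sum_4 mult.commute)
  finally show "v = (\<Sum>i\<in>UNIV. (mink (M$i) (M$i) * mink v (M$i)) *\<^sub>R M$i)" .
  have "det J = -1" by (simp add: det_4 J_def)
  moreover have "det G = (\<Prod>i\<in>UNIV. mink (M$i) (M$i))"
    by (subst det_diagonal) (auto simp: G_def)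
  ultimately show "(det M)\<^sup>2 = - (\<Prod>i\<in>UNIV. mink (M$i) (M$i))"
    using arg_cong[OF gram, of det] by (simp add: det_mul det_transpose power2_eq_square)
qed

lemma prod_4: "prod f (UNIV::4 set) = f 1 * f 2 * f 3 * f 4"
  unfolding UNIV_4 by (simp add: ac_simps)

lemma frame_expansion:
  assumes "orthonormal_pair e1 e2"
    and "\<bar>mink e3 e3\<bar> = 1" "\<bar>mink e4 e4\<bar> = 1" "mink e3 e4 = 0"
    and "mink e3 e1 = 0" "mink e3 e2 = 0" "mink e4 e1 = 0" "mink e4 e2 = 0"
  shows "v = mink v e1 *\<^sub>R e1 + mink v e2 *\<^sub>R e2
      + (mink e3 e3 * mink v e3) *\<^sub>R e3 + (mink e4 e4 * mink v e4) *\<^sub>R e4"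
    and "(det (vector [e1, e2, e3, e4] :: real^4^4))\<^sup>2 = - (mink e3 e3 * mink e4 e4)"
proof -
  let ?M = "vector [e1, e2, e3, e4] :: real^4^4"
  have "\<bar>mink (?M$i) (?M$i)\<bar> = 1" for i
    using assms(1-3) exhaust_4[of i] by (auto simp: vector_4 orthonormal_pair_def)
  moreover have "mink (?M$i) (?M$j) = 0" if "i \<noteq> j" for i j
    using assms that exhaust_4[of i] exhaust_4[of j] mink_commute
    by (auto simp: vector_4 orthonormal_pair_def)
  ultimately show "v = mink v e1 *\<^sub>R e1 + mink v e2 *\<^sub>R e2
      + (mink e3 e3 * mink v e3) *\<^sub>R e3 + (mink e4 e4 * mink v e4) *\<^sub>R e4"
    "(det (vector [e1, e2, e3, e4] :: real^4^4))\<^sup>2 = - (mink e3 e3 * mink e4 e4)"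
    using orthonormal_expansion[of ?M] assms(1)
    by (simp_all add: vector_4 sum_4 prod_4 orthonormal_pair_def)
qed

text \<open>Both sides are compared as bilinear forms. The form \<open>P\<close> of the Hodge dual
  is alternating and annihilates \<open>e1\<close> and \<open>e2\<close>, so it is determined by its
  value on \<open>e3\<close>, \<open>e4\<close>, which is minus the determinant of the
  frame.\<close>

lemma wedge_normals_eq_hodge:
  assumes e12: "orthonormal_pair e1 e2"
    and n3: "\<bar>mink e3 e3\<bar> = 1" and n4: "\<bar>mink e4 e4\<bar> = 1" and o34: "mink e3 e4 = 0"
    and orth: "mink e3 e1 = 0" "mink e3 e2 = 0" "mink e4 e1 = 0" "mink e4 e2 = 0"
    and pos: "det (vector [e1, e2, e3, e4] :: real^4^4) > 0"
  shows "wedge e3 e4 = hodge (wedge e1 e2)"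
proof -
  define P where "P c d = mink (contract (hodge (wedge e1 e2)) d) c" for c d
  note exp = frame_expansion[OF e12 n3 n4 o34 orth]
  \<comment> \<open>A positive squared determinant forces one normal to be space-like and the other
    time-like; only this product of signs is used below, not which of the two is time-like.\<close>
  have s: "mink e3 e3 * mink e4 e4 = -1"
  proof -
    have "(det (vector [e1, e2, e3, e4] :: real^4^4))\<^sup>2 > 0" using pos by simp
    then have "mink e3 e3 * mink e4 e4 < 0" using exp(2) by simp
    moreover have "\<bar>mink e3 e3 * mink e4 e4\<bar> = 1" using n3 n4 by (simp add: abs_mult)
    ultimately show ?thesis by linarith
  qed
  have "det (vector [e1, e2, e3, e4] :: real^4^4) = 1"
    using exp(2) s pos by (simp add: power2_eq_1_iff)
  then have P34: "P e3 e4 = -1" by (simp add: P_def mink_contract_hodge)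
  have Palt: "P c d = - P d c" "P c c = 0" "P e1 d = 0" "P e2 d = 0" for c d
    unfolding P_def by (rule mink_contract_hodge_alt)+
  have Plin: "P (c + c') d = P c d + P c' d" "P (r *\<^sub>R c) d = r * P c d"
    "P c (d + d') = P c d + P c d'" "P c (r *\<^sub>R d) = r * P c d" for c c' d d' r
    by (simp_all add: P_def mink_simps contract_simps)
  have P': "P c e1 = 0" "P c e2 = 0" "P e4 e3 = 1" for c
    using Palt(1)[of c e1] Palt(1)[of c e2] Palt(1)[of e4 e3] Palt(3,4) P34 by auto
  show ?thesis
  proof (rule contract_inject)
    fix d
    have "mink (contract (wedge e3 e4) d - contract (hodge (wedge e1 e2)) d) c = 0" for c
    proof -
      have "P c d = P (mink c e1 *\<^sub>R e1 + mink c e2 *\<^sub>R e2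
          + (mink e3 e3 * mink c e3) *\<^sub>R e3 + (mink e4 e4 * mink c e4) *\<^sub>R e4)
         (mink d e1 *\<^sub>R e1 + mink d e2 *\<^sub>R e2
          + (mink e3 e3 * mink d e3) *\<^sub>R e3 + (mink e4 e4 * mink d e4) *\<^sub>R e4)"
        using exp(1)[of c] exp(1)[of d] by simp
      also have "\<dots> = - (mink e3 e3 * mink e4 e4) * (mink c e3 * mink d e4 - mink c e4 * mink d e3)"
        unfolding Plin Palt(2-4) P' P34 by (simp add: algebra_simps)
      also have "\<dots> = mink (contract (wedge e3 e4) d) c"
        by (simp add: s contract_wedge mink_simps mink_commute)
      finally show ?thesis by (simp add: mink_simps P_def)
    qed
    then show "contract (wedge e3 e4) d = contract (hodge (wedge e1 e2)) d"
      using mink_nondegenerate by fastforce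
  qed
qed

definition normal_part :: "real^4 \<Rightarrow> real^4 \<Rightarrow> real^4 \<Rightarrow> real^4" where
  "normal_part e1 e2 v = v - mink v e1 *\<^sub>R e1 - mink v e2 *\<^sub>R e2"

lemma mink_normal_part:
  assumes "orthonormal_pair e1 e2"
  shows "mink (normal_part e1 e2 v) e1 = 0" "mink (normal_part e1 e2 v) e2 = 0"
  using assms by (simp_all add: normal_part_def mink_simps orthonormal_pair_def)

lemma linear_normal_part: "linear (normal_part e1 e2)"
  by (rule linearI) (simp_all add: normal_part_def mink_simps algebra_simps)

lemmas normal_part_simps = linear_add[OF linear_normal_part] linear_diff[OF linear_normal_part]
  linear_scale[OF linear_normal_part] linear_neg[OF linear_normal_part] linear_0[OF linear_normal_part]

text \<open>The time axis projects to a time-like, hence nonzero, vector of the normal plane of any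
  orthonormal pair; normalising it gives a unit normal that depends smoothly on the pair.\<close>

definition time_normal :: "real^4 \<Rightarrow> real^4 \<Rightarrow> real^4" where
  "time_normal e1 e2 = (let t = normal_part e1 e2 (axis 1 1) in inverse (sqrt (- mink t t)) *\<^sub>R t)"

text \<open>The triple cross product of the pair with \<open>time_normal\<close>; the sign makes the
  resulting frame positively oriented.\<close>

definition space_normal :: "real^4 \<Rightarrow> real^4 \<Rightarrow> real^4" where
  "space_normal e1 e2 = - contract (hodge (wedge e1 e2)) (time_normal e1 e2)"

text \<open>The axis has square -1, and removing its components along two space-like unit vectors
  can only decrease the square.\<close>

lemma mink_time_axis_normal:
  assumes "orthonormal_pair e1 e2"
  shows "mink (normal_part e1 e2 (axis 1 1)) (normal_part e1 e2 (axis 1 1)) < 0"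
proof -
  have "mink (normal_part e1 e2 (axis 1 1)) (normal_part e1 e2 (axis 1 1))
      = -1 - (e1$1)\<^sup>2 - (e2$1)\<^sup>2"
    using assms
    by (simp add: normal_part_def mink_simps orthonormal_pair_def mink_axis power2_eq_square
        mink_commute[of "axis 1 1"])
  then show ?thesis by (smt (verit) zero_le_power2)
qed

text \<open>The number \<open>mink e3 e3\<close> is evaluated twice, through the Gram determinant
  and as the determinant of the frame, so normalisation and orientation come out together.\<close>

lemma time_space_normal:
  assumes e12: "orthonormal_pair e1 e2"
  defines "e3 \<equiv> space_normal e1 e2" and "e4 \<equiv> time_normal e1 e2"
  shows "mink e3 e3 = 1" "mink e4 e4 = -1" "mink e3 e4 = 0"
    "mink e3 e1 = 0" "mink e3 e2 = 0" "mink e4 e1 = 0" "mink e4 e2 = 0"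
    "det (vector [e1, e2, e3, e4] :: real^4^4) = 1"
proof -
  let ?t = "normal_part e1 e2 (axis 1 1)"
  have neg: "- mink ?t ?t > 0" using mink_time_axis_normal[OF e12] by simp
  have e4: "e4 = inverse (sqrt (- mink ?t ?t)) *\<^sub>R ?t" by (simp add: e4_def time_normal_def Let_def)
  have "inverse (sqrt (- mink ?t ?t)) * inverse (sqrt (- mink ?t ?t)) = inverse (- mink ?t ?t)"
    using neg by (metis inverse_mult_distrib order_less_imp_le real_sqrt_mult_self abs_of_pos)
  then show e44: "mink e4 e4 = -1" unfolding e4 using neg by (simp add: mink_simps field_simps)
  show o: "mink e4 e1 = 0" "mink e4 e2 = 0"
    unfolding e4 using mink_normal_part[OF e12] by (simp_all add: mink_simps)
  have e3: "e3 = - contract (hodge (wedge e1 e2)) e4" by (simp add: e3_def e4_def space_normal_def)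
  show "mink e3 e4 = 0" "mink e3 e1 = 0" "mink e3 e2 = 0"
    by (simp_all add: e3 mink_simps mink_contract_hodge_alt(2-4))
  show e33: "mink e3 e3 = 1"
    using mink_contract_hodge_Gram[of e1 e2 e4] e12 o e44
    by (simp add: e3 mink_simps orthonormal_pair_def mink_commute[of e1 e4] mink_commute[of e2 e4])
  have "mink e3 e3 = det (vector [e1, e2, e3, e4] :: real^4^4)"
    using mink_contract_hodge[of e1 e2 e4 e3] by (subst e3) (simp add: mink_simps)
  then show "det (vector [e1, e2, e3, e4] :: real^4^4) = 1" using e33 by simp
qed

text \<open>The hypothesis \<open>eq\<close> says that contracting \<open>wedge a b\<close> with
  \<open>H\<close> gives 0. The normal plane has dimension two, so \<open>wedge a b\<close> is a
  multiple of \<open>wedge e3 e4\<close>, and its contraction is that multiple of \<open>H\<close>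
  with coordinates exchanged up to sign. It vanishes only if the multiple does, even when
  \<open>H\<close> is light-like.\<close>

lemma wedge_normals_eq_0:
  assumes e12: "orthonormal_pair e1 e2"
    and a: "mink a e1 = 0" "mink a e2 = 0" and b: "mink b e1 = 0" "mink b e2 = 0"
    and H: "mink H e1 = 0" "mink H e2 = 0" "H \<noteq> 0"
    and eq: "mink b H *\<^sub>R a = mink a H *\<^sub>R b"
  shows "wedge a b = 0"
proof -
  define e3 e4 where "e3 = space_normal e1 e2" and "e4 = time_normal e1 e2"
  note n = time_space_normal[OF e12, folded e3_def e4_def]
  have exp: "v = mink v e3 *\<^sub>R e3 - mink v e4 *\<^sub>R e4" if "mink v e1 = 0" "mink v e2 = 0" for v
    using frame_expansion(1)[OF e12, of e3 e4 v] n that by simp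
  define q where "q = mink a e3 * mink b e4 - mink a e4 * mink b e3"
  have mH: "mink v H = mink v e3 * mink H e3 - mink v e4 * mink H e4" for v
    by (subst exp[OF H(1,2)]) (simp add: mink_simps)
  have 3: "mink b H * mink a e3 = mink a H * mink b e3" using arg_cong[OF eq, of "\<lambda>v. mink v e3"] by (simp add: mink_simps)
  have 4: "mink b H * mink a e4 = mink a H * mink b e4" using arg_cong[OF eq, of "\<lambda>v. mink v e4"] by (simp add: mink_simps)
  have "q * mink H e4 = 0" using 3 unfolding mH q_def by (auto simp: algebra_simps)
  moreover have "q * mink H e3 = 0" using 4 unfolding mH q_def by (auto simp: algebra_simps)
  moreover have "mink H e3 \<noteq> 0 \<or> mink H e4 \<noteq> 0" using exp[OF H(1,2)] H(3) by auto
  ultimately have "q = 0" by auto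
  moreover have "wedge a b = - q *\<^sub>R wedge e3 e4"
    by (subst exp[OF a], subst exp[OF b])
      (simp add: wedge_simps q_def wedge_commute[of e4 e3] algebra_simps)
  ultimately show ?thesis by simp
qed

text \<open>Contraction with \<open>e1\<close> and \<open>e2\<close> does not see
  \<open>wedge m m'\<close>, whose factors are normal; it sends the other terms to a normal and a
  tangential vector, which must vanish separately.\<close>

lemma wedge_decomposition_unique:
  assumes e12: "orthonormal_pair e1 e2"
    and n: "mink n1 e1 = 0" "mink n1 e2 = 0" "mink n2 e1 = 0" "mink n2 e2 = 0"
    and m: "mink m e1 = 0" "mink m e2 = 0" "mink m' e1 = 0" "mink m' e2 = 0"
    and eq: "wedge e1 n1 + wedge e2 n2 + wedge m m' + c *\<^sub>R wedge e1 e2 = 0"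
  shows "n1 = 0" "n2 = 0" "c = 0"
proof -
  have 1: "c *\<^sub>R e2 = - n1"
    using arg_cong[OF eq, of "\<lambda>w. contract w e1"] e12 n m
    by (simp add: contract_simps contract_wedge orthonormal_pair_def)
  have 2: "c *\<^sub>R e1 = n2"
    using arg_cong[OF eq, of "\<lambda>w. contract w e2"] e12 n m
    by (simp add: contract_simps contract_wedge orthonormal_pair_def)
  show "c = 0"
    using arg_cong[OF 1, of "\<lambda>v. mink v e2"] n e12 by (simp add: mink_simps orthonormal_pair_def)
  then show "n1 = 0" "n2 = 0" using 1 2 by auto
qed

section \<open>Moving frames on a parameter domain\<close>

lemma two_times_eq_scaleR: "2 * v = 2 *\<^sub>R (v :: 'b::{semiring_1, real_vector}^'n)"
  by (simp only: mult_2 scaleR_2)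

lemma diff_eq_zero_transfer:
  fixes p q r :: "'b::ab_group_add"
  assumes "p = q" "r = p - q" shows "r = 0"
  using assms by simp

text \<open>The frame is carried as a pair of fields in the parameter plane, so that differentiating
  along it is an ordinary directional derivative and the bracket of the frame is that of plane
  fields.\<close>

locale framed_patch =
  fixes U :: "(real^2) set" and x :: "real^2 \<Rightarrow> real^4" and a1 a2 :: "real^2 \<Rightarrow> real^2"
  assumes open_U: "open U"
    and smooth_x: "smooth_on U x"
    and inj_D: "u \<in> U \<Longrightarrow> inj (D x u)"
    and smooth_a1: "smooth_on U a1" and smooth_a2: "smooth_on U a2"
    and orthonormal: "u \<in> U \<Longrightarrow> orthonormal_pair (D x u (a1 u)) (D x u (a2 u))"
    and positive: "u \<in> U \<Longrightarrow> det (vector [a1 u, a2 u] :: real^2^2) > 0"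
begin

section \<open>The frame, its connection form and its second fundamental form\<close>

definition E1 :: "real^2 \<Rightarrow> real^4" where "E1 u = D x u (a1 u)"
definition E2 :: "real^2 \<Rightarrow> real^4" where "E2 u = D x u (a2 u)"

abbreviation d1 :: "(real^2 \<Rightarrow> 'b::real_normed_vector) \<Rightarrow> real^2 \<Rightarrow> 'b" where "d1 f u \<equiv> D f u (a1 u)"
abbreviation d2 :: "(real^2 \<Rightarrow> 'b::real_normed_vector) \<Rightarrow> real^2 \<Rightarrow> 'b" where "d2 f u \<equiv> D f u (a2 u)"

text \<open>The connection form of the frame, evaluated on the two frame vectors.\<close>

definition \<omega>1 :: "real^2 \<Rightarrow> real" where "\<omega>1 u = mink (d1 E1 u) (E2 u)"
definition \<omega>2 :: "real^2 \<Rightarrow> real" where "\<omega>2 u = mink (d2 E1 u) (E2 u)"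

abbreviation N :: "real^2 \<Rightarrow> real^4 \<Rightarrow> real^4" where "N u \<equiv> normal_part (E1 u) (E2 u)"

definition h11 :: "real^2 \<Rightarrow> real^4" where "h11 u = N u (d1 E1 u)"
text \<open>Read off from \<open>d1 E2\<close>; that \<open>d2 E1\<close> has the same normal part
  is the symmetry of the second fundamental form, a consequence of vanishing torsion.\<close>

definition h12 :: "real^2 \<Rightarrow> real^4" where "h12 u = N u (d1 E2 u)"
definition h22 :: "real^2 \<Rightarrow> real^4" where "h22 u = N u (d2 E2 u)"

lemma orthonormal_E: "u \<in> U \<Longrightarrow> orthonormal_pair (E1 u) (E2 u)"
  using orthonormal by (simp add: E1_def E2_def)

lemma mink_E:
  assumes "u \<in> U"
  shows "mink (E1 u) (E1 u) = 1" "mink (E2 u) (E2 u) = 1" "mink (E1 u) (E2 u) = 0" "mink (E2 u) (E1 u) = 0"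
  using orthonormal_E[OF assms] by (simp_all add: orthonormal_pair_def)

lemma N_E: "u \<in> U \<Longrightarrow> N u (E1 u) = 0" "u \<in> U \<Longrightarrow> N u (E2 u) = 0"
  by (simp_all add: normal_part_def mink_E)

lemma N_normal: "mink v (E1 u) = 0 \<Longrightarrow> mink v (E2 u) = 0 \<Longrightarrow> N u v = v"
  by (simp add: normal_part_def)

lemma mink_N: "u \<in> U \<Longrightarrow> mink (N u v) (E1 u) = 0" "u \<in> U \<Longrightarrow> mink (N u v) (E2 u) = 0"
  by (simp_all add: mink_normal_part orthonormal_E)

text \<open>Cramer's rule in the basis \<open>a1 u\<close>, \<open>a2 u\<close>, independent since
  its determinant is positive; the coefficients are then identified by pairing the image with the
  orthonormal \<open>E1 u\<close>, \<open>E2 u\<close>.\<close>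

lemma tangent_coords:
  assumes "u \<in> U"
  shows "b = mink (D x u b) (E1 u) *\<^sub>R a1 u + mink (D x u b) (E2 u) *\<^sub>R a2 u"
proof -
  define p q where "p = a1 u" and "q = a2 u"
  define \<delta> where "\<delta> = p$1 * q$2 - p$2 * q$1"
  have "\<delta> \<noteq> 0" using positive[OF assms] by (simp add: det_2 \<delta>_def p_def q_def)
  define \<alpha> where "\<alpha> = (b$1 * q$2 - b$2 * q$1) / \<delta>"
  define \<beta> where "\<beta> = (p$1 * b$2 - p$2 * b$1) / \<delta>"
  have "b = (\<alpha> * \<delta> / \<delta>) *\<^sub>R p + (\<beta> * \<delta> / \<delta>) *\<^sub>R q"
  proof -
    have "\<delta> *\<^sub>R b = (b$1 * q$2 - b$2 * q$1) *\<^sub>R p + (p$1 * b$2 - p$2 * b$1) *\<^sub>R q"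
      by (simp add: vec_eq_iff forall_2 \<delta>_def algebra_simps)
    also have "b$1 * q$2 - b$2 * q$1 = \<alpha> * \<delta>" using \<open>\<delta> \<noteq> 0\<close> by (simp add: \<alpha>_def)
    also have "p$1 * b$2 - p$2 * b$1 = \<beta> * \<delta>" using \<open>\<delta> \<noteq> 0\<close> by (simp add: \<beta>_def)
    finally have "\<delta> *\<^sub>R b = (\<alpha> * \<delta>) *\<^sub>R p + (\<beta> * \<delta>) *\<^sub>R q" .
    then have "(1/\<delta>) *\<^sub>R \<delta> *\<^sub>R b = (1/\<delta>) *\<^sub>R ((\<alpha> * \<delta>) *\<^sub>R p + (\<beta> * \<delta>) *\<^sub>R q)" by simp
    then show ?thesis using \<open>\<delta> \<noteq> 0\<close> by (simp add: scaleR_add_right)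
  qed
  then have b: "b = \<alpha> *\<^sub>R a1 u + \<beta> *\<^sub>R a2 u" using \<open>\<delta> \<noteq> 0\<close> by (simp add: p_def q_def)
  have lin: "linear (D x u)" using linear_D[OF smooth_on_imp_differentiable[OF smooth_x assms]] .
  have "D x u b = \<alpha> *\<^sub>R E1 u + \<beta> *\<^sub>R E2 u"
    by (subst b) (simp add: E1_def E2_def linear_add[OF lin] linear_scale[OF lin])
  then show ?thesis using b by (simp add: mink_simps mink_E[OF assms])
qed

lemma D_coords:
  assumes "u \<in> U" "f differentiable (at u)"
  shows "D f u b = mink (D x u b) (E1 u) *\<^sub>R d1 f u + mink (D x u b) (E2 u) *\<^sub>R d2 f u"
proof -
  note lin = linear_D[OF assms(2)]
  have "D f u b = D f u (mink (D x u b) (E1 u) *\<^sub>R a1 u + mink (D x u b) (E2 u) *\<^sub>R a2 u)"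
    using tangent_coords[OF assms(1), of b] by simp
  then show ?thesis by (simp only: linear_add[OF lin] linear_scale[OF lin])
qed

lemma D_x_expansion:
  assumes "u \<in> U"
  shows "D x u b = mink (D x u b) (E1 u) *\<^sub>R E1 u + mink (D x u b) (E2 u) *\<^sub>R E2 u"
  using D_coords[OF assms smooth_on_imp_differentiable[OF smooth_x assms], of b] by (simp add: E1_def E2_def)

lemma N_tangent: "u \<in> U \<Longrightarrow> N u (D x u b) = 0"
  by (subst D_x_expansion) (simp_all add: normal_part_simps N_E)

lemma df: "smooth_on U f \<Longrightarrow> u \<in> U \<Longrightarrow> f differentiable (at u)"
  by (rule smooth_on_imp_differentiable)

lemma smooth_mink: "smooth_on U f \<Longrightarrow> smooth_on U g \<Longrightarrow> smooth_on U (\<lambda>u. mink (f u) (g u))"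
  by (rule smooth_on_bilinear[OF bounded_bilinear_mink _ _ open_U])

lemma smooth_d: "smooth_on U f \<Longrightarrow> smooth_on U (d1 f)" "smooth_on U f \<Longrightarrow> smooth_on U (d2 f)"
  by (rule smooth_on_D_along[OF _ smooth_a1 open_U], assumption)
    (rule smooth_on_D_along[OF _ smooth_a2 open_U], assumption)

lemma smooth_E: "smooth_on U E1" "smooth_on U E2"
  using smooth_d[OF smooth_x] by (simp_all add: E1_def[abs_def] E2_def[abs_def])

lemma smooth_N: "smooth_on U f \<Longrightarrow> smooth_on U (\<lambda>u. N u (f u))"
  unfolding normal_part_def
  by (intro smooth_on_diff smooth_on_scaleR smooth_mink smooth_E open_U)

lemma smooth_coeffs:
  "smooth_on U \<omega>1" "smooth_on U \<omega>2" "smooth_on U h11" "smooth_on U h12" "smooth_on U h22"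
  unfolding \<omega>1_def[abs_def] \<omega>2_def[abs_def] h11_def[abs_def] h12_def[abs_def] h22_def[abs_def]
  by (intro smooth_mink smooth_N smooth_d smooth_E)+

lemma D_mink:
  assumes "smooth_on U f" "smooth_on U g" "u \<in> U"
  shows "D (\<lambda>u. mink (f u) (g u)) u b = mink (D f u b) (g u) + mink (f u) (D g u b)"
  by (rule D_bilinear[OF bounded_bilinear_mink df[OF assms(1,3)] df[OF assms(2,3)]])

lemma mink_D_of_const:
  assumes "smooth_on U f" "smooth_on U g" "u \<in> U" "\<And>v. v \<in> U \<Longrightarrow> mink (f v) (g v) = c"
  shows "mink (D f u b) (g u) = - mink (f u) (D g u b)"
proof -
  have "D (\<lambda>u. mink (f u) (g u)) u b = D (\<lambda>_. c) u b"
    by (rule fun_cong[OF D_cong[OF open_U assms(3)]]) (use assms(4) in auto)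
  then show ?thesis using D_mink[OF assms(1-3), of b] by simp
qed

lemma mink_DE:
  assumes "u \<in> U"
  shows "mink (D E1 u b) (E1 u) = 0" "mink (D E2 u b) (E2 u) = 0"
    "mink (D E2 u b) (E1 u) = - mink (D E1 u b) (E2 u)"
  using mink_D_of_const[OF smooth_E(1) smooth_E(1) assms mink_E(1), of b]
    mink_D_of_const[OF smooth_E(2) smooth_E(2) assms mink_E(2), of b]
    mink_D_of_const[OF smooth_E(2) smooth_E(1) assms mink_E(4), of b]
  by (simp_all add: mink_commute)

section \<open>Structure equations, Codazzi equations and Weingarten formula\<close>

abbreviation bracket :: "real^2 \<Rightarrow> real^2" where "bracket u \<equiv> d1 a2 u - d2 a1 u"

lemma commutator_frame:
  fixes f :: "real^2 \<Rightarrow> 'b::euclidean_space"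
  assumes "smooth_on U f" "u \<in> U"
  shows "d1 (d2 f) u - d2 (d1 f) u = D f u (bracket u)"
  by (rule commutator[OF assms(1) open_U assms(2) df[OF smooth_a1 assms(2)] df[OF smooth_a2 assms(2)]])

lemma torsion_free:
  assumes "u \<in> U" shows "d1 E2 u - d2 E1 u = D x u (bracket u)"
  using commutator_frame[OF smooth_x assms] by (simp add: E1_def[abs_def] E2_def[abs_def])

lemma structure_equations:
  assumes u: "u \<in> U"
  shows "d1 E1 u = \<omega>1 u *\<^sub>R E2 u + h11 u" "d1 E2 u = - (\<omega>1 u *\<^sub>R E1 u) + h12 u"
    "d2 E1 u = \<omega>2 u *\<^sub>R E2 u + h12 u" "d2 E2 u = - (\<omega>2 u *\<^sub>R E1 u) + h22 u"
proof -
  \<comment> \<open>The bracket of the frame is tangent, so its normal part vanishes.\<close>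
  have "N u (d1 E2 u) - N u (d2 E1 u) = 0"
    using arg_cong[OF torsion_free[OF u], of "N u"] N_tangent[OF u] by (simp add: normal_part_simps)
  then have "h12 u = N u (d2 E1 u)" by (simp add: h12_def)
  then show "d2 E1 u = \<omega>2 u *\<^sub>R E2 u + h12 u"
    by (simp add: normal_part_def \<omega>2_def mink_DE[OF u])
qed (simp_all add: h11_def h12_def h22_def normal_part_def \<omega>1_def \<omega>2_def mink_DE[OF u])

lemma mink_h:
  assumes "u \<in> U"
  shows "mink (h11 u) (E1 u) = 0" "mink (h11 u) (E2 u) = 0" "mink (h12 u) (E1 u) = 0"
    "mink (h12 u) (E2 u) = 0" "mink (h22 u) (E1 u) = 0" "mink (h22 u) (E2 u) = 0"
  by (simp_all add: h11_def h12_def h22_def mink_N[OF assms])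

lemma N_h: "u \<in> U \<Longrightarrow> N u (h11 u) = h11 u" "u \<in> U \<Longrightarrow> N u (h12 u) = h12 u" "u \<in> U \<Longrightarrow> N u (h22 u) = h22 u"
  by (simp_all add: N_normal mink_h)

text \<open>The bracket of the frame is the antisymmetrised covariant derivative, so its components
  are \<open>- \<omega>1 u\<close> and \<open>- \<omega>2 u\<close>. This removes the bracket of the
  plane fields from all later identities.\<close>

lemma commutator_connection:
  fixes f :: "real^2 \<Rightarrow> 'b::euclidean_space"
  assumes f: "smooth_on U f" and u: "u \<in> U"
  shows "d1 (d2 f) u - d2 (d1 f) u = - (\<omega>1 u *\<^sub>R d1 f u) - \<omega>2 u *\<^sub>R d2 f u"
proof -
  have "D x u (bracket u) = - (\<omega>1 u *\<^sub>R E1 u) - \<omega>2 u *\<^sub>R E2 u"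
    using torsion_free[OF u] structure_equations[OF u] by simp
  then show ?thesis
    using commutator_frame[OF f u] D_coords[OF u df[OF f u], of "bracket u"]
    by (simp add: mink_simps mink_E[OF u])
qed

lemma D_sum_scaleR:
  assumes "smooth_on U c" "smooth_on U e" "smooth_on U n" "u \<in> U"
  shows "D (\<lambda>v. c v *\<^sub>R e v + n v) u b = D c u b *\<^sub>R e u + c u *\<^sub>R D e u b + D n u b"
  using D_add[OF df[OF smooth_on_scaleR[OF assms(1,2) open_U] assms(4)] df[OF assms(3,4)], of b]
    D_bilinear[OF bounded_bilinear_scaleR df[OF assms(1,4)] df[OF assms(2,4)], of b]
  by simp

lemma D_cong_smooth:
  assumes "smooth_on U f" "u \<in> U" "\<And>v. v \<in> U \<Longrightarrow> g v = f v"
  shows "D g u b = D f u b"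
  by (rule fun_cong[OF D_cong[OF open_U assms(2)]]) (use assms df in auto)

text \<open>Derivatives in the flat ambient space commute up to the bracket; these are the normal
  parts of that fact for \<open>E1\<close> and \<open>E2\<close>, the tangential ones being the
  Gauss equation. Solving for the derivatives of \<open>h12\<close> leaves those of
  \<open>h11\<close> and \<open>h22\<close>, which combine into derivatives of H.\<close>

lemma Codazzi:
  assumes u: "u \<in> U"
  shows "N u (d1 h12 u) = N u (d2 h11 u) + \<omega>1 u *\<^sub>R (h22 u - h11 u) - (2 * \<omega>2 u) *\<^sub>R h12 u"
    "N u (d2 h12 u) = N u (d1 h22 u) + \<omega>2 u *\<^sub>R (h22 u - h11 u) + (2 * \<omega>1 u) *\<^sub>R h12 u"
proof -
  note sm = smooth_coeffs smooth_E smooth_on_uminus[OF _ open_U] smooth_on_add[OF _ _ open_U]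
    smooth_on_scaleR[OF _ _ open_U]
  have neg: "D (\<lambda>v. - c v) u b = - D c u b" if "smooth_on U c" for c :: "real^2 \<Rightarrow> real" and b
    by (rule D_linear[OF bounded_linear_minus[OF bounded_linear_ident] df[OF that u]])
  have 1: "D (d2 E1) u b = (D \<omega>2 u b) *\<^sub>R E2 u + (\<omega>2 u) *\<^sub>R D E2 u b + D h12 u b" for b
  proof -
    have "D (d2 E1) u b = D (\<lambda>v. (\<omega>2 v) *\<^sub>R E2 v + h12 v) u b"
      by (rule D_cong_smooth[OF _ u], intro sm, simp add: structure_equations)
    also have "\<dots> = (D \<omega>2 u b) *\<^sub>R E2 u + (\<omega>2 u) *\<^sub>R D E2 u b + D h12 u b"
      by (subst D_sum_scaleR) (simp_all add: sm u)
    finally show ?thesis .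
  qed
  have 2: "D (d1 E1) u b = (D \<omega>1 u b) *\<^sub>R E2 u + (\<omega>1 u) *\<^sub>R D E2 u b + D h11 u b" for b
  proof -
    have "D (d1 E1) u b = D (\<lambda>v. (\<omega>1 v) *\<^sub>R E2 v + h11 v) u b"
      by (rule D_cong_smooth[OF _ u], intro sm, simp add: structure_equations)
    also have "\<dots> = (D \<omega>1 u b) *\<^sub>R E2 u + (\<omega>1 u) *\<^sub>R D E2 u b + D h11 u b"
      by (subst D_sum_scaleR) (simp_all add: sm u)
    finally show ?thesis .
  qed
  have 3: "D (d2 E2) u b = (- D \<omega>2 u b) *\<^sub>R E1 u + (- \<omega>2 u) *\<^sub>R D E1 u b + D h22 u b" for b
  proof -
    have "D (d2 E2) u b = D (\<lambda>v. (- \<omega>2 v) *\<^sub>R E1 v + h22 v) u b"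
      by (rule D_cong_smooth[OF _ u], intro sm, simp add: structure_equations)
    also have "\<dots> = (- D \<omega>2 u b) *\<^sub>R E1 u + (- \<omega>2 u) *\<^sub>R D E1 u b + D h22 u b"
      by (subst D_sum_scaleR) (simp_all add: sm u neg)
    finally show ?thesis .
  qed
  have 4: "D (d1 E2) u b = (- D \<omega>1 u b) *\<^sub>R E1 u + (- \<omega>1 u) *\<^sub>R D E1 u b + D h12 u b" for b
  proof -
    have "D (d1 E2) u b = D (\<lambda>v. (- \<omega>1 v) *\<^sub>R E1 v + h12 v) u b"
      by (rule D_cong_smooth[OF _ u], intro sm, simp add: structure_equations)
    also have "\<dots> = (- D \<omega>1 u b) *\<^sub>R E1 u + (- \<omega>1 u) *\<^sub>R D E1 u b + D h12 u b"
      by (subst D_sum_scaleR) (simp_all add: sm u neg)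
    finally show ?thesis .
  qed
  note simps = normal_part_simps N_E[OF u] N_h[OF u] structure_equations[OF u]
  have "\<omega>2 u *\<^sub>R h12 u + N u (d1 h12 u) - (\<omega>1 u *\<^sub>R h22 u + N u (d2 h11 u)) = - (\<omega>1 u *\<^sub>R h11 u) - \<omega>2 u *\<^sub>R h12 u"
    using arg_cong[OF commutator_connection[OF smooth_E(1) u], of "N u"] unfolding 1 2 by (simp add: simps)
  from this have "N u (d1 h12 u) - (N u (d2 h11 u) + \<omega>1 u *\<^sub>R (h22 u - h11 u) - (\<omega>2 u + \<omega>2 u) *\<^sub>R h12 u) = 0"
    by (rule diff_eq_zero_transfer) (simp add: algebra_simps two_times_eq_scaleR)
  then show "N u (d1 h12 u) = N u (d2 h11 u) + \<omega>1 u *\<^sub>R (h22 u - h11 u) - (2 * \<omega>2 u) *\<^sub>R h12 u"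
    unfolding mult_2 by simp
  have "- (\<omega>2 u *\<^sub>R h11 u) + N u (d1 h22 u) - (- (\<omega>1 u *\<^sub>R h12 u) + N u (d2 h12 u)) = - (\<omega>1 u *\<^sub>R h12 u) - \<omega>2 u *\<^sub>R h22 u"
    using arg_cong[OF commutator_connection[OF smooth_E(2) u], of "N u"] unfolding 3 4 by (simp add: simps)
  then have "N u (d1 h22 u) + \<omega>2 u *\<^sub>R (h22 u - h11 u) + (\<omega>1 u + \<omega>1 u) *\<^sub>R h12 u - N u (d2 h12 u) = 0"
    by (rule diff_eq_zero_transfer) (simp add: algebra_simps two_times_eq_scaleR)
  then show "N u (d2 h12 u) = N u (d1 h22 u) + \<omega>2 u *\<^sub>R (h22 u - h11 u) + (2 * \<omega>1 u) *\<^sub>R h12 u"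
    unfolding mult_2 by simp
qed

text \<open>Differentiating the orthogonality of \<open>n\<close> to the frame moves the derivative
  onto \<open>E1\<close> and \<open>E2\<close>. The tangential part of \<open>D n u b\<close> thus
  involves only the value of \<open>n\<close>, which turns parallelism into a linear homogeneous
  system.\<close>

lemma Weingarten:
  assumes n: "smooth_on U n" "\<And>v. v \<in> U \<Longrightarrow> mink (n v) (E1 v) = 0" "\<And>v. v \<in> U \<Longrightarrow> mink (n v) (E2 v) = 0"
    and u: "u \<in> U"
  shows "D n u b = N u (D n u b) - mink (n u) (D E1 u b) *\<^sub>R E1 u - mink (n u) (D E2 u b) *\<^sub>R E2 u"
  using mink_D_of_const[OF n(1) smooth_E(1) u n(2), of b] mink_D_of_const[OF n(1) smooth_E(2) u n(3), of b]
  by (simp add: normal_part_def)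

lemma Weingarten_h:
  assumes u: "u \<in> U"
    and n: "smooth_on U n" "\<And>v. v \<in> U \<Longrightarrow> mink (n v) (E1 v) = 0" "\<And>v. v \<in> U \<Longrightarrow> mink (n v) (E2 v) = 0"
  shows "d1 n u = N u (d1 n u) - mink (n u) (h11 u) *\<^sub>R E1 u - mink (n u) (h12 u) *\<^sub>R E2 u"
    "d2 n u = N u (d2 n u) - mink (n u) (h12 u) *\<^sub>R E1 u - mink (n u) (h22 u) *\<^sub>R E2 u"
  using Weingarten[OF n u, of "a1 u"] Weingarten[OF n u, of "a2 u"] n(2)[OF u] n(3)[OF u]
  by (simp_all add: structure_equations[OF u] mink_simps)

section \<open>The Laplacian of the tangent bivector\<close>

definition \<tau> :: "real^2 \<Rightarrow> real^4^4" where "\<tau> u = wedge (E1 u) (E2 u)"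

definition Hm :: "real^2 \<Rightarrow> real^4" where "Hm u = (1/2) *\<^sub>R (h11 u + h22 u)"

text \<open>The covariant derivatives of the frame vectors along themselves, \<omega>1 E2 and -
  \<omega>2 E1, are written out here.\<close>

definition lap :: "(real^2 \<Rightarrow> 'b::real_normed_vector) \<Rightarrow> real^2 \<Rightarrow> 'b" where
  "lap G u = (\<omega>1 u *\<^sub>R d2 G u - d1 (d1 G) u) + (- (\<omega>2 u *\<^sub>R d1 G u) - d2 (d2 G) u)"

text \<open>The squared length of the second fundamental form; the normal plane is Lorentzian, so it
  may be negative.\<close>

definition norm_h :: "real^2 \<Rightarrow> real" where
  "norm_h u = mink (h11 u) (h11 u) + 2 * mink (h12 u) (h12 u) + mink (h22 u) (h22 u)"

lemma smooth_wedge: "smooth_on U f \<Longrightarrow> smooth_on U g \<Longrightarrow> smooth_on U (\<lambda>u. wedge (f u) (g u))"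
  by (rule smooth_on_bilinear[OF bounded_bilinear_wedge _ _ open_U])

lemma D_wedge:
  assumes "smooth_on U f" "smooth_on U g" "u \<in> U"
  shows "D (\<lambda>u. wedge (f u) (g u)) u b = wedge (D f u b) (g u) + wedge (f u) (D g u b)"
  by (rule D_bilinear[OF bounded_bilinear_wedge df[OF assms(1,3)] df[OF assms(2,3)]])

lemma smooth_\<tau>: "smooth_on U \<tau>"
  unfolding \<tau>_def[abs_def] by (intro smooth_wedge smooth_E)

lemma smooth_Hm: "smooth_on U Hm"
  unfolding Hm_def[abs_def] by (intro smooth_on_scaleR smooth_on_add smooth_coeffs open_U smooth_on_const)

lemma smooth_norm_h: "smooth_on U norm_h"
  unfolding norm_h_def[abs_def]
  by (intro smooth_on_add smooth_on_bilinear[OF bounded_bilinear_mult] smooth_mink smooth_coeffs open_U smooth_on_const)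

lemma mink_Hm: "u \<in> U \<Longrightarrow> mink (Hm u) (E1 u) = 0" "u \<in> U \<Longrightarrow> mink (Hm u) (E2 u) = 0"
  by (simp_all add: Hm_def mink_simps mink_h)

lemma d_\<tau>:
  assumes "u \<in> U"
  shows "d1 \<tau> u = wedge (h11 u) (E2 u) + wedge (E1 u) (h12 u)"
    "d2 \<tau> u = wedge (h12 u) (E2 u) + wedge (E1 u) (h22 u)"
  using D_wedge[OF smooth_E assms] structure_equations[OF assms]
  by (simp_all add: \<tau>_def[abs_def] wedge_simps)

lemma dd_\<tau>:
  assumes u: "u \<in> U"
  shows "d1 (d1 \<tau>) u = wedge (d1 h11 u) (E2 u) + wedge (h11 u) (d1 E2 u)
      + (wedge (d1 E1 u) (h12 u) + wedge (E1 u) (d1 h12 u))"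
    "d2 (d2 \<tau>) u = wedge (d2 h12 u) (E2 u) + wedge (h12 u) (d2 E2 u)
      + (wedge (d2 E1 u) (h22 u) + wedge (E1 u) (d2 h22 u))"
proof -
  note sm = smooth_coeffs(3-5) smooth_E smooth_wedge smooth_on_add[OF _ _ open_U]
  have "d1 (d1 \<tau>) u = d1 (\<lambda>u. wedge (h11 u) (E2 u) + wedge (E1 u) (h12 u)) u"
    by (rule D_cong_smooth) (auto intro!: sm u simp: d_\<tau>)
  then show "d1 (d1 \<tau>) u = wedge (d1 h11 u) (E2 u) + wedge (h11 u) (d1 E2 u)
      + (wedge (d1 E1 u) (h12 u) + wedge (E1 u) (d1 h12 u))"
    using D_add[OF df[OF sm(6)[OF sm(1,5)] u] df[OF sm(6)[OF sm(4,2)] u]]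
      D_wedge[OF sm(1,5) u] D_wedge[OF sm(4,2) u] by simp
  have "d2 (d2 \<tau>) u = d2 (\<lambda>u. wedge (h12 u) (E2 u) + wedge (E1 u) (h22 u)) u"
    by (rule D_cong_smooth) (auto intro!: sm u simp: d_\<tau>)
  then show "d2 (d2 \<tau>) u = wedge (d2 h12 u) (E2 u) + wedge (h12 u) (d2 E2 u)
      + (wedge (d2 E1 u) (h22 u) + wedge (E1 u) (d2 h22 u))"
    using D_add[OF df[OF sm(6)[OF sm(2,5)] u] df[OF sm(6)[OF sm(4,3)] u]]
      D_wedge[OF sm(2,5) u] D_wedge[OF sm(4,3) u] by simp
qed

lemma d_Hm:
  assumes u: "u \<in> U"
  shows "D Hm u b = (1/2) *\<^sub>R (D h11 u b + D h22 u b)"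
  using D_linear[OF bounded_linear_scaleR_right
      df[OF smooth_on_add[OF smooth_coeffs(3,5) open_U] u], of "1/2" b]
    D_add[OF df[OF smooth_coeffs(3) u] df[OF smooth_coeffs(5) u], of b]
  by (simp add: Hm_def[abs_def])

text \<open>After the Codazzi equations the normal derivatives left are those of \<open>h11\<close>
  and \<open>h22\<close>. The ones along \<open>E1\<close> occur in wedge products with
  \<open>E2 u\<close> and add up to twice the derivative of H; likewise with the roles exchanged.
  All terms containing \<omega>1 or \<omega>2 cancel, in accordance with the Laplacian being
  independent of the frame.\<close>

lemma lap_\<tau>:
  assumes u: "u \<in> U"
  shows "lap \<tau> u = norm_h u *\<^sub>R \<tau> u - 2 *\<^sub>R wedge (h11 u - h22 u) (h12 u)
     - 2 *\<^sub>R wedge (E1 u) (N u (d2 Hm u)) + 2 *\<^sub>R wedge (E2 u) (N u (d1 Hm u))"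
proof -
  note w11 = Weingarten_h(1)[OF u smooth_coeffs(3) mink_h(1,2)]
  note w12 = Weingarten_h[OF u smooth_coeffs(4) mink_h(3,4)]
  note w22 = Weingarten_h(2)[OF u smooth_coeffs(5) mink_h(5,6)]
  define A where "A = N u (d1 h11 u)"
  define B where "B = N u (d2 h11 u)"
  define C where "C = N u (d1 h22 u)"
  define F where "F = N u (d2 h22 u)"
  have 1: "d1 h11 u = A - mink (h11 u) (h11 u) *\<^sub>R E1 u - mink (h11 u) (h12 u) *\<^sub>R E2 u"
    using w11 by (simp add: A_def)
  have 2: "d1 h12 u = B + \<omega>1 u *\<^sub>R (h22 u - h11 u) - (2 * \<omega>2 u) *\<^sub>R h12 u
      - mink (h12 u) (h11 u) *\<^sub>R E1 u - mink (h12 u) (h12 u) *\<^sub>R E2 u"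
    using w12(1) Codazzi(1)[OF u] by (simp add: B_def)
  have 3: "d2 h12 u = C + \<omega>2 u *\<^sub>R (h22 u - h11 u) + (2 * \<omega>1 u) *\<^sub>R h12 u
      - mink (h12 u) (h12 u) *\<^sub>R E1 u - mink (h12 u) (h22 u) *\<^sub>R E2 u"
    using w12(2) Codazzi(2)[OF u] by (simp add: C_def)
  have 4: "d2 h22 u = F - mink (h22 u) (h12 u) *\<^sub>R E1 u - mink (h22 u) (h22 u) *\<^sub>R E2 u"
    using w22 by (simp add: F_def)
  have 5: "2 *\<^sub>R N u (d1 Hm u) = A + C" "2 *\<^sub>R N u (d2 Hm u) = B + F"
    by (simp_all add: d_Hm[OF u] normal_part_simps A_def B_def C_def F_def)
  have 6: "lap \<tau> u = norm_h u *\<^sub>R \<tau> u - 2 *\<^sub>R wedge (h11 u - h22 u) (h12 u)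
     - wedge (E1 u) (2 *\<^sub>R N u (d2 Hm u)) + wedge (E2 u) (2 *\<^sub>R N u (d1 Hm u))"
    unfolding 5 lap_def norm_h_def dd_\<tau>[OF u] d_\<tau>[OF u] 1 2 3 4 structure_equations[OF u] \<tau>_def
    by (simp add: wedge_simps wedge_commute[of A "E2 u"] wedge_commute[of C "E2 u"]
        wedge_commute[of "h11 u" "E1 u"] wedge_commute[of "h12 u" "E1 u"]
        wedge_commute[of "h11 u" "E2 u"] wedge_commute[of "h12 u" "E2 u"]
        wedge_commute[of "h22 u" "E2 u"] wedge_commute[of "h22 u" "h12 u"] mink_commute
        algebra_simps two_times_eq_scaleR)
  then show ?thesis by (simp only: wedge.scaleR_right)
qed

lemma lap_\<tau>_eigen_imp_parallel:
  assumes u: "u \<in> U" and eq: "lap \<tau> u = c *\<^sub>R \<tau> u"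
  shows "N u (D Hm u b) = 0"
proof -
  have "wedge (E1 u) (- 2 *\<^sub>R N u (d2 Hm u)) + wedge (E2 u) (2 *\<^sub>R N u (d1 Hm u))
      + wedge (- 2 *\<^sub>R (h11 u - h22 u)) (h12 u) + (norm_h u - c) *\<^sub>R wedge (E1 u) (E2 u) = 0"
    using eq unfolding lap_\<tau>[OF u] \<tau>_def by (simp add: wedge_simps algebra_simps)
  from wedge_decomposition_unique[OF orthonormal_E[OF u] _ _ _ _ _ _ _ _ this]
  have "N u (d2 Hm u) = 0" "N u (d1 Hm u) = 0"
    by (simp_all add: mink_simps mink_N[OF u] mink_h[OF u])
  then show ?thesis by (subst D_coords[OF u df[OF smooth_Hm u]]) (simp add: normal_part_simps)
qed

text \<open>For parallel H the first derivatives are tangent and given by the Weingarten formula.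
  Differentiating once more, the normal parts contain only products with the second fundamental
  form. The commutator has normal part 0, and comparing both orders yields the Ricci equation:
  contracting \<open>wedge (h11 u - h22 u) (h12 u)\<close> with H gives 0.\<close>

lemma parallel_imp_lap_\<tau>_eigen:
  assumes par: "\<And>v b. v \<in> U \<Longrightarrow> N v (D Hm v b) = 0" and u: "u \<in> U" and ne: "Hm u \<noteq> 0"
  shows "lap \<tau> u = norm_h u *\<^sub>R \<tau> u"
proof -
  have w: "d1 Hm v = - mink (Hm v) (h11 v) *\<^sub>R E1 v + - (mink (Hm v) (h12 v) *\<^sub>R E2 v)"
    "d2 Hm v = - mink (Hm v) (h12 v) *\<^sub>R E1 v + - (mink (Hm v) (h22 v) *\<^sub>R E2 v)" if "v \<in> U" for v
    using Weingarten_h[OF that smooth_Hm mink_Hm] par[OF that] by simp_all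
  have smc: "smooth_on U (\<lambda>v. - mink (Hm v) (n v))" "smooth_on U (\<lambda>v. - (mink (Hm v) (n v) *\<^sub>R E2 v))"
    if "smooth_on U n" for n
    by (intro smooth_on_uminus smooth_on_scaleR smooth_mink smooth_Hm that open_U smooth_E)+
  have ND2: "N u (D (\<lambda>v. - (mink (Hm v) (n v) *\<^sub>R E2 v)) u b) = - (mink (Hm u) (n u) *\<^sub>R N u (D E2 u b))"
    if n: "smooth_on U n" for n b
    using D_linear[OF bounded_linear_minus[OF bounded_linear_ident]
        df[OF smooth_on_scaleR[OF smooth_mink[OF smooth_Hm n] smooth_E(2) open_U] u], of b]
      D_bilinear[OF bounded_bilinear_scaleR df[OF smooth_mink[OF smooth_Hm n] u] df[OF smooth_E(2) u], of b]
    by (simp add: normal_part_simps N_E[OF u])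
  \<comment> \<open>Derivatives of the coefficients stay tangential, so only the derivatives of the
    frame vectors contribute.\<close>
  have ND: "N u (D (\<lambda>v. - mink (Hm v) (n v) *\<^sub>R E1 v + - (mink (Hm v) (m v) *\<^sub>R E2 v)) u b)
      = - (mink (Hm u) (n u) *\<^sub>R N u (D E1 u b)) - mink (Hm u) (m u) *\<^sub>R N u (D E2 u b)"
    if n: "smooth_on U n" and m: "smooth_on U m" for n m b
    using D_sum_scaleR[OF smc(1)[OF n] smooth_E(1) smc(2)[OF m] u, of b] ND2[OF m, of b]
    by (simp add: normal_part_simps N_E[OF u])
  have sm2: "smooth_on U (\<lambda>v. - mink (Hm v) (n v) *\<^sub>R E1 v + - (mink (Hm v) (m v) *\<^sub>R E2 v))"
    if "smooth_on U n" "smooth_on U m" for n m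
    by (intro smooth_on_add smooth_on_scaleR smc that smooth_E open_U)
  have "N u (d1 (d2 Hm) u) = - (mink (Hm u) (h12 u) *\<^sub>R h11 u) - mink (Hm u) (h22 u) *\<^sub>R h12 u"
    using D_cong_smooth[OF sm2[OF smooth_coeffs(4,5)] u w(2), of "a1 u"] ND[OF smooth_coeffs(4,5), of "a1 u"]
    by (simp add: structure_equations[OF u] normal_part_simps N_E[OF u] N_h[OF u])
  moreover have "N u (d2 (d1 Hm) u) = - (mink (Hm u) (h11 u) *\<^sub>R h12 u) - mink (Hm u) (h12 u) *\<^sub>R h22 u"
    using D_cong_smooth[OF sm2[OF smooth_coeffs(3,4)] u w(1), of "a2 u"] ND[OF smooth_coeffs(3,4), of "a2 u"]
    by (simp add: structure_equations[OF u] normal_part_simps N_E[OF u] N_h[OF u])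
  moreover have "N u (d1 (d2 Hm) u) - N u (d2 (d1 Hm) u) = 0"
    using arg_cong[OF commutator_connection[OF smooth_Hm u], of "N u"] par[OF u] by (simp add: normal_part_simps)
  ultimately have "(- (mink (Hm u) (h12 u) *\<^sub>R h11 u) - mink (Hm u) (h22 u) *\<^sub>R h12 u)
      - (- (mink (Hm u) (h11 u) *\<^sub>R h12 u) - mink (Hm u) (h12 u) *\<^sub>R h22 u) = 0"
    by (simp only:)
  then have "mink (h12 u) (Hm u) *\<^sub>R (h11 u - h22 u) = mink (h11 u - h22 u) (Hm u) *\<^sub>R h12 u"
    by (simp add: mink_simps mink_commute[of _ "Hm u"] algebra_simps)
  then have "wedge (h11 u - h22 u) (h12 u) = 0"
    by (intro wedge_normals_eq_0[OF orthonormal_E[OF u] _ _ _ _ mink_Hm[OF u] ne])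
      (simp_all add: mink_simps mink_h[OF u])
  then show ?thesis by (simp add: lap_\<tau>[OF u] par[OF u] wedge_simps)
qed

text \<open>A parallel normal field satisfies a first-order linear homogeneous system, so on a small ball
  its supremum bounds itself with a factor less than one. Since \<open>H\<close> may be light-like, constancy of
  \<open>\<langle>H, H\<rangle>\<close> would not suffice here.\<close>

lemma parallel_zero_locally:
  assumes par: "\<And>v b. v \<in> U \<Longrightarrow> N v (D Hm v b) = 0" and u: "u \<in> U" and zero: "Hm u = 0"
  obtains r where "r > 0" "ball u r \<subseteq> U" "\<And>v. v \<in> ball u r \<Longrightarrow> Hm v = 0"
proof -
  obtain r0 where r0: "r0 > 0" "cball u r0 \<subseteq> U" using open_U u open_contains_cball by blast
  have bound: "\<exists>K. \<forall>v\<in>cball u r0. norm (f v) \<le> K" if "smooth_on U f" for f :: "real^2 \<Rightarrow> 'b::euclidean_space"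
  proof -
    have "compact (f ` cball u r0)"
      using smooth_on_imp_continuous_on[OF that] r0(2)
      by (intro compact_continuous_image compact_cball) (auto intro: continuous_on_subset)
    then have "bounded (f ` cball u r0)" by (rule compact_imp_bounded)
    then show ?thesis by (auto simp: bounded_iff)
  qed
  obtain Kmink where Kmink: "Kmink > 0" "\<And>a b. norm (mink a b) \<le> norm a * norm b * Kmink"
    using mink.pos_bounded by blast
  \<comment> \<open>The sum over the basis dominates the operator norm of the derivative, and each
    summand is bounded on the compact ball by continuity.\<close>
  define L where "L f v = (\<Sum>b\<in>Basis. norm (D f v b))" for f :: "real^2 \<Rightarrow> real^4" and v
  have DL: "norm (D f v b) \<le> L f v * norm b" if "smooth_on U f" "v \<in> U" for f v b
  proof -
    have "D f v b = (\<Sum>i\<in>Basis. (b \<bullet> i) *\<^sub>R D f v i)"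
      by (rule linear_eq_sum_Basis[OF linear_D[OF df[OF that]]])
    then have "norm (D f v b) \<le> (\<Sum>i\<in>Basis. norm ((b \<bullet> i) *\<^sub>R D f v i))"
      by (simp only:) (rule norm_sum)
    also have "\<dots> \<le> (\<Sum>i\<in>Basis. norm (D f v i) * norm b)"
      by (intro sum_mono) (simp add: Basis_le_norm mult.commute[of "norm (D f v _)"] mult_right_mono)
    finally show ?thesis by (simp add: L_def sum_distrib_right)
  qed
  have Lb: "\<exists>K. \<forall>v\<in>cball u r0. L f v \<le> K" if f: "smooth_on U f" for f
  proof -
    obtain K where "\<And>b v. v \<in> cball u r0 \<Longrightarrow> norm (D f v b) \<le> K b"
      using bound[OF smooth_on_D[OF f]] by metis
    then show ?thesis unfolding L_def by (metis (no_types, lifting) sum_mono)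
  qed
  obtain K1 where K1: "\<And>v. v \<in> cball u r0 \<Longrightarrow> L E1 v \<le> K1" using Lb[OF smooth_E(1)] by blast
  obtain K2 where K2: "\<And>v. v \<in> cball u r0 \<Longrightarrow> L E2 v \<le> K2" using Lb[OF smooth_E(2)] by blast
  obtain M1 where M1: "\<And>v. v \<in> cball u r0 \<Longrightarrow> norm (E1 v) \<le> M1" using bound[OF smooth_E(1)] by blast
  obtain M2 where M2: "\<And>v. v \<in> cball u r0 \<Longrightarrow> norm (E2 v) \<le> M2" using bound[OF smooth_E(2)] by blast
  \<comment> \<open>Bounds both terms of the Weingarten formula for a parallel H, each by the norm
    of the bilinear form times a derivative bound times a frame bound.\<close>
  define C where "C = Kmink * (K1 * M1 + K2 * M2)"
  have u0: "u \<in> cball u r0" using r0 by simp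
  have "0 \<le> K1" "0 \<le> K2" "0 \<le> M1" "0 \<le> M2"
    using K1[OF u0] K2[OF u0] M1[OF u0] M2[OF u0]
    by (smt (verit) L_def sum_nonneg norm_ge_zero)+
  then have C: "C \<ge> 0" using Kmink by (simp add: C_def)
  have DHm: "norm (D Hm v b) \<le> (C * norm (Hm v)) * norm b" if v: "v \<in> cball u r0" for v b
  proof -
    have vU: "v \<in> U" using v r0 by blast
    have bd: "norm (mink (Hm v) (D e v b) *\<^sub>R e v) \<le> (Kmink * (K * M)) * norm (Hm v) * norm b"
      if "smooth_on U e" "L e v \<le> K" "norm (e v) \<le> M" for e K M
    proof -
      have "norm (D e v b) \<le> K * norm b"
        using DL[OF that(1) vU, of b] mult_right_mono[OF that(2), of "norm b"] by simp
      then have "norm (mink (Hm v) (D e v b)) \<le> norm (Hm v) * (K * norm b) * Kmink"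
        using Kmink by (intro order_trans[OF Kmink(2)] mult_right_mono mult_left_mono) auto
      then have "norm (mink (Hm v) (D e v b)) * norm (e v) \<le> (norm (Hm v) * (K * norm b) * Kmink) * M"
        using that(3) by (intro mult_mono) (auto intro: order_trans[OF norm_ge_zero])
      then show ?thesis by (simp add: mult_ac)
    qed
    have "D Hm v b = - (mink (Hm v) (D E1 v b) *\<^sub>R E1 v) - mink (Hm v) (D E2 v b) *\<^sub>R E2 v"
      using Weingarten[OF smooth_Hm mink_Hm vU, of b] par[OF vU, of b] by simp
    then have "norm (D Hm v b) \<le> norm (mink (Hm v) (D E1 v b) *\<^sub>R E1 v) + norm (mink (Hm v) (D E2 v b) *\<^sub>R E2 v)"
      by (metis norm_minus_cancel norm_triangle_ineq4)
    also have "\<dots> \<le> (Kmink * (K1 * M1)) * norm (Hm v) * norm b + (Kmink * (K2 * M2)) * norm (Hm v) * norm b"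
      by (intro add_mono bd smooth_E K1 K2 M1 M2 v)
    also have "\<dots> = (C * norm (Hm v)) * norm b" by (simp add: C_def algebra_simps)
    finally show ?thesis .
  qed
  \<comment> \<open>Chosen to make \<open>C * r\<close> less than 1; the summand in
    \<open>C + 1\<close> covers the case \<open>C = 0\<close>.\<close>
  define r where "r = min r0 (1 / (2 * (C + 1)))"
  have r: "r > 0" "r \<le> r0" using r0 C by (auto simp: r_def)
  have Cr: "C * r < 1"
  proof -
    have "C * r \<le> C * (1 / (2 * (C + 1)))" using C by (intro mult_left_mono) (auto simp: r_def)
    also have "\<dots> < 1" using C by (simp add: field_simps)
    finally show ?thesis .
  qed
  have sub: "cball u r \<subseteq> cball u r0" using r by auto
  have "continuous_on (cball u r) (\<lambda>v. norm (Hm v))"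
    using smooth_on_imp_continuous_on[OF smooth_Hm] sub r0(2)
    by (intro continuous_on_norm) (blast intro: continuous_on_subset)
  then obtain w where w: "w \<in> cball u r" "\<And>v. v \<in> cball u r \<Longrightarrow> norm (Hm v) \<le> norm (Hm w)"
    using continuous_attains_sup[of "cball u r" "\<lambda>v. norm (Hm v)"] r by auto
  \<comment> \<open>Mean value inequality from the centre, where H is 0, to the point
    \<open>w\<close> of largest norm: the maximum is at most \<open>C * r\<close> times
    itself.\<close>
  have "norm (Hm w - Hm u) \<le> (C * norm (Hm w)) * norm (w - u)"
  proof (rule differentiable_bound[where f = Hm and S = "cball u r" and f' = "D Hm"])
    show "(Hm has_derivative D Hm v) (at v within cball u r)" if "v \<in> cball u r" for v
      using has_derivative_D[OF df[OF smooth_Hm]] that sub r0(2) has_derivative_at_withinI by blast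
    show "onorm (D Hm v) \<le> C * norm (Hm w)" if v: "v \<in> cball u r" for v
    proof (rule onorm_bound)
      show "0 \<le> C * norm (Hm w)" using C by simp
      show "norm (D Hm v b) \<le> C * norm (Hm w) * norm b" for b
        using DHm[of v b] v sub C w(2)[OF v]
        by (smt (verit) mult_left_mono mult_right_mono norm_ge_zero subsetD)
    qed
  qed (use w r in auto)
  also have "\<dots> \<le> (C * norm (Hm w)) * r"
    using w(1) C by (intro mult_left_mono) (auto simp: dist_norm norm_minus_commute)
  finally have "norm (Hm w) * (1 - C * r) \<le> 0" by (simp add: zero algebra_simps)
  then have "norm (Hm w) \<le> 0" using Cr by (simp add: mult_le_0_iff)
  then have "Hm v = 0" if "v \<in> cball u r" for v using w(2)[OF that] by simp
  moreover have "ball u r \<subseteq> U" using sub r0(2) ball_subset_cball by blast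
  ultimately show thesis using that[of r] r(1) ball_subset_cball by blast
qed

end

section \<open>Charts of a space-like surface\<close>

lemma det_vector_linear:
  fixes L :: "real^2 \<Rightarrow> real^2"
  assumes "linear L"
  shows "det (vector [L a, L b] :: real^2^2) = det (matrix L) * det (vector [a, b] :: real^2^2)"
proof -
  have L: "L v = (\<chi> i. matrix L $ i $ 1 * v$1 + matrix L $ i $ 2 * v$2)" for v
  proof -
    have "v = v$1 *\<^sub>R axis 1 1 + v$2 *\<^sub>R axis 2 1" by (simp add: vec_eq_iff forall_2 axis_def)
    then have "L v = v$1 *\<^sub>R L (axis 1 1) + v$2 *\<^sub>R L (axis 2 1)"
      by (metis linear_add[OF assms] linear_scale[OF assms])
    then show ?thesis by (simp add: vec_eq_iff matrix_def mult.commute)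
  qed
  show ?thesis by (simp add: det_2 L algebra_simps)
qed

locale spacelike_surface =
  fixes S :: "'m surface"
  assumes surface: "oriented_spacelike_surface S"
begin

lemma chart:
  assumes "(U, \<phi>) \<in> params S"
  shows chart_open: "open U"
    and chart_openin: "openin (points S) (\<phi> ` U)"
    and chart_homeo: "homeomorphic_map (top_of_set U) (subtopology (points S) (\<phi> ` U)) \<phi>"
    and chart_smooth: "smooth_on U (position S \<circ> \<phi>)"
    and chart_inj_D: "u \<in> U \<Longrightarrow> inj (D (position S \<circ> \<phi>) u)"
  using surface assms
  by (auto simp: oriented_spacelike_surface_def oriented_surface_def immersed_def)

lemma chart_inj_on:
  assumes "(U, \<phi>) \<in> params S" shows "inj_on \<phi> U"
  using homeomorphic_imp_injective_map[OF chart_homeo[OF assms]] by simp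

lemma chart_topspace: "(U, \<phi>) \<in> params S \<Longrightarrow> u \<in> U \<Longrightarrow> \<phi> u \<in> topspace (points S)"
  using openin_subset[OF chart_openin] by blast

lemma chart_cover:
  assumes "p \<in> topspace (points S)"
  obtains U \<phi> u where "(U, \<phi>) \<in> params S" "u \<in> U" "\<phi> u = p"
proof -
  have "(\<Union>(U, \<phi>) \<in> params S. \<phi> ` U) = topspace (points S)"
    using surface by (simp add: oriented_spacelike_surface_def oriented_surface_def)
  with assms obtain c where c: "c \<in> params S" "p \<in> (case c of (U, \<phi>) \<Rightarrow> \<phi> ` U)" by blast
  obtain U \<phi> where "c = (U, \<phi>)" by (cases c)
  with c show thesis using that by auto
qed

lemma chart_open_vimage:
  assumes "(U, \<phi>) \<in> params S" "openin (points S) W"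
  shows "open (U \<inter> \<phi> -` W)"
proof -
  have "openin (subtopology (points S) (\<phi> ` U)) (\<phi> ` U \<inter> W)"
    using assms(2) by (rule openin_subtopology_Int2)
  from openin_continuous_map_preimage[OF homeomorphic_imp_continuous_map[OF chart_homeo[OF assms(1)]] this]
  have "openin (top_of_set U) {u \<in> U. \<phi> u \<in> \<phi> ` U \<inter> W}" by simp
  also have "{u \<in> U. \<phi> u \<in> \<phi> ` U \<inter> W} = U \<inter> \<phi> -` W" by auto
  finally show ?thesis using openin_open_eq[OF chart_open[OF assms(1)]] by blast
qed

lemma chart_open_image:
  assumes "(U, \<phi>) \<in> params S" "open T" "T \<subseteq> U"
  shows "openin (points S) (\<phi> ` T)"
proof -
  have "openin (top_of_set U) T"
    using assms(2,3) openin_open_eq[OF chart_open[OF assms(1)]] by blast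
  then have "openin (subtopology (points S) (\<phi> ` U)) (\<phi> ` T)"
    using homeomorphic_imp_open_map[OF chart_homeo[OF assms(1)]] by (simp add: open_map_def)
  then show ?thesis using openin_trans_full chart_openin[OF assms(1)] by blast
qed

section \<open>Change of charts\<close>

abbreviation transition where "transition \<phi> V \<psi> \<equiv> inv_into V \<psi> \<circ> \<phi>"

lemma transition:
  assumes "(U, \<phi>) \<in> params S" "(V, \<psi>) \<in> params S"
  shows transition_open: "open (U \<inter> \<phi> -` (\<psi> ` V))"
    and transition_smooth: "smooth_on (U \<inter> \<phi> -` (\<psi> ` V)) (transition \<phi> V \<psi>)"
    and transition_det: "u \<in> U \<Longrightarrow> \<phi> u \<in> \<psi> ` V \<Longrightarrow> det (matrix (D (transition \<phi> V \<psi>) u)) > 0"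
    and transition_maps: "\<phi> u \<in> \<psi> ` V \<Longrightarrow> transition \<phi> V \<psi> u \<in> V"
    and transition_inverse: "\<phi> u \<in> \<psi> ` V \<Longrightarrow> \<psi> (transition \<phi> V \<psi> u) = \<phi> u"
proof -
  show "open (U \<inter> \<phi> -` (\<psi> ` V))"
    by (rule chart_open_vimage[OF assms(1) chart_openin[OF assms(2)]])
  show "smooth_on (U \<inter> \<phi> -` (\<psi> ` V)) (transition \<phi> V \<psi>)"
    "u \<in> U \<Longrightarrow> \<phi> u \<in> \<psi> ` V \<Longrightarrow> det (matrix (D (transition \<phi> V \<psi>) u)) > 0"
    using surface assms by (fastforce simp: oriented_spacelike_surface_def oriented_surface_def)+
  show "\<phi> u \<in> \<psi> ` V \<Longrightarrow> transition \<phi> V \<psi> u \<in> V" "\<phi> u \<in> \<psi> ` V \<Longrightarrow> \<psi> (transition \<phi> V \<psi> u) = \<phi> u"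
    by (auto simp: inv_into_into f_inv_into_f)
qed

text \<open>Chain rule through the transition map. Comparisons of derivatives in two charts are
  instances of it, with \<open>G\<close> the position or the function being differentiated.\<close>

lemma D_transition:
  assumes c: "(U, \<phi>) \<in> params S" "(V, \<psi>) \<in> params S" and u: "u \<in> U" and v: "v \<in> V"
    and eq: "\<phi> u = \<psi> v" and G: "(G \<circ> \<psi>) differentiable (at v)"
  shows "D (G \<circ> \<phi>) u a = D (G \<circ> \<psi>) v (D (transition \<phi> V \<psi>) u a)"
proof -
  let ?N = "U \<inter> \<phi> -` (\<psi> ` V)" and ?\<tau> = "transition \<phi> V \<psi>"
  have uN: "u \<in> ?N" using u v eq by auto
  have \<tau>u: "?\<tau> u = v" using inv_into_f_f[OF chart_inj_on[OF c(2)] v] eq by simp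
  have d\<tau>: "?\<tau> differentiable (at u)"
    using smooth_on_imp_differentiable[OF transition_smooth[OF c] uN] .
  have "D (G \<circ> \<phi>) u = D (\<lambda>w. (G \<circ> \<psi>) (?\<tau> w)) u"
  proof (rule D_cong[OF transition_open[OF c] uN])
    show "(G \<circ> \<psi>) (?\<tau> w) = (G \<circ> \<phi>) w" if "w \<in> ?N" for w
      using transition_inverse[OF c, of w] that by simp
    show "(\<lambda>w. (G \<circ> \<psi>) (?\<tau> w)) differentiable (at u)"
      using differentiable_compose[of "G \<circ> \<psi>" ?\<tau> u UNIV] G d\<tau> \<tau>u by (simp only: )
  qed
  then show ?thesis using D_compose[OF d\<tau>, of "G \<circ> \<psi>"] G by (simp only: \<tau>u)
qed

lemma chart_differentiable:
  "(U, \<phi>) \<in> params S \<Longrightarrow> u \<in> U \<Longrightarrow> (position S \<circ> \<phi>) differentiable (at u)"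
  using smooth_on_imp_differentiable[OF chart_smooth] .

lemma tangent_space_chart:
  assumes c: "(U, \<phi>) \<in> params S" and u: "u \<in> U"
  shows "tangent_space S (\<phi> u) = range (D (position S \<circ> \<phi>) u)"
proof
  show "range (D (position S \<circ> \<phi>) u) \<subseteq> tangent_space S (\<phi> u)"
    using c u unfolding tangent_space_def by blast
  show "tangent_space S (\<phi> u) \<subseteq> range (D (position S \<circ> \<phi>) u)"
  proof
    fix v assume "v \<in> tangent_space S (\<phi> u)"
    then obtain V \<psi> w a where V: "(V, \<psi>) \<in> params S" "w \<in> V" "\<psi> w = \<phi> u"
      and v: "v = D (position S \<circ> \<psi>) w a"
      unfolding tangent_space_def by blast
    show "v \<in> range (D (position S \<circ> \<phi>) u)"
      using D_transition[OF V(1) c V(2) u V(3) chart_differentiable[OF c u]] v by simp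
  qed
qed

text \<open>The value is unique because the differential of the immersion is injective: coordinate
  vectors representing \<open>X\<close> in two charts correspond under the differential of the
  transition map.\<close>

lemma dirderiv_chart:
  assumes c: "(U, \<phi>) \<in> params S" and u: "u \<in> U" and X: "X (\<phi> u) = D (position S \<circ> \<phi>) u a"
    and G: "(G \<circ> \<phi>) differentiable (at u)"
  shows "dirderiv S X G (\<phi> u) = D (G \<circ> \<phi>) u a"
  unfolding dirderiv_def
proof (rule the_equality)
  show "\<exists>(U, \<phi>')\<in>params S. \<exists>u'\<in>U. \<exists>a'. \<phi>' u' = \<phi> u \<and> D (position S \<circ> \<phi>') u' a' = X (\<phi> u)
      \<and> D (G \<circ> \<phi>) u a = D (G \<circ> \<phi>') u' a'"
    by (rule bexI[OF _ c]) (use u X in auto)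
  fix d
  assume "\<exists>(V, \<psi>)\<in>params S. \<exists>v\<in>V. \<exists>b. \<psi> v = \<phi> u \<and> D (position S \<circ> \<psi>) v b = X (\<phi> u) \<and> d = D (G \<circ> \<psi>) v b"
  then obtain V \<psi> v b where V: "(V, \<psi>) \<in> params S" "v \<in> V" "\<psi> v = \<phi> u"
    and b: "D (position S \<circ> \<psi>) v b = X (\<phi> u)" and d: "d = D (G \<circ> \<psi>) v b" by blast
  note tr = D_transition[OF V(1) c V(2) u V(3)]
  have "D (position S \<circ> \<phi>) u (D (transition \<psi> U \<phi>) v b) = D (position S \<circ> \<phi>) u a"
    using tr[OF chart_differentiable[OF c u]] b X by simp
  then have "D (transition \<psi> U \<phi>) v b = a" using chart_inj_D[OF c u] by (simp add: inj_eq)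
  then show "d = D (G \<circ> \<phi>) u a" using d tr[OF G] by simp
qed

text \<open>Coordinate vectors in two charts differ by the differential of the transition map, whose
  determinant is positive.\<close>

lemma positive_pair_chart:
  assumes c: "(U, \<phi>) \<in> params S" and u: "u \<in> U"
  shows "positive_pair S (\<phi> u) (D (position S \<circ> \<phi>) u a) (D (position S \<circ> \<phi>) u b)
    \<longleftrightarrow> det (vector [a, b] :: real^2^2) > 0"
proof
  assume "det (vector [a, b] :: real^2^2) > 0"
  then show "positive_pair S (\<phi> u) (D (position S \<circ> \<phi>) u a) (D (position S \<circ> \<phi>) u b)"
    using c u unfolding positive_pair_def by blast
next
  assume "positive_pair S (\<phi> u) (D (position S \<circ> \<phi>) u a) (D (position S \<circ> \<phi>) u b)"
  then obtain V \<psi> v a' b' where V: "(V, \<psi>) \<in> params S" "v \<in> V" "\<psi> v = \<phi> u"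
    and ab: "D (position S \<circ> \<phi>) u a = D (position S \<circ> \<psi>) v a'" "D (position S \<circ> \<phi>) u b = D (position S \<circ> \<psi>) v b'"
    and pos: "det (vector [a', b'] :: real^2^2) > 0"
    unfolding positive_pair_def by blast
  note tr = D_transition[OF V(1) c V(2) u V(3) chart_differentiable[OF c u]]
  let ?L = "D (transition \<psi> U \<phi>) v"
  have "a = ?L a'" "b = ?L b'"
    using tr ab chart_inj_D[OF c u] by (metis injD)+
  moreover have vN: "v \<in> V \<inter> \<psi> -` (\<phi> ` U)" using V u by auto
  have "linear ?L" using linear_D[OF smooth_on_imp_differentiable[OF transition_smooth[OF V(1) c] vN]] .
  moreover have "det (matrix ?L) > 0" using transition_det[OF V(1) c, of v] vN by blast
  ultimately show "det (vector [a, b] :: real^2^2) > 0"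
    using pos by (simp add: det_vector_linear)
qed

text \<open>Smoothness is demanded in all charts of the atlas; in another chart the function is
  \<open>f\<close> after the transition map.\<close>

lemma smooth_fun_chartI:
  assumes c: "(U, \<phi>) \<in> params S" and f: "smooth_on U (\<lambda>u. f u)"
  shows "smooth_fun S (\<phi> ` U) (\<lambda>p. f (inv_into U \<phi> p))"
  unfolding smooth_fun_def
proof safe
  fix V \<psi> assume V: "(V, \<psi>) \<in> params S"
  have "smooth_on (V \<inter> \<psi> -` (\<phi> ` U)) (\<lambda>v. f (transition \<psi> U \<phi> v))"
    by (rule smooth_on_compose[OF f transition_smooth[OF V c] transition_open[OF V c]])
      (use transition_maps[OF V c] in auto)
  then show "smooth_on (V \<inter> \<psi> -` \<phi> ` U) ((\<lambda>p. f (inv_into U \<phi> p)) \<circ> \<psi>)"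
    by (simp add: comp_def)
qed

text \<open>Gram-Schmidt on the coordinate fields, carried out in the parameter plane with the
  induced metric, which is positive definite as the surface is space-like. The change of basis is
  triangular with positive diagonal, so the orientation is kept.\<close>

lemma framing_exists:
  assumes c: "(U, \<phi>) \<in> params S"
  obtains a1 a2 where "framed_patch U (position S \<circ> \<phi>) a1 a2"
proof -
  let ?x = "position S \<circ> \<phi>"
  note U = chart_open[OF c] and sx = chart_smooth[OF c]
  define b1 b2 :: "real^2" where "b1 = axis 1 1" and "b2 = axis 2 1"
  define x1 x2 where "x1 u = D ?x u b1" and "x2 u = D ?x u b2" for u
  define a1 where "a1 u = inverse (sqrt (mink (x1 u) (x1 u))) *\<^sub>R b1" for u
  define c2 where "c2 u = b2 - mink (x2 u) (D ?x u (a1 u)) *\<^sub>R a1 u" for u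
  define a2 where "a2 u = inverse (sqrt (mink (D ?x u (c2 u)) (D ?x u (c2 u)))) *\<^sub>R c2 u" for u
  have lin: "linear (D ?x u)" if "u \<in> U" for u
    using linear_D[OF chart_differentiable[OF c that]] .
  have pos: "mink (D ?x u a) (D ?x u a) > 0" if u: "u \<in> U" and a: "a \<noteq> 0" for u a
  proof -
    have "D ?x u a \<noteq> 0"
      using chart_inj_D[OF c u] a linear_0[OF lin[OF u]] by (metis injD)
    moreover have "D ?x u a \<in> tangent_space S (\<phi> u)" using tangent_space_chart[OF c u] by simp
    ultimately show ?thesis
      using surface chart_topspace[OF c u] by (auto simp: oriented_spacelike_surface_def spacelike_def)
  qed
  have sm: "smooth_on U (\<lambda>u. mink (f u) (g u))" if "smooth_on U f" "smooth_on U g" for f g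
    by (rule smooth_on_bilinear[OF bounded_bilinear_mink that U])
  have b1: "b1 \<noteq> 0" by (simp add: b1_def)
  have sx12: "smooth_on U x1" "smooth_on U x2"
    unfolding x1_def[abs_def] x2_def[abs_def] by (intro smooth_on_D sx)+
  have sa1: "smooth_on U a1"
    unfolding a1_def[abs_def]
    by (intro smooth_on_scaleR smooth_on_inverse_sqrt sm sx12 smooth_on_const U)
      (simp add: x1_def pos b1)
  have sc2: "smooth_on U c2"
    unfolding c2_def[abs_def]
    by (intro smooth_on_diff smooth_on_scaleR sm sx12 smooth_on_const smooth_on_D_along sx sa1 U)
  \<comment> \<open>\<open>a1 u\<close> is a multiple of the first basis vector, so subtracting it
    leaves the second coordinate of \<open>b2\<close> unchanged.\<close>
  have c2: "c2 u \<noteq> 0" for u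
  proof -
    have "c2 u $ 2 = 1" by (simp add: c2_def b2_def a1_def b1_def axis_def)
    then show ?thesis by auto
  qed
  have sa2: "smooth_on U a2"
    unfolding a2_def[abs_def]
    by (intro smooth_on_scaleR smooth_on_inverse_sqrt sm sc2 smooth_on_D_along sx U) (simp add: pos c2)
  have unit: "mink (inverse (sqrt (mink v v)) *\<^sub>R v) (inverse (sqrt (mink v v)) *\<^sub>R v) = 1"
    if "mink v v > 0" for v
  proof -
    have "inverse (sqrt (mink v v)) * inverse (sqrt (mink v v)) = inverse (mink v v)"
      using that by (metis inverse_mult_distrib order_less_imp_le real_sqrt_mult_self abs_of_pos)
    then show ?thesis using that by (simp add: mink_simps field_simps)
  qed
  have "framed_patch U ?x a1 a2"
  proof
    fix u assume u: "u \<in> U"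
    note l = linear_scale[OF lin[OF u]] linear_diff[OF lin[OF u]]
    have 1: "mink (D ?x u (a1 u)) (D ?x u (a1 u)) = 1"
      using unit[OF pos[OF u b1]] by (simp add: a1_def l x1_def)
    have 2: "mink (D ?x u (a2 u)) (D ?x u (a2 u)) = 1"
      using unit[OF pos[OF u c2[of u]]] by (simp add: a2_def l)
    have "mink (D ?x u (c2 u)) (D ?x u (a1 u)) = 0"
      using 1 by (simp add: c2_def l mink_simps x2_def)
    then have 3: "mink (D ?x u (a2 u)) (D ?x u (a1 u)) = 0" by (simp add: a2_def l mink_simps)
    show "orthonormal_pair (D ?x u (a1 u)) (D ?x u (a2 u))"
      using 1 2 3 by (simp add: orthonormal_pair_def mink_commute)
    have "det (vector [a1 u, a2 u] :: real^2^2) =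
        inverse (sqrt (mink (x1 u) (x1 u))) * inverse (sqrt (mink (D ?x u (c2 u)) (D ?x u (c2 u))))"
      by (simp add: det_2 a1_def a2_def c2_def b1_def b2_def axis_def)
    also have "\<dots> > 0" using pos[OF u b1] pos[OF u c2[of u]] by (simp add: x1_def)
    finally show "det (vector [a1 u, a2 u] :: real^2^2) > 0" .
  qed (use U sx sa1 sa2 chart_inj_D[OF c] in auto)
  then show thesis by (rule that)
qed

end

section \<open>Geometry in a framed chart\<close>

text \<open>With \<open>t\<close> the determinant, the second row is \<open>t\<close> times the
  first one turned by a right angle, and t^2 = 1; hence orthonormal rows give orthonormal
  columns.\<close>

lemma orthogonal_columns:
  fixes a b c d :: real
  assumes "a * a + b * b = 1" "c * c + d * d = 1" "a * c + b * d = 0"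
  shows "a * a + c * c = 1" "b * b + d * d = 1" "a * b + c * d = 0" "(a * d - b * c)\<^sup>2 = 1"
proof -
  define t where "t = a * d - b * c"
  have "t * a = (a * a) * d - b * (a * c)" by (simp add: t_def algebra_simps)
  also have "a * c = - b * d" using assms(3) by simp
  also have "(a * a) * d - b * (- b * d) = (a * a + b * b) * d" by (simp add: algebra_simps)
  finally have d: "d = t * a" using assms(1) by simp
  have "t * b = (a * (b * d)) - (b * b) * c" by (simp add: t_def algebra_simps)
  also have "b * d = - a * c" using assms(3) by simp
  also have "a * (- a * c) - (b * b) * c = - (a * a + b * b) * c" by (simp add: algebra_simps)
  finally have c: "c = - (t * b)" using assms(1) by simp
  have "t * t * (a * a + b * b) = c * c + d * d" unfolding c d by (simp add: algebra_simps)
  then have tt: "t * t = 1" using assms by simp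
  then show "(a * d - b * c)\<^sup>2 = 1" by (simp add: t_def power2_eq_square)
  have cc: "c * c = b * b" "d * d = a * a" "c * d = - (a * b)"
  proof -
    have "c * c = (t * t) * (b * b)" "d * d = (t * t) * (a * a)" "c * d = - ((t * t) * (a * b))"
      unfolding c d by (simp_all add: algebra_simps)
    then show "c * c = b * b" "d * d = a * a" "c * d = - (a * b)" by (simp_all add: tt)
  qed
  then show "a * a + c * c = 1" "b * b + d * d = 1" "a * b + c * d = 0" using assms by simp_all
qed

locale framed_chart = spacelike_surface S + framed_patch U "position S \<circ> \<phi>" a1 a2
  for S :: "'m surface" and U \<phi> a1 a2 +
  assumes in_params: "(U, \<phi>) \<in> params S"
begin

abbreviation "x \<equiv> position S \<circ> \<phi>"

lemma linear_Dx: "u \<in> U \<Longrightarrow> linear (D x u)"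
  using linear_D[OF df[OF smooth_x]] .

lemma tangent_iff:
  assumes "u \<in> U"
  shows "v \<in> tangent_space S (\<phi> u) \<longleftrightarrow> v = mink v (E1 u) *\<^sub>R E1 u + mink v (E2 u) *\<^sub>R E2 u"
proof
  assume "v \<in> tangent_space S (\<phi> u)"
  then show "v = mink v (E1 u) *\<^sub>R E1 u + mink v (E2 u) *\<^sub>R E2 u"
    using D_x_expansion[OF assms] unfolding tangent_space_chart[OF in_params assms] by blast
next
  assume "v = mink v (E1 u) *\<^sub>R E1 u + mink v (E2 u) *\<^sub>R E2 u"
  also have "\<dots> = D x u (mink v (E1 u) *\<^sub>R a1 u + mink v (E2 u) *\<^sub>R a2 u)"
    by (simp add: E1_def E2_def linear_add[OF linear_Dx[OF assms]] linear_scale[OF linear_Dx[OF assms]])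
  finally show "v \<in> tangent_space S (\<phi> u)" unfolding tangent_space_chart[OF in_params assms] by blast
qed

lemma normal_iff:
  assumes "u \<in> U"
  shows "v \<in> normal_space S (\<phi> u) \<longleftrightarrow> mink v (E1 u) = 0 \<and> mink v (E2 u) = 0"
proof
  have "E1 u \<in> tangent_space S (\<phi> u)" "E2 u \<in> tangent_space S (\<phi> u)"
    by (simp_all add: tangent_iff[OF assms] mink_E[OF assms])
  then show "v \<in> normal_space S (\<phi> u) \<Longrightarrow> mink v (E1 u) = 0 \<and> mink v (E2 u) = 0"
    by (simp add: normal_space_def)
  assume 0: "mink v (E1 u) = 0 \<and> mink v (E2 u) = 0"
  have "mink v w = 0" if "w \<in> tangent_space S (\<phi> u)" for w
  proof -
    have "mink v w = mink v (mink w (E1 u) *\<^sub>R E1 u + mink w (E2 u) *\<^sub>R E2 u)"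
      using that tangent_iff[OF assms] by simp
    then show ?thesis using 0 by (simp add: mink_simps)
  qed
  then show "v \<in> normal_space S (\<phi> u)" by (simp add: normal_space_def)
qed

definition tangent_part :: "real^2 \<Rightarrow> real^4 \<Rightarrow> real^4" where
  "tangent_part u v = mink v (E1 u) *\<^sub>R E1 u + mink v (E2 u) *\<^sub>R E2 u"

lemma N_eq: "N u v = v - tangent_part u v"
  by (simp add: normal_part_def tangent_part_def)

lemma mink_tangent_part:
  "u \<in> U \<Longrightarrow> mink (tangent_part u v) (E1 u) = mink v (E1 u)"
  "u \<in> U \<Longrightarrow> mink (tangent_part u v) (E2 u) = mink v (E2 u)"
  by (simp_all add: tangent_part_def mink_simps mink_E)

lemma tangent_part_tangent: "u \<in> U \<Longrightarrow> tangent_part u v \<in> tangent_space S (\<phi> u)"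
  by (simp add: tangent_iff mink_tangent_part) (simp add: tangent_part_def)

lemma tangent_part_of_tangent: "u \<in> U \<Longrightarrow> v \<in> tangent_space S (\<phi> u) \<Longrightarrow> tangent_part u v = v"
  by (metis tangent_iff tangent_part_def)

lemma mink_tangent_part_tangent:
  assumes "u \<in> U" "z \<in> tangent_space S (\<phi> u)"
  shows "mink (tangent_part u v) z = mink v z"
proof -
  have "z = tangent_part u z" using tangent_part_of_tangent[OF assms] by simp
  then have "mink w z = mink w (tangent_part u z)" for w by simp
  then show ?thesis
    by (simp add: tangent_part_def[of u z] mink_simps mink_tangent_part[OF assms(1)])
qed

definition chart_vector :: "('m \<Rightarrow> real^4) \<Rightarrow> real^2 \<Rightarrow> real^2" where
  "chart_vector X u = mink (X (\<phi> u)) (E1 u) *\<^sub>R a1 u + mink (X (\<phi> u)) (E2 u) *\<^sub>R a2 u"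

lemma D_x_chart_vector:
  assumes "u \<in> U" "X (\<phi> u) \<in> tangent_space S (\<phi> u)"
  shows "D x u (chart_vector X u) = X (\<phi> u)"
proof -
  have "D x u (chart_vector X u) = mink (X (\<phi> u)) (E1 u) *\<^sub>R E1 u + mink (X (\<phi> u)) (E2 u) *\<^sub>R E2 u"
    by (simp add: chart_vector_def E1_def E2_def linear_add[OF linear_Dx[OF assms(1)]] linear_scale[OF linear_Dx[OF assms(1)]])
  also have "\<dots> = X (\<phi> u)" using assms tangent_iff by simp
  finally show ?thesis .
qed

lemma dirderiv_chart_vector:
  assumes "u \<in> U" "X (\<phi> u) \<in> tangent_space S (\<phi> u)" "(G \<circ> \<phi>) differentiable (at u)"
  shows "dirderiv S X G (\<phi> u) = D (G \<circ> \<phi>) u (chart_vector X u)"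
  by (rule dirderiv_chart[OF in_params assms(1) _ assms(3)]) (simp add: D_x_chart_vector assms)

lemma inv_chart: "u \<in> U \<Longrightarrow> inv_into U \<phi> (\<phi> u) = u"
  by (rule inv_into_f_f[OF chart_inj_on[OF in_params]])

text \<open>Turns the moving frame, which lives on the parameter domain, into fields on the surface,
  as the definitions require.\<close>

definition push :: "(real^2 \<Rightarrow> 'b) \<Rightarrow> 'm \<Rightarrow> 'b" where
  "push f p = f (inv_into U \<phi> p)"

lemma push_chart: "u \<in> U \<Longrightarrow> push f (\<phi> u) = f u"
  by (simp add: push_def inv_chart)

lemma smooth_push: "smooth_on U f \<Longrightarrow> smooth_fun S (\<phi> ` U) (push f)"
  unfolding push_def[abs_def] by (rule smooth_fun_chartI[OF in_params])

lemma tangent_push: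
  "smooth_on U f \<Longrightarrow> (\<And>u. u \<in> U \<Longrightarrow> f u \<in> tangent_space S (\<phi> u)) \<Longrightarrow> tangent_field S (\<phi> ` U) (push f)"
  by (auto simp: tangent_field_def smooth_push push_chart)

lemma E_tangent: "u \<in> U \<Longrightarrow> E1 u \<in> tangent_space S (\<phi> u)" "u \<in> U \<Longrightarrow> E2 u \<in> tangent_space S (\<phi> u)"
  by (simp_all add: tangent_iff mink_E)

lemma tangent_frame_push: "tangent_frame S (\<phi> ` U) (push E1) (push E2)"
  unfolding tangent_frame_def
  using chart_openin[OF in_params]
  by (auto simp: push_chart mink_E tangent_push smooth_E E_tangent)

lemma field_smooth:
  assumes "smooth_fun S W X"
  shows "smooth_on (U \<inter> \<phi> -` W) (X \<circ> \<phi>)"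
  using assms in_params by (auto simp: smooth_fun_def)

lemma smooth_chart_vector:
  assumes W: "openin (points S) W" and X: "smooth_fun S W X"
  shows "smooth_on (U \<inter> \<phi> -` W) (chart_vector X)"
proof -
  note op = chart_open_vimage[OF in_params W]
  have X': "smooth_on (U \<inter> \<phi> -` W) (\<lambda>u. X (\<phi> u))" using field_smooth[OF X] by (simp add: comp_def)
  show ?thesis
    unfolding chart_vector_def[abs_def]
    by (intro smooth_on_add smooth_on_scaleR smooth_on_bilinear[OF bounded_bilinear_mink] X' op
        smooth_on_subset[OF smooth_E(1)] smooth_on_subset[OF smooth_E(2)]
        smooth_on_subset[OF smooth_a1] smooth_on_subset[OF smooth_a2]) auto
qed

lemma field_differentiable:
  assumes "smooth_fun S W X" "u \<in> U" "\<phi> u \<in> W"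
  shows "(X \<circ> \<phi>) differentiable (at u)"
  using smooth_on_imp_differentiable[OF field_smooth[OF assms(1)], of u] assms by auto

lemma dirderiv_mink:
  assumes "u \<in> U" "X (\<phi> u) \<in> tangent_space S (\<phi> u)"
    and "(Y \<circ> \<phi>) differentiable (at u)" "(Z \<circ> \<phi>) differentiable (at u)"
  shows "dirderiv S X (\<lambda>q. mink (Y q) (Z q)) (\<phi> u)
    = mink (dirderiv S X Y (\<phi> u)) (Z (\<phi> u)) + mink (Y (\<phi> u)) (dirderiv S X Z (\<phi> u))"
proof -
  have eq: "(\<lambda>q. mink (Y q) (Z q)) \<circ> \<phi> = (\<lambda>v. mink ((Y \<circ> \<phi>) v) ((Z \<circ> \<phi>) v))" by auto
  have "(\<lambda>v. mink ((Y \<circ> \<phi>) v) ((Z \<circ> \<phi>) v)) differentiable (at u)"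
    using bounded_bilinear.FDERIV[OF bounded_bilinear_mink has_derivative_D[OF assms(3)] has_derivative_D[OF assms(4)]]
    unfolding differentiable_def by blast
  then have "dirderiv S X (\<lambda>q. mink (Y q) (Z q)) (\<phi> u) = D (\<lambda>v. mink ((Y \<circ> \<phi>) v) ((Z \<circ> \<phi>) v)) u (chart_vector X u)"
    using dirderiv_chart_vector[where X = X, OF assms(1,2), of "\<lambda>q. mink (Y q) (Z q)"] by (simp only: eq)
  then show ?thesis
    using D_bilinear[OF bounded_bilinear_mink assms(3,4)]
    by (simp add: dirderiv_chart_vector[where X = X, OF assms(1,2)] assms(3,4))
qed

text \<open>With the Lie bracket written through ambient derivatives, the Koszul expression collapses to
  \<open>2 \<langle>X(Y), Z\<rangle>\<close>.\<close>

lemma levi_civita_chart: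
  assumes W: "openin (points S) W" and X: "tangent_field S W X" and Y: "tangent_field S W Y"
    and u: "u \<in> U" "\<phi> u \<in> W"
  shows "levi_civita S X Y (\<phi> u) = tangent_part u (dirderiv S X Y (\<phi> u))"
proof -
  let ?p = "\<phi> u"
  let ?K = "\<lambda>Z. dirderiv S X (\<lambda>q. mink (Y q) (Z q)) ?p + dirderiv S Y (\<lambda>q. mink (X q) (Z q)) ?p
           - dirderiv S Z (\<lambda>q. mink (X q) (Y q)) ?p + mink (lie_bracket S X Y ?p) (Z ?p)
           - mink (lie_bracket S X Z ?p) (Y ?p) - mink (lie_bracket S Y Z ?p) (X ?p)"
  have tg: "Z ?p \<in> tangent_space S ?p" "(Z \<circ> \<phi>) differentiable (at u)"
    if "tangent_field S W' Z" "?p \<in> W'" for W' Z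
    using that field_differentiable[OF _ u(1)] by (auto simp: tangent_field_def)
  have K: "?K Z = 2 * mink (dirderiv S X Y ?p) (Z ?p)" if Z: "tangent_field S W' Z" "?p \<in> W'" for W' Z
    using dirderiv_mink[where X = X, OF u(1) tg(1)[OF X u(2)] tg(2)[OF Y u(2)] tg(2)[OF Z]]
      dirderiv_mink[where X = Y, OF u(1) tg(1)[OF Y u(2)] tg(2)[OF X u(2)] tg(2)[OF Z]]
      dirderiv_mink[where X = Z, OF u(1) tg(1)[OF Z] tg(2)[OF X u(2)] tg(2)[OF Y u(2)]]
    by (simp add: lie_bracket_def mink_simps mink_commute[of "X ?p"] mink_commute[of "Y ?p"])
  show ?thesis
    unfolding levi_civita_def
  proof (rule the_equality, intro conjI allI impI)
    show "tangent_part u (dirderiv S X Y ?p) \<in> tangent_space S ?p"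
      by (rule tangent_part_tangent[OF u(1)])
    show "2 * mink (tangent_part u (dirderiv S X Y ?p)) (Z ?p) = ?K Z"
      if "openin (points S) W' \<and> ?p \<in> W' \<and> tangent_field S W' Z" for W' Z
      using K[of W' Z] that tg(1)[of W' Z] mink_tangent_part_tangent[OF u(1)] by simp
  next
    fix v
    assume v: "v \<in> tangent_space S ?p \<and>
       (\<forall>W Z. openin (points S) W \<and> ?p \<in> W \<and> tangent_field S W Z \<longrightarrow> 2 * mink v (Z ?p) = ?K Z)"
    have pU: "?p \<in> \<phi> ` U" using u by simp
    \<comment> \<open>The Koszul identity is tested against tangent fields, so the frame vectors are
      extended to fields; the pairings with both of them determine \<open>v\<close>.\<close>
    have "mink v (E u) = mink (dirderiv S X Y ?p) (E u)"
      if E: "smooth_on U E" "\<And>u. u \<in> U \<Longrightarrow> E u \<in> tangent_space S (\<phi> u)" for E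
    proof -
      note t = tangent_push[OF E]
      have "2 * mink v (push E ?p) = ?K (push E)" using v chart_openin[OF in_params] pU t by blast
      then show ?thesis using K[OF t pU] by (simp add: push_chart[OF u(1)])
    qed
    from this[OF smooth_E(1) E_tangent(1)] this[OF smooth_E(2) E_tangent(2)]
    show "v = tangent_part u (dirderiv S X Y ?p)"
      using v tangent_iff[OF u(1), of v] by (simp add: tangent_part_def)
  qed
qed

text \<open>The Christoffel symbols of the induced metric, contracted with \<open>a\<close> and
  \<open>b\<close>: the tangential part of the second derivative of the position, in
  coordinates.\<close>

definition \<Gamma> :: "real^2 \<Rightarrow> real^2 \<Rightarrow> real^2 \<Rightarrow> real^2" where
  "\<Gamma> u a b = mink (D2 x u a b) (E1 u) *\<^sub>R a1 u + mink (D2 x u a b) (E2 u) *\<^sub>R a2 u"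

lemma D_x_\<Gamma>: "u \<in> U \<Longrightarrow> D x u (\<Gamma> u a b) = tangent_part u (D2 x u a b)"
  by (simp add: \<Gamma>_def tangent_part_def E1_def E2_def linear_add[OF linear_Dx] linear_scale[OF linear_Dx])

lemma linear_tangent_part: "linear (tangent_part u)"
  by (rule linearI) (simp_all add: tangent_part_def mink_simps algebra_simps)

text \<open>A tangent field is \<open>D x\<close> applied to its coordinate vector. The product rule
  splits its derivative into a part depending on the fields only through their values at the point
  and a tangent part; the normal component is therefore tensorial.\<close>

lemma dirderiv_field:
  assumes W: "openin (points S) W" and X: "tangent_field S W X" and Y: "tangent_field S W Y"
    and u: "u \<in> U" "\<phi> u \<in> W"
  shows "dirderiv S X Y (\<phi> u) = D2 x u (chart_vector X u) (chart_vector Y u) + D x u (D (chart_vector Y) u (chart_vector X u))"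
proof -
  let ?V = "U \<inter> \<phi> -` W"
  note V = chart_open_vimage[OF in_params W]
  have uV: "u \<in> ?V" using u by simp
  have sY: "smooth_fun S W Y" using Y by (simp add: tangent_field_def)
  have dY: "chart_vector Y differentiable (at u)" using smooth_on_imp_differentiable[OF smooth_chart_vector[OF W sY] uV] .
  have "dirderiv S X Y (\<phi> u) = D (Y \<circ> \<phi>) u (chart_vector X u)"
    by (rule dirderiv_chart_vector[OF u(1) _ field_differentiable[OF sY u]]) (use X u in \<open>auto simp: tangent_field_def\<close>)
  also have "D (Y \<circ> \<phi>) u = D (\<lambda>v. D x v (chart_vector Y v)) u"
  proof (rule D_cong[OF V uV])
    show "D x v (chart_vector Y v) = (Y \<circ> \<phi>) v" if "v \<in> ?V" for v
      using D_x_chart_vector[of v Y] Y that by (auto simp: tangent_field_def)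
    show "(\<lambda>v. D x v (chart_vector Y v)) differentiable (at u)"
      by (rule smooth_on_imp_differentiable[OF smooth_on_D_along[OF _ smooth_chart_vector[OF W sY] V] uV])
        (rule smooth_on_subset[OF smooth_x], auto)
  qed
  finally show ?thesis using D_D_along[OF smooth_x open_U u(1) dY] by simp
qed

lemma tangent_part_D_x: "u \<in> U \<Longrightarrow> tangent_part u (D x u b) = D x u b"
  by (rule tangent_part_of_tangent) (simp_all add: tangent_space_chart[OF in_params])

lemma second_fundamental_form_chart:
  assumes W: "openin (points S) W" and X: "tangent_field S W X" and Y: "tangent_field S W Y"
    and u: "u \<in> U" "\<phi> u \<in> W"
  shows "second_fundamental_form S X Y (\<phi> u) = N u (D2 x u (chart_vector X u) (chart_vector Y u))"
  unfolding second_fundamental_form_def levi_civita_chart[OF assms] dirderiv_field[OF assms]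
  by (simp add: N_eq linear_add[OF linear_tangent_part] tangent_part_D_x[OF u(1)])

definition Hess :: "(real^2 \<Rightarrow> 'b::real_normed_vector) \<Rightarrow> real^2 \<Rightarrow> real^2 \<Rightarrow> real^2 \<Rightarrow> 'b" where
  "Hess G u a b = D2 G u a b - D G u (\<Gamma> u a b)"

text \<open>Both terms contain the derivative of the coordinates of \<open>Y\<close>, and it
  cancels. What is left is minus the covariant Hessian, which depends on the fields only through
  their values at the point.\<close>

lemma Hess_chart:
  assumes W: "openin (points S) W" and X: "tangent_field S W X" and Y: "tangent_field S W Y"
    and u: "u \<in> U" "\<phi> u \<in> W" and G: "smooth_on U (G \<circ> \<phi>)"
  shows "dirderiv S (levi_civita S X Y) G (\<phi> u) - dirderiv S X (dirderiv S Y G) (\<phi> u)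
    = - Hess (G \<circ> \<phi>) u (chart_vector X u) (chart_vector Y u)"
proof -
  let ?V = "U \<inter> \<phi> -` W" and ?G = "G \<circ> \<phi>"
  note V = chart_open_vimage[OF in_params W]
  have uV: "u \<in> ?V" using u by simp
  have sY: "smooth_fun S W Y" using Y by (simp add: tangent_field_def)
  have dY: "chart_vector Y differentiable (at u)" using smooth_on_imp_differentiable[OF smooth_chart_vector[OF W sY] uV] .
  have dG: "?G differentiable (at v)" if "v \<in> U" for v using df[OF G that] .
  have "levi_civita S X Y (\<phi> u) = D x u (\<Gamma> u (chart_vector X u) (chart_vector Y u) + D (chart_vector Y) u (chart_vector X u))"
    unfolding levi_civita_chart[OF W X Y u] dirderiv_field[OF W X Y u]
    by (simp add: linear_add[OF linear_tangent_part] tangent_part_D_x[OF u(1)] D_x_\<Gamma>[OF u(1)]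
        linear_add[OF linear_Dx[OF u(1)]])
  from dirderiv_chart[where X = "levi_civita S X Y", OF in_params u(1) this dG[OF u(1)]]
  have 1: "dirderiv S (levi_civita S X Y) G (\<phi> u)
      = D ?G u (\<Gamma> u (chart_vector X u) (chart_vector Y u)) + D ?G u (D (chart_vector Y) u (chart_vector X u))"
    by (simp add: linear_add[OF linear_D[OF dG[OF u(1)]]])
  have sm: "smooth_on ?V (\<lambda>v. D ?G v (chart_vector Y v))"
    by (rule smooth_on_D_along[OF smooth_on_subset[OF G] smooth_chart_vector[OF W sY] V]) auto
  have eq: "D ?G v (chart_vector Y v) = (dirderiv S Y G \<circ> \<phi>) v" if "v \<in> ?V" for v
    using dirderiv_chart_vector[of v Y G] dG Y that by (auto simp: tangent_field_def)
  have dd: "(dirderiv S Y G \<circ> \<phi>) differentiable (at u)"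
    using smooth_on_imp_differentiable[OF smooth_on_cong[OF sm V eq] uV] .
  have "dirderiv S X (dirderiv S Y G) (\<phi> u) = D (dirderiv S Y G \<circ> \<phi>) u (chart_vector X u)"
    by (rule dirderiv_chart_vector[OF u(1) _ dd]) (use X u in \<open>auto simp: tangent_field_def\<close>)
  also have "D (dirderiv S Y G \<circ> \<phi>) u = D (\<lambda>v. D ?G v (chart_vector Y v)) u"
    by (rule D_cong[OF V uV eq smooth_on_imp_differentiable[OF sm uV]])
  finally show ?thesis
    unfolding 1 Hess_def using D_D_along[OF G open_U u(1) dY] by simp
qed

lemma linear_Hess:
  assumes G: "smooth_on U G" and u: "u \<in> U"
  shows "linear (\<lambda>a. Hess G u a b)" "linear (\<lambda>b. Hess G u a b)"
proof -
  note l = linear_D2[OF G open_U u] linear_D2[OF smooth_x open_U u] linear_D[OF df[OF G u]]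
  show "linear (\<lambda>a. Hess G u a b)" "linear (\<lambda>b. Hess G u a b)"
    by (rule linearI; simp add: Hess_def \<Gamma>_def linear_add[OF l(1)] linear_add[OF l(2)] linear_add[OF l(3)]
        linear_add[OF l(4)] linear_add[OF l(5)] linear_scale[OF l(1)] linear_scale[OF l(2)]
        linear_scale[OF l(3)] linear_scale[OF l(4)] linear_scale[OF l(5)] mink_simps algebra_simps)+
qed

section \<open>Independence of the orthonormal tangent frame\<close>

lemma frame_change:
  assumes f: "tangent_frame S W f1 f2" and u: "u \<in> U" "\<phi> u \<in> W"
  obtains c11 c12 c21 c22 where
    "f1 (\<phi> u) = c11 *\<^sub>R E1 u + c12 *\<^sub>R E2 u" "f2 (\<phi> u) = c21 *\<^sub>R E1 u + c22 *\<^sub>R E2 u"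
    "chart_vector f1 u = c11 *\<^sub>R a1 u + c12 *\<^sub>R a2 u" "chart_vector f2 u = c21 *\<^sub>R a1 u + c22 *\<^sub>R a2 u"
    "c11 * c11 + c21 * c21 = 1" "c12 * c12 + c22 * c22 = 1" "c11 * c12 + c21 * c22 = 0"
    "(c11 * c22 - c12 * c21)\<^sup>2 = 1"
proof -
  define c11 c12 c21 c22 where "c11 = mink (f1 (\<phi> u)) (E1 u)" "c12 = mink (f1 (\<phi> u)) (E2 u)"
    "c21 = mink (f2 (\<phi> u)) (E1 u)" "c22 = mink (f2 (\<phi> u)) (E2 u)"
  note c = this
  have t: "f1 (\<phi> u) \<in> tangent_space S (\<phi> u)" "f2 (\<phi> u) \<in> tangent_space S (\<phi> u)"
    and o: "mink (f1 (\<phi> u)) (f1 (\<phi> u)) = 1" "mink (f2 (\<phi> u)) (f2 (\<phi> u)) = 1" "mink (f1 (\<phi> u)) (f2 (\<phi> u)) = 0"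
    using f u by (auto simp: tangent_frame_def tangent_field_def)
  have e: "f1 (\<phi> u) = c11 *\<^sub>R E1 u + c12 *\<^sub>R E2 u" "f2 (\<phi> u) = c21 *\<^sub>R E1 u + c22 *\<^sub>R E2 u"
    using t unfolding tangent_iff[OF u(1)] c by blast+
  have "c11 * c11 + c12 * c12 = 1" "c21 * c21 + c22 * c22 = 1" "c11 * c21 + c12 * c22 = 0"
    using o unfolding e by (simp_all add: mink_simps mink_E[OF u(1)] mult.commute)
  from orthogonal_columns[OF this] show thesis
    by (intro that[OF e]) (simp_all add: chart_vector_def c)
qed

text \<open>An orthogonal change of frame drops out of the trace, since its columns have unit length
  and the mixed terms vanish. For the second fundamental form and the Hessian this justifies the
  definite descriptions of the mean curvature vector and the Laplacian.\<close>

lemma trace_frame: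
  assumes f: "tangent_frame S W f1 f2" and u: "u \<in> U" "\<phi> u \<in> W"
    and B: "\<And>b. linear (\<lambda>a. B a b)" "\<And>a. linear (B a)"
  shows "B (chart_vector f1 u) (chart_vector f1 u) + B (chart_vector f2 u) (chart_vector f2 u) = B (a1 u) (a1 u) + B (a2 u) (a2 u)"
proof -
  obtain c11 c12 c21 c22 where
    c: "chart_vector f1 u = c11 *\<^sub>R a1 u + c12 *\<^sub>R a2 u" "chart_vector f2 u = c21 *\<^sub>R a1 u + c22 *\<^sub>R a2 u"
    and o: "c11 * c11 + c21 * c21 = 1" "c12 * c12 + c22 * c22 = 1" "c11 * c12 + c21 * c22 = 0"
    using frame_change[OF f u] by metis
  note l = linear_add[OF B(1)] linear_add[OF B(2)] linear_scale[OF B(1)] linear_scale[OF B(2)]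
  have "B (chart_vector f1 u) (chart_vector f1 u) + B (chart_vector f2 u) (chart_vector f2 u)
      = (c11 * c11 + c21 * c21) *\<^sub>R B (a1 u) (a1 u) + (c12 * c12 + c22 * c22) *\<^sub>R B (a2 u) (a2 u)
      + (c11 * c12 + c21 * c22) *\<^sub>R (B (a1 u) (a2 u) + B (a2 u) (a1 u))"
    unfolding c by (simp add: l algebra_simps)
  then show ?thesis by (simp add: o)
qed

lemma D2_x_frame:
  assumes "u \<in> U"
  shows "d1 E1 u = D2 x u (a1 u) (a1 u) + D x u (d1 a1 u)"
    "d2 E2 u = D2 x u (a2 u) (a2 u) + D x u (d2 a2 u)"
  using D_D_along[OF smooth_x open_U assms df[OF smooth_a1 assms]]
    D_D_along[OF smooth_x open_U assms df[OF smooth_a2 assms]]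
  by (simp_all add: E1_def[abs_def] E2_def[abs_def])

lemma mean_curvature_chart:
  assumes u: "u \<in> U"
  shows "mean_curvature S (\<phi> u) = Hm u"
proof -
  let ?B = "\<lambda>a b. N u (D2 x u a b)"
  have lin: "linear (\<lambda>a. ?B a b)" "linear (?B a)" for a b
    using linear_compose[OF linear_D2(1)[OF smooth_x open_U u] linear_normal_part]
      linear_compose[OF linear_D2(2)[OF smooth_x open_U u] linear_normal_part]
    by (simp_all add: comp_def)
  have "?B (a1 u) (a1 u) = h11 u" "?B (a2 u) (a2 u) = h22 u"
    by (simp_all add: h11_def h22_def D2_x_frame[OF u] normal_part_simps N_tangent[OF u])
  then have H: "Hm u = (1/2) *\<^sub>R (?B (a1 u) (a1 u) + ?B (a2 u) (a2 u))" by (simp add: Hm_def)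
  have any: "(1/2) *\<^sub>R (second_fundamental_form S f1 f1 (\<phi> u) + second_fundamental_form S f2 f2 (\<phi> u)) = Hm u"
    if "\<phi> u \<in> W" and f: "tangent_frame S W f1 f2" for W f1 f2
  proof -
    have W: "openin (points S) W" and t: "tangent_field S W f1" "tangent_field S W f2"
      using f by (auto simp: tangent_frame_def)
    show ?thesis
      unfolding second_fundamental_form_chart[OF W t(1) t(1) u that(1)]
        second_fundamental_form_chart[OF W t(2) t(2) u that(1)] H trace_frame[OF f u that(1) lin] ..
  qed
  have "\<phi> u \<in> \<phi> ` U" using u by simp
  note own = any[OF this tangent_frame_push]
  show ?thesis
    unfolding mean_curvature_def
  proof (rule the_equality)
    show "\<exists>W f1 f2. \<phi> u \<in> W \<and> tangent_frame S W f1 f2 \<and>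
        Hm u = (1/2) *\<^sub>R (second_fundamental_form S f1 f1 (\<phi> u) + second_fundamental_form S f2 f2 (\<phi> u))"
      using own[symmetric] tangent_frame_push \<open>\<phi> u \<in> \<phi> ` U\<close> by blast
  qed (use any in blast)
qed

text \<open>Joins two descriptions of one operator: \<open>lap\<close>, suited to the structure
  equations, and the trace of the Hessian, which does not depend on the frame. The link is that
  \<omega>1 \<open>a2\<close>, the covariant derivative of \<open>a1\<close> along itself, is
  \<Gamma> plus the plain derivative of \<open>a1\<close>; similarly for \<open>a2\<close>.\<close>

lemma lap_eq_Hess:
  assumes G: "smooth_on U G" and u: "u \<in> U"
  shows "lap G u = - (Hess G u (a1 u) (a1 u) + Hess G u (a2 u) (a2 u))"
proof -
  note lin = linear_D[OF df[OF G u]]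
  have g: "\<Gamma> u (a1 u) (a1 u) = \<omega>1 u *\<^sub>R a2 u - d1 a1 u" "\<Gamma> u (a2 u) (a2 u) = - (\<omega>2 u *\<^sub>R a1 u) - d2 a2 u"
  proof -
    have e: "D2 x u (a1 u) (a1 u) = \<omega>1 u *\<^sub>R E2 u + h11 u - D x u (d1 a1 u)"
      "D2 x u (a2 u) (a2 u) = - (\<omega>2 u *\<^sub>R E1 u) + h22 u - D x u (d2 a2 u)"
      using D2_x_frame[OF u] structure_equations[OF u] by (simp_all add: algebra_simps)
    have "\<Gamma> u (a1 u) (a1 u) = \<omega>1 u *\<^sub>R a2 u
        - (mink (D x u (d1 a1 u)) (E1 u) *\<^sub>R a1 u + mink (D x u (d1 a1 u)) (E2 u) *\<^sub>R a2 u)"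
      unfolding \<Gamma>_def e by (simp add: mink_simps mink_E[OF u] mink_h[OF u] algebra_simps)
    then show "\<Gamma> u (a1 u) (a1 u) = \<omega>1 u *\<^sub>R a2 u - d1 a1 u"
      by (simp only: tangent_coords[OF u, symmetric])
    have "\<Gamma> u (a2 u) (a2 u) = - (\<omega>2 u *\<^sub>R a1 u)
        - (mink (D x u (d2 a2 u)) (E1 u) *\<^sub>R a1 u + mink (D x u (d2 a2 u)) (E2 u) *\<^sub>R a2 u)"
      unfolding \<Gamma>_def e by (simp add: mink_simps mink_E[OF u] mink_h[OF u] algebra_simps)
    then show "\<Gamma> u (a2 u) (a2 u) = - (\<omega>2 u *\<^sub>R a1 u) - d2 a2 u"
      by (simp only: tangent_coords[OF u, symmetric])
  qed
  have "d1 (d1 G) u = D2 G u (a1 u) (a1 u) + D G u (d1 a1 u)"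
    "d2 (d2 G) u = D2 G u (a2 u) (a2 u) + D G u (d2 a2 u)"
    by (rule D_D_along[OF G open_U u df[OF smooth_a1 u]] D_D_along[OF G open_U u df[OF smooth_a2 u]])+
  then show ?thesis
    by (simp add: lap_def Hess_def g linear_diff[OF lin] linear_neg[OF lin] linear_scale[OF lin])
qed

lemma laplacian_chart:
  assumes G: "smooth_on U (G \<circ> \<phi>)" and u: "u \<in> U"
  shows "laplacian S G (\<phi> u) = lap (G \<circ> \<phi>) u"
proof -
  have any: "(dirderiv S (levi_civita S f1 f1) G (\<phi> u) - dirderiv S f1 (dirderiv S f1 G) (\<phi> u))
      + (dirderiv S (levi_civita S f2 f2) G (\<phi> u) - dirderiv S f2 (dirderiv S f2 G) (\<phi> u)) = lap (G \<circ> \<phi>) u"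
    if "\<phi> u \<in> W" and f: "tangent_frame S W f1 f2" for W f1 f2
  proof -
    have W: "openin (points S) W" and t: "tangent_field S W f1" "tangent_field S W f2"
      using f by (auto simp: tangent_frame_def)
    show ?thesis
      unfolding Hess_chart[OF W t(1) t(1) u that(1) G] Hess_chart[OF W t(2) t(2) u that(1) G]
        lap_eq_Hess[OF G u] trace_frame[OF f u that(1) linear_Hess[OF G u], symmetric]
      by simp
  qed
  have "\<phi> u \<in> \<phi> ` U" using u by simp
  note own = any[OF this tangent_frame_push]
  show ?thesis
    unfolding laplacian_def
  proof (rule the_equality)
    show "\<exists>W f1 f2. \<phi> u \<in> W \<and> tangent_frame S W f1 f2 \<and> lap (G \<circ> \<phi>) u =
        (dirderiv S (levi_civita S f1 f1) G (\<phi> u) - dirderiv S f1 (dirderiv S f1 G) (\<phi> u))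
      + (dirderiv S (levi_civita S f2 f2) G (\<phi> u) - dirderiv S f2 (dirderiv S f2 G) (\<phi> u))"
      using own[symmetric] tangent_frame_push \<open>\<phi> u \<in> \<phi> ` U\<close> by blast
  qed (use any in blast)
qed

section \<open>Normal frame, Gauss map and normal connection in a chart\<close>

lemma smooth_normals:
  "smooth_on U (\<lambda>u. space_normal (E1 u) (E2 u))" "smooth_on U (\<lambda>u. time_normal (E1 u) (E2 u))"
proof -
  have t: "smooth_on U (\<lambda>u. N u (axis 1 1))" by (rule smooth_N[OF smooth_on_const])
  show s: "smooth_on U (\<lambda>u. time_normal (E1 u) (E2 u))"
    unfolding time_normal_def Let_def
    by (intro smooth_on_scaleR smooth_on_inverse_sqrt smooth_on_uminus smooth_mink t open_U)
      (simp add: mink_time_axis_normal[OF orthonormal_E])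
  show "smooth_on U (\<lambda>u. space_normal (E1 u) (E2 u))"
    unfolding space_normal_def
    by (intro smooth_on_uminus smooth_on_bilinear[OF bounded_bilinear_contract]
        smooth_on_linear[OF _ _ bounded_linear_hodge] smooth_wedge smooth_E s open_U)
qed

lemma oriented_frame_push:
  "oriented_frame S (\<phi> ` U) (push E1) (push E2) (push (\<lambda>u. space_normal (E1 u) (E2 u)))
     (push (\<lambda>u. time_normal (E1 u) (E2 u)))"
proof -
  have "positive_pair S (\<phi> u) (E1 u) (E2 u)" if "u \<in> U" for u
    unfolding E1_def E2_def positive_pair_chart[OF in_params that] by (rule positive[OF that])
  then show ?thesis
    unfolding oriented_frame_def normal_field_def
    using tangent_frame_push smooth_normals time_space_normal[OF orthonormal_E]
    by (auto simp: push_chart smooth_push normal_iff)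
qed

text \<open>An orthonormal tangent frame differs from \<open>E1\<close>, \<open>E2\<close> by an
  orthogonal matrix. Positivity of both excludes determinant -1, so the tangent bivectors agree, and
  with them their Hodge duals, which are the normal bivectors.\<close>

lemma gauss_map_chart:
  assumes u: "u \<in> U"
  shows "gauss_map S (\<phi> u) = hodge (\<tau> u)"
proof -
  have any: "wedge (f3 (\<phi> u)) (f4 (\<phi> u)) = hodge (\<tau> u)"
    if W: "\<phi> u \<in> W" and f: "oriented_frame S W f1 f2 f3 f4" for W f1 f2 f3 f4
  proof -
    have tf: "tangent_frame S W f1 f2" using f by (simp add: oriented_frame_def)
    obtain c11 c12 c21 c22 where
      e: "f1 (\<phi> u) = c11 *\<^sub>R E1 u + c12 *\<^sub>R E2 u" "f2 (\<phi> u) = c21 *\<^sub>R E1 u + c22 *\<^sub>R E2 u"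
      and c: "chart_vector f1 u = c11 *\<^sub>R a1 u + c12 *\<^sub>R a2 u" "chart_vector f2 u = c21 *\<^sub>R a1 u + c22 *\<^sub>R a2 u"
      and sq: "(c11 * c22 - c12 * c21)\<^sup>2 = 1"
      using frame_change[OF tf u W] by metis
    have T: "f1 (\<phi> u) \<in> tangent_space S (\<phi> u)" "f2 (\<phi> u) \<in> tangent_space S (\<phi> u)"
      and nf: "f3 (\<phi> u) \<in> normal_space S (\<phi> u)" "f4 (\<phi> u) \<in> normal_space S (\<phi> u)"
      using f W by (auto simp: oriented_frame_def tangent_frame_def tangent_field_def normal_field_def)
    have "positive_pair S (\<phi> u) (D x u (chart_vector f1 u)) (D x u (chart_vector f2 u))"
      using f W D_x_chart_vector[of u f1] D_x_chart_vector[of u f2] u T by (simp add: oriented_frame_def)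
    then have "det (vector [chart_vector f1 u, chart_vector f2 u] :: real^2^2) > 0"
      by (simp only: positive_pair_chart[OF in_params u])
    moreover have "det (vector [chart_vector f1 u, chart_vector f2 u] :: real^2^2)
        = (c11 * c22 - c12 * c21) * det (vector [a1 u, a2 u] :: real^2^2)"
      unfolding c by (simp add: det_2 algebra_simps)
    ultimately have "c11 * c22 - c12 * c21 > 0" using positive[OF u] by (simp add: zero_less_mult_iff)
    then have "c11 * c22 - c12 * c21 = 1" using sq by (simp add: power2_eq_1_iff)
    moreover have "wedge (f1 (\<phi> u)) (f2 (\<phi> u)) = (c11 * c22 - c12 * c21) *\<^sub>R \<tau> u"
      unfolding e \<tau>_def by (simp add: wedge_simps wedge_commute[of "E2 u" "E1 u"] algebra_simps)
    ultimately have "wedge (f1 (\<phi> u)) (f2 (\<phi> u)) = \<tau> u" by simp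
    moreover have "wedge (f3 (\<phi> u)) (f4 (\<phi> u)) = hodge (wedge (f1 (\<phi> u)) (f2 (\<phi> u)))"
      using f W T nf unfolding oriented_frame_def tangent_frame_def normal_space_def
      by (intro wedge_normals_eq_hodge) (auto simp: orthonormal_pair_def mink_commute)
    ultimately show ?thesis by simp
  qed
  have "\<phi> u \<in> \<phi> ` U" using u by simp
  note own = any[OF this oriented_frame_push]
  show ?thesis
    unfolding gauss_map_def
  proof (rule the_equality)
    show "\<exists>W f1 f2 f3 f4. \<phi> u \<in> W \<and> oriented_frame S W f1 f2 f3 f4 \<and> hodge (\<tau> u) = wedge (f3 (\<phi> u)) (f4 (\<phi> u))"
      using own[symmetric] oriented_frame_push \<open>\<phi> u \<in> \<phi> ` U\<close> by blast
  qed (use any in blast)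
qed

lemma normal_connection_chart:
  assumes u: "u \<in> U" and X: "X (\<phi> u) \<in> tangent_space S (\<phi> u)"
    and \<xi>: "(\<xi> \<circ> \<phi>) differentiable (at u)"
  shows "normal_connection S X \<xi> (\<phi> u) = N u (D (\<xi> \<circ> \<phi>) u (chart_vector X u))"
proof -
  let ?w = "D (\<xi> \<circ> \<phi>) u (chart_vector X u)"
  have w: "dirderiv S X \<xi> (\<phi> u) = ?w" by (rule dirderiv_chart_vector[where X = X, OF u X \<xi>])
  have "shape_operator S \<xi> X (\<phi> u) = - tangent_part u ?w"
    unfolding shape_operator_def w
  proof (rule the_equality)
    show "- tangent_part u ?w \<in> tangent_space S (\<phi> u) \<and> ?w + - tangent_part u ?w \<in> normal_space S (\<phi> u)"
      by (simp add: tangent_iff[OF u] normal_iff[OF u] mink_simps mink_tangent_part[OF u])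
        (simp add: tangent_part_def)
    fix v assume "v \<in> tangent_space S (\<phi> u) \<and> ?w + v \<in> normal_space S (\<phi> u)"
    then have v: "v = mink v (E1 u) *\<^sub>R E1 u + mink v (E2 u) *\<^sub>R E2 u"
      and "mink v (E1 u) = - mink ?w (E1 u)" "mink v (E2 u) = - mink ?w (E2 u)"
      by (auto simp: tangent_iff[OF u] normal_iff[OF u] mink_simps)
    then show "v = - tangent_part u ?w" by (simp add: tangent_part_def)
  qed
  then show ?thesis by (simp add: normal_connection_def w N_eq)
qed

end

section \<open>The Gauss map and the mean curvature vector\<close>

context framed_patch
begin

lemma lap_cong:
  assumes "smooth_on U F" "u \<in> U" "\<And>v. v \<in> U \<Longrightarrow> G v = F v"
  shows "lap G u = lap F u"
proof -
  have D: "D G v b = D F v b" if "v \<in> U" for v b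
    by (rule D_cong_smooth[OF assms(1) that assms(3)])
  have "d1 (d1 G) u = d1 (d1 F) u" "d2 (d2 G) u = d2 (d2 F) u"
    using D_cong_smooth[OF smooth_d(1)[OF assms(1)] assms(2) D]
      D_cong_smooth[OF smooth_d(2)[OF assms(1)] assms(2) D] by blast+
  then show ?thesis by (simp add: lap_def D assms(2))
qed

lemma lap_linear:
  assumes F: "smooth_on U F" and u: "u \<in> U" and L: "bounded_linear L"
  shows "lap (\<lambda>v. L (F v)) u = L (lap F u)"
proof -
  note LF = bounded_linear.linear[OF L]
  have D: "D (\<lambda>v. L (F v)) v b = L (D F v b)" if "v \<in> U" for v b
    by (rule D_linear[OF L df[OF F that]])
  have "d1 (d1 (\<lambda>v. L (F v))) u = d1 (\<lambda>v. L (d1 F v)) u" "d2 (d2 (\<lambda>v. L (F v))) u = d2 (\<lambda>v. L (d2 F v)) u"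
    using D_cong_smooth[OF smooth_on_linear[OF smooth_d(1)[OF F] open_U L] u D]
      D_cong_smooth[OF smooth_on_linear[OF smooth_d(2)[OF F] open_U L] u D] by blast+
  then show ?thesis
    by (simp add: lap_def D[OF u] D_linear[OF L df[OF smooth_d(1)[OF F] u]]
        D_linear[OF L df[OF smooth_d(2)[OF F] u]] linear_add[OF LF] linear_diff[OF LF]
        linear_neg[OF LF] linear_scale[OF LF])
qed

lemma hodge_hodge_\<tau>: "hodge (hodge (\<tau> u)) = - \<tau> u"
  by (simp add: \<tau>_def hodge_hodge_wedge)

lemma \<tau>_nonzero:
  assumes "u \<in> U" shows "\<tau> u \<noteq> 0"
proof
  assume "\<tau> u = 0"
  then have "mink (contract (\<tau> u) (E2 u)) (E1 u) = 0" by (simp add: contract_simps mink_simps)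
  then show False by (simp add: \<tau>_def contract_wedge mink_E[OF assms])
qed

text \<open>By the formula for \<open>lap \<tau>\<close> this is a combination of wedge products, so
  the square of \<open>hodge\<close> is -1 on it; an eigen-equation for the dual can then be pulled
  back to \<tau>.\<close>

lemma hodge_hodge_lap_\<tau>:
  assumes "u \<in> U" shows "hodge (hodge (lap \<tau> u)) = - lap \<tau> u"
  unfolding lap_\<tau>[OF assms] \<tau>_def by (simp add: hodge_simps hodge_hodge_wedge)

end

context framed_chart
begin

lemma smooth_gauss_map: "smooth_on U (gauss_map S \<circ> \<phi>)"
  by (rule smooth_on_cong[OF smooth_on_linear[OF smooth_\<tau> open_U bounded_linear_hodge] open_U])
    (simp add: gauss_map_chart)

lemma laplacian_gauss_map:
  assumes u: "u \<in> U"
  shows "laplacian S (gauss_map S) (\<phi> u) = hodge (lap \<tau> u)"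
proof -
  have "lap (gauss_map S \<circ> \<phi>) u = lap (\<lambda>v. hodge (\<tau> v)) u"
    by (rule lap_cong[OF smooth_on_linear[OF smooth_\<tau> open_U bounded_linear_hodge] u])
      (simp add: gauss_map_chart)
  then show ?thesis
    by (simp add: laplacian_chart[OF smooth_gauss_map u] lap_linear[OF smooth_\<tau> u bounded_linear_hodge])
qed

lemma gauss_map_nonzero:
  assumes "u \<in> U" shows "gauss_map S (\<phi> u) \<noteq> 0"
proof
  assume "gauss_map S (\<phi> u) = 0"
  then have "hodge (hodge (\<tau> u)) = 0" by (simp add: gauss_map_chart[OF assms] hodge_simps)
  then show False using \<tau>_nonzero[OF assms] by (simp add: hodge_hodge_\<tau>)
qed

lemma mean_curvature_comp:
  assumes "u \<in> U"
  shows "(mean_curvature S \<circ> \<phi>) differentiable (at u)" "D (mean_curvature S \<circ> \<phi>) u b = D Hm u b"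
proof -
  have "smooth_on U (mean_curvature S \<circ> \<phi>)"
    by (rule smooth_on_cong[OF smooth_Hm open_U]) (simp add: mean_curvature_chart)
  then show "(mean_curvature S \<circ> \<phi>) differentiable (at u)" using df assms by blast
  show "D (mean_curvature S \<circ> \<phi>) u b = D Hm u b"
    by (rule D_cong_smooth[OF smooth_Hm assms]) (simp add: mean_curvature_chart)
qed

text \<open>Parallelism is stated for tangent fields; a constant direction \<open>b\<close> of the
  parameter plane yields such a field on the chart image.\<close>

lemma parallel_imp_N_D_Hm:
  assumes par: "parallel_mean_curvature S" and u: "u \<in> U"
  shows "N u (D Hm u b) = 0"
proof -
  let ?X = "push (\<lambda>v. D x v b)"
  have X: "tangent_field S (\<phi> ` U) ?X"
    by (rule tangent_push[OF smooth_on_D[OF smooth_x]]) (simp add: tangent_space_chart[OF in_params])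
  have Xu: "?X (\<phi> u) = D x u b" by (simp add: push_chart[OF u])
  then have t: "?X (\<phi> u) \<in> tangent_space S (\<phi> u)" by (simp add: tangent_space_chart[OF in_params u])
  have "chart_vector ?X u = b"
    using D_x_chart_vector[of u ?X, OF u t] Xu inj_D[OF u] by (simp add: inj_eq)
  moreover have "normal_connection S ?X (mean_curvature S) (\<phi> u) = 0"
    using par X chart_openin[OF in_params] u unfolding parallel_mean_curvature_def by blast
  ultimately show ?thesis
    using normal_connection_chart[of u ?X "mean_curvature S", OF u t mean_curvature_comp(1)[OF u]]
    by (simp add: mean_curvature_comp(2)[OF u])
qed

lemma gauss_eigen_imp_normal_connection:
  assumes eq: "laplacian S (gauss_map S) (\<phi> u) = c *\<^sub>R gauss_map S (\<phi> u)" and u: "u \<in> U"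
    and X: "X (\<phi> u) \<in> tangent_space S (\<phi> u)"
  shows "normal_connection S X (mean_curvature S) (\<phi> u) = 0"
proof -
  have "hodge (hodge (lap \<tau> u)) = hodge (c *\<^sub>R hodge (\<tau> u))"
    using eq by (simp add: laplacian_gauss_map[OF u] gauss_map_chart[OF u])
  then have "lap \<tau> u = c *\<^sub>R \<tau> u"
    by (simp add: hodge_hodge_lap_\<tau>[OF u] hodge_simps hodge_hodge_\<tau>)
  from lap_\<tau>_eigen_imp_parallel[OF u this] show ?thesis
    using normal_connection_chart[of u X "mean_curvature S", OF u X mean_curvature_comp(1)[OF u]]
    by (simp add: mean_curvature_comp(2)[OF u])
qed

lemma parallel_imp_gauss_eigen:
  assumes par: "parallel_mean_curvature S" and u: "u \<in> U" and ne: "mean_curvature S (\<phi> u) \<noteq> 0"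
  shows "laplacian S (gauss_map S) (\<phi> u) = norm_h u *\<^sub>R gauss_map S (\<phi> u)"
  using parallel_imp_lap_\<tau>_eigen[OF parallel_imp_N_D_Hm[OF par] u] ne
  by (simp add: mean_curvature_chart[OF u] laplacian_gauss_map[OF u] gauss_map_chart[OF u] hodge_simps)

lemma mean_curvature_zero_near:
  assumes par: "parallel_mean_curvature S" and u: "u \<in> U" and zero: "mean_curvature S (\<phi> u) = 0"
  shows "\<exists>W. openin (points S) W \<and> \<phi> u \<in> W \<and> (\<forall>q\<in>W. mean_curvature S q = 0)"
proof -
  obtain r where r: "r > 0" "ball u r \<subseteq> U" "\<And>v. v \<in> ball u r \<Longrightarrow> Hm v = 0"
    using parallel_zero_locally[OF parallel_imp_N_D_Hm[OF par] u] zero by (auto simp: mean_curvature_chart[OF u])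
  then have "\<forall>q\<in>\<phi> ` ball u r. mean_curvature S q = 0" using mean_curvature_chart by auto
  moreover have "\<phi> u \<in> \<phi> ` ball u r" using r(1) by simp
  ultimately show ?thesis using chart_open_image[OF in_params open_ball r(2)] by blast
qed

lemma mean_curvature_nonzero_near:
  assumes u: "u \<in> U" and ne: "mean_curvature S (\<phi> u) \<noteq> 0"
  shows "\<exists>W. openin (points S) W \<and> \<phi> u \<in> W \<and> (\<forall>q\<in>W. mean_curvature S q \<noteq> 0)"
proof -
  let ?V = "U \<inter> Hm -` (- {0})"
  have "open ?V"
    by (rule continuous_open_preimage[OF smooth_on_imp_continuous_on[OF smooth_Hm] open_U]) auto
  then have "openin (points S) (\<phi> ` ?V)" by (rule chart_open_image[OF in_params]) auto
  moreover have "\<phi> u \<in> \<phi> ` ?V" using u ne by (simp add: mean_curvature_chart[OF u])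
  moreover have "\<forall>q\<in>\<phi> ` ?V. mean_curvature S q \<noteq> 0" using mean_curvature_chart by auto
  ultimately show ?thesis by blast
qed

end

section \<open>From charts to the whole surface\<close>

context spacelike_surface
begin

lemma framed_chart_exists:
  assumes "(U, \<phi>) \<in> params S"
  obtains a1 a2 where "framed_chart S U \<phi> a1 a2"
proof -
  obtain a1 a2 where "framed_patch U (position S \<circ> \<phi>) a1 a2" using framing_exists[OF assms] .
  then have "framed_chart S U \<phi> a1 a2"
    by (intro framed_chart.intro spacelike_surface_axioms framed_chart_axioms.intro assms)
  then show thesis by (rule that)
qed

lemma framed_chart_at:
  assumes "p \<in> topspace (points S)"
  obtains U \<phi> a1 a2 u where "framed_chart S U \<phi> a1 a2" "u \<in> U" "p = \<phi> u"
proof -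
  obtain U \<phi> u where c: "(U, \<phi>) \<in> params S" "u \<in> U" "\<phi> u = p"
    using chart_cover[OF assms] .
  moreover obtain a1 a2 where "framed_chart S U \<phi> a1 a2" using framed_chart_exists[OF c(1)] .
  ultimately show thesis using that by blast
qed

text \<open>The zero set of H is open by the uniqueness estimate for parallel fields, its complement
  by continuity. As the complement is nonempty, a zero would disconnect the surface.\<close>

lemma mean_curvature_nowhere_zero:
  assumes conn: "connected_space (points S)" and nmax: "\<not> maximal S"
    and par: "parallel_mean_curvature S" and p: "p \<in> topspace (points S)"
  shows "mean_curvature S p \<noteq> 0"
proof
  assume zero: "mean_curvature S p = 0"
  let ?A = "{q \<in> topspace (points S). mean_curvature S q = 0}"
  let ?B = "{q \<in> topspace (points S). mean_curvature S q \<noteq> 0}"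
  have near_A: "\<exists>W. openin (points S) W \<and> q \<in> W \<and> W \<subseteq> ?A" if q: "q \<in> ?A" for q
  proof -
    from q obtain U \<phi> a1 a2 u where c: "framed_chart S U \<phi> a1 a2" "u \<in> U" "q = \<phi> u"
      using framed_chart_at by blast
    have "mean_curvature S (\<phi> u) = 0" using q c(3) by simp
    from framed_chart.mean_curvature_zero_near[OF c(1) par c(2) this]
    obtain W where W: "openin (points S) W" "\<phi> u \<in> W" "\<forall>q\<in>W. mean_curvature S q = 0" by blast
    have "W \<subseteq> topspace (points S)" by (rule openin_subset[OF W(1)])
    then show ?thesis using W c(3) by blast
  qed
  have open_A: "openin (points S) ?A"
    by (subst openin_subopen) (intro ballI near_A)
  have near_B: "\<exists>W. openin (points S) W \<and> q \<in> W \<and> W \<subseteq> ?B" if q: "q \<in> ?B" for q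
  proof -
    from q obtain U \<phi> a1 a2 u where c: "framed_chart S U \<phi> a1 a2" "u \<in> U" "q = \<phi> u"
      using framed_chart_at by blast
    have "mean_curvature S (\<phi> u) \<noteq> 0" using q c(3) by simp
    from framed_chart.mean_curvature_nonzero_near[OF c(1) c(2) this]
    obtain W where W: "openin (points S) W" "\<phi> u \<in> W" "\<forall>q\<in>W. mean_curvature S q \<noteq> 0" by blast
    have "W \<subseteq> topspace (points S)" by (rule openin_subset[OF W(1)])
    then show ?thesis using W c(3) by blast
  qed
  have open_B: "openin (points S) ?B"
    by (subst openin_subopen) (intro ballI near_B)
  have "?A \<inter> ?B = {}" "topspace (points S) \<subseteq> ?A \<union> ?B" by auto
  moreover have "?A \<noteq> {}" using zero p by blast
  moreover have "?B \<noteq> {}" using nmax by (auto simp: maximal_def)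
  ultimately show False using conn open_A open_B unfolding connected_space_def by blast
qed

end

theorem theorem4p4:
  fixes S :: "'m surface"
  assumes "oriented_spacelike_surface S"
    and "connected_space (points S)"
    and "\<not> maximal S"
  shows "pointwise_1type_gauss_first_kind S \<longleftrightarrow> parallel_mean_curvature S"
proof
  interpret spacelike_surface S by unfold_locales (rule assms(1))
  let ?T = "topspace (points S)" and ?L = "laplacian S (gauss_map S)" and ?\<nu> = "gauss_map S"
  show "parallel_mean_curvature S" if type1: "pointwise_1type_gauss_first_kind S"
    unfolding parallel_mean_curvature_def
  proof (intro allI impI ballI)
    fix W X p assume W: "openin (points S) W \<and> tangent_field S W X" and p: "p \<in> W"
    then have pT: "p \<in> ?T" using openin_subset by blast
    obtain U \<phi> a1 a2 u where c: "framed_chart S U \<phi> a1 a2" "u \<in> U" "p = \<phi> u"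
      using framed_chart_at[OF pT] .
    obtain r where "?L p = r *\<^sub>R ?\<nu> p"
      using type1 pT unfolding pointwise_1type_gauss_first_kind_def by blast
    then show "normal_connection S X (mean_curvature S) p = 0"
      unfolding c(3)
      by (rule framed_chart.gauss_eigen_imp_normal_connection[OF c(1) _ c(2)])
        (use W p c(3) in \<open>auto simp: tangent_field_def\<close>)
  qed
  show "pointwise_1type_gauss_first_kind S" if par: "parallel_mean_curvature S"
  proof -
    \<comment> \<open>The factor is chosen pointwise, but it is unique because the Gauss map
      vanishes nowhere. It therefore agrees with \<open>norm_h\<close> in every framed chart and is
      smooth, without a comparison of \<open>norm_h\<close> between charts.\<close>
    define f where "f p = (SOME c. ?L p = c *\<^sub>R ?\<nu> p)" for p
    have eigen: "?L (\<phi> u) = framed_patch.norm_h (position S \<circ> \<phi>) a1 a2 u *\<^sub>R ?\<nu> (\<phi> u)"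
      and f: "f (\<phi> u) = framed_patch.norm_h (position S \<circ> \<phi>) a1 a2 u"
      if c: "framed_chart S U \<phi> a1 a2" and u: "u \<in> U" for U \<phi> a1 a2 u
    proof -
      interpret framed_chart S U \<phi> a1 a2 by (rule c)
      show e: "?L (\<phi> u) = norm_h u *\<^sub>R ?\<nu> (\<phi> u)"
        using mean_curvature_nowhere_zero[OF assms(2,3) par chart_topspace[OF in_params u]]
        by (rule parallel_imp_gauss_eigen[OF par u])
      show "f (\<phi> u) = norm_h u"
        unfolding f_def e using gauss_map_nonzero[OF u] by simp
    qed
    have "smooth_fun S ?T f"
      unfolding smooth_fun_def
    proof safe
      fix U \<phi> assume U: "(U, \<phi>) \<in> params S"
      then obtain a1 a2 where c: "framed_chart S U \<phi> a1 a2" using framed_chart_exists by blast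
      interpret framed_chart S U \<phi> a1 a2 by (rule c)
      have "smooth_on U (f \<circ> \<phi>)"
        by (rule smooth_on_cong[OF smooth_norm_h open_U]) (simp add: f[OF c])
      then show "smooth_on (U \<inter> \<phi> -` ?T) (f \<circ> \<phi>)" by (rule smooth_on_subset) simp
    qed
    moreover have "?L p = f p *\<^sub>R ?\<nu> p" if "p \<in> ?T" for p
      using framed_chart_at[OF that] eigen f by metis
    ultimately show ?thesis unfolding pointwise_1type_gauss_first_kind_def by blast
  qed
qed

end
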